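(* Let $\mathcal C$ be a braided monoidal category, let $B$ be a bialgebra in $\mathcal C$, and let $F$ be an object of $\mathcal C$ which is a left $B$-module algebra and a left $B$-comodule coalgebra in $\mathcal C$. Then the following are equivalent: 1. the biproduct $F\times B$ is a bialgebra in $\mathcal C$; 2. $F$ is a bialgebra in ${}_B^B\mathcal{YD}(\mathcal C)$.
   Context: Let $c_{X,Y}:X\otimes Y\to Y\otimes X$ be the braiding of $\mathcal C$ (associativity and unit constraints are suppressed; an object also denotes its identity morphism). Let $(B,\mu_B,\eta_B,\Delta_B,\varepsilon_B)$ be a bialgebra in $\mathcal C$: an algebra and coalgebra such that $\Delta_B\mu_B=(\mu_B\otimes\mu_B)(B\otimes c_{B,B}\otimes B)(\Delta_B\otimes\Delta_B)$, $\varepsilon_B\mu_B=\varepsilon_B\otimes\varepsilon_B$, $\Delta_B\eta_B=\eta_B\otimes\eta_B$, $\varepsilon_B\eta_B=\mathrm{id}_I$. For left $B$-modules $X,Y$ with actions $\nu_X,\nu_Y$, the tensor product $X\otimes Y$ carries the action $(\nu_X\otimes\nu_Y)(B\otimes c_{B,X}\otimes Y)(\Delta_B\otimes X\otimes Y)$, and $I$ carries the action $\varepsilon_B$. For left $B$-comodules $X,Y$ with coactions $\delta_X:X\to B\otimes X$ and $\delta_Y$, the tensor product $X\otimes Y$ carries the coaction $(\mu_B\otimes X\otimes Y)(B\otimes c_{X,B}\otimes Y)(\delta_X\otimes\delta_Y)$, and $I$ carries the coaction $\eta_B$. The object $F$ is a left $B$-module algebra: it has an algebra structure $(\mu_F,\eta_F)$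 and a left $B$-action $\nu:B\otimes F\to F$ such that $\mu_F,\eta_F$ are morphisms of left $B$-modules. It is a left $B$-comodule coalgebra: it has a coalgebra structure $(\Delta_F,\varepsilon_F)$ and a left $B$-coaction $\delta:F\to B\otimes F$ such that $\Delta_F,\varepsilon_F$ are morphisms of left $B$-comodules. The biproduct $F\times B$ is the object $F\otimes B$ with multiplication $$(\mu_F\otimes\mu_B)(F\otimes\nu\otimes B\otimes B)(F\otimes B\otimes c_{B,F}\otimes B)(F\otimes\Delta_B\otimes F\otimes B)$$ (smash product), unit $\eta_F\otimes\eta_B$, comultiplication $$(F\otimes\mu_B\otimes F\otimes B)(F\otimes B\otimes c_{F,B}\otimes B)(F\otimes\delta\otimes\Delta_B)(\Delta_F\otimes B)$$ (smash coproduct), and counit $\varepsilon_F\otimes\varepsilon_B$. The category ${}_B^B\mathcal{YD}(\mathcal C)$ of left-left Yetter–Drinfel'd modules over $B$ in $\mathcal C$ has as objects those $X\in\mathcal C$ with a left $B$-module structure $\nu_X$ and a left $B$-comodule structure $\delta_X$ satisfying $$(\mu_B\otimes X)(B\otimes c_{X,B})(\delta_X\nu_X\otimes B)(B\otimes c_{B,X})(\Delta_B\otimes X)=(\mu_B\otimes\nu_X)(B\otimes c_{B,B}\otimes X)(\Delta_B\otimes\delta_X),$$ and as morphisms the morphisms of $\mathcal C$ that are both $B$-linear and $B$-colinear. It is monoidal, where $X\otimes Y$ carries the action $(\nu_X\otimes\nu_Y)(B\otimes c_{B,X}\otimes Y)(\Delta_B\otimes X\otimes Y)$ and the coaction $(\mu_B\otimes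 X\otimes Y)(B\otimes c_{X,B}\otimes Y)(\delta_X\otimes\delta_Y)$, and the unit object $I$ carries the action $\varepsilon_B$ and the coaction $\eta_B$; and it has the pre-braiding $d_{X,Y}=(\nu_Y\otimes X)(B\otimes c_{X,Y})(\delta_X\otimes Y):X\otimes Y\to Y\otimes X$. "$F$ is a bialgebra in ${}_B^B\mathcal{YD}(\mathcal C)$" means that, with the given structures $\nu,\delta,\mu_F,\eta_F,\Delta_F,\varepsilon_F$: $F$ is an object of ${}_B^B\mathcal{YD}(\mathcal C)$; all of $\mu_F,\eta_F,\Delta_F,\varepsilon_F$ are morphisms in ${}_B^B\mathcal{YD}(\mathcal C)$; and $\Delta_F\mu_F=(\mu_F\otimes\mu_F)(F\otimes d_{F,F}\otimes F)(\Delta_F\otimes\Delta_F)$, $\varepsilon_F\mu_F=\varepsilon_F\otimes\varepsilon_F$, $\Delta_F\eta_F=\eta_F\otimes\eta_F$, $\varepsilon_F\eta_F=\mathrm{id}_I$. *)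

theory Defs
  imports Main
begin

section \<open>Braided monoidal categories\<close>

text \<open>
  Categories have a set of objects and a set of arrows. Associativity and unit constraints are
  kept explicit: no strictness is assumed. \<open>\<a>[X,Y,Z] : (X \<odot> Y) \<odot> Z \<rightarrow> X \<odot> (Y \<odot> Z)\<close>,
  \<open>\<l>[X] : \<I> \<odot> X \<rightarrow> X\<close>, \<open>\<r>[X] : X \<odot> \<I> \<rightarrow> X\<close>, \<open>\<c>[X,Y] : X \<odot> Y \<rightarrow> Y \<odot> X\<close>. The tensor product is
  written \<open>\<odot>\<close> on objects and \<open>\<otimes>\<close> on arrows; \<open>g \<cdot> f\<close> is \<open>g\<close> after \<open>f\<close>.
\<close>

record ('o, 'm) cat =
  Obj :: "'o set"
  Arr :: "'m set"
  Dom :: "'m \<Rightarrow> 'o"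
  Cod :: "'m \<Rightarrow> 'o"
  idt :: "'o \<Rightarrow> 'm" ("\<i>\<index>[_]")
  cmp :: "'m \<Rightarrow> 'm \<Rightarrow> 'm" (infixr "\<cdot>\<index>" 55)

record ('o, 'm) monoidal_cat = "('o, 'm) cat" +
  tobj :: "'o \<Rightarrow> 'o \<Rightarrow> 'o" (infixl "\<odot>\<index>" 70)
  tarr :: "'m \<Rightarrow> 'm \<Rightarrow> 'm" (infixl "\<otimes>\<index>" 70)
  unt :: 'o ("\<I>\<index>")
  assc :: "'o \<Rightarrow> 'o \<Rightarrow> 'o \<Rightarrow> 'm" ("\<a>\<index>[_,_,_]")
  lunt :: "'o \<Rightarrow> 'm" ("\<l>\<index>[_]")
  runt :: "'o \<Rightarrow> 'm" ("\<r>\<index>[_]")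

record ('o, 'm) braided_cat = "('o, 'm) monoidal_cat" +
  brd :: "'o \<Rightarrow> 'o \<Rightarrow> 'm" ("\<c>\<index>[_,_]")

context
  fixes C :: "('o, 'm, 'x) cat_scheme" (structure)
begin

definition hom :: "'o \<Rightarrow> 'o \<Rightarrow> 'm set" where
  "hom X Y = {f \<in> Arr C. Dom C f = X \<and> Cod C f = Y}"

definition inverse_arrows :: "'m \<Rightarrow> 'm \<Rightarrow> bool" where
  "inverse_arrows f g \<longleftrightarrow>
     f \<in> Arr C \<and> g \<in> hom (Cod C f) (Dom C f) \<and>
     g \<cdot> f = \<i>[Dom C f] \<and> f \<cdot> g = \<i>[Cod C f]"

definition iso :: "'m \<Rightarrow> bool" where
  "iso f \<longleftrightarrow> (\<exists>g. inverse_arrows f g)"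

definition inverse_arrow :: "'m \<Rightarrow> 'm" where
  "inverse_arrow f = (THE g. inverse_arrows f g)"

end

abbreviation assc_inv ("\<a>\<^sup>-\<^sup>1\<index>[_,_,_]") where
  "\<a>\<^sup>-\<^sup>1\<^bsub>C\<^esub>[X,Y,Z] \<equiv> inverse_arrow C (\<a>\<^bsub>C\<^esub>[X,Y,Z])"

abbreviation lunt_inv ("\<l>\<^sup>-\<^sup>1\<index>[_]") where
  "\<l>\<^sup>-\<^sup>1\<^bsub>C\<^esub>[X] \<equiv> inverse_arrow C (\<l>\<^bsub>C\<^esub>[X])"

abbreviation runt_inv ("\<r>\<^sup>-\<^sup>1\<index>[_]") where
  "\<r>\<^sup>-\<^sup>1\<^bsub>C\<^esub>[X] \<equiv> inverse_arrow C (\<r>\<^bsub>C\<^esub>[X])"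

locale category =
  fixes C (structure)
  assumes Dom_Obj: "f \<in> Arr C \<Longrightarrow> Dom C f \<in> Obj C"
    and Cod_Obj: "f \<in> Arr C \<Longrightarrow> Cod C f \<in> Obj C"
    and idt_hom: "X \<in> Obj C \<Longrightarrow> \<i>[X] \<in> hom C X X"
    and cmp_hom: "f \<in> hom C X Y \<Longrightarrow> g \<in> hom C Y Z \<Longrightarrow> g \<cdot> f \<in> hom C X Z"
    and idt_right: "f \<in> hom C X Y \<Longrightarrow> f \<cdot> \<i>[X] = f"
    and idt_left: "f \<in> hom C X Y \<Longrightarrow> \<i>[Y] \<cdot> f = f"
    and cmp_assoc: "f \<in> hom C W X \<Longrightarrow> g \<in> hom C X Y \<Longrightarrow> h \<in> hom C Y Z \<Longrightarrow>
          (h \<cdot> g) \<cdot> f = h \<cdot> (g \<cdot> f)"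

locale monoidal_category = category C for C (structure) +
  assumes unt_Obj: "\<I> \<in> Obj C"
    and tobj_Obj: "X \<in> Obj C \<Longrightarrow> Y \<in> Obj C \<Longrightarrow> X \<odot> Y \<in> Obj C"
    and tarr_hom: "f \<in> hom C X Y \<Longrightarrow> g \<in> hom C X' Y' \<Longrightarrow> f \<otimes> g \<in> hom C (X \<odot> X') (Y \<odot> Y')"
    and tarr_idt: "X \<in> Obj C \<Longrightarrow> Y \<in> Obj C \<Longrightarrow> \<i>[X] \<otimes> \<i>[Y] = \<i>[X \<odot> Y]"
    and tarr_cmp: "f \<in> hom C X Y \<Longrightarrow> g \<in> hom C Y Z \<Longrightarrow>
          f' \<in> hom C X' Y' \<Longrightarrow> g' \<in> hom C Y' Z' \<Longrightarrow>
          (g \<cdot> f) \<otimes> (g' \<cdot> f') = (g \<otimes> g') \<cdot> (f \<otimes> f')"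
    and assc_hom: "X \<in> Obj C \<Longrightarrow> Y \<in> Obj C \<Longrightarrow> Z \<in> Obj C \<Longrightarrow>
          \<a>[X,Y,Z] \<in> hom C (X \<odot> Y \<odot> Z) (X \<odot> (Y \<odot> Z))"
    and assc_iso: "X \<in> Obj C \<Longrightarrow> Y \<in> Obj C \<Longrightarrow> Z \<in> Obj C \<Longrightarrow> iso C \<a>[X,Y,Z]"
    and assc_nat: "f \<in> hom C X X' \<Longrightarrow> g \<in> hom C Y Y' \<Longrightarrow> h \<in> hom C Z Z' \<Longrightarrow>
          \<a>[X',Y',Z'] \<cdot> (f \<otimes> g \<otimes> h) = (f \<otimes> (g \<otimes> h)) \<cdot> \<a>[X,Y,Z]"
    and lunt_hom: "X \<in> Obj C \<Longrightarrow> \<l>[X] \<in> hom C (\<I> \<odot> X) X"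
    and lunt_iso: "X \<in> Obj C \<Longrightarrow> iso C \<l>[X]"
    and lunt_nat: "f \<in> hom C X Y \<Longrightarrow> \<l>[Y] \<cdot> (\<i>[\<I>] \<otimes> f) = f \<cdot> \<l>[X]"
    and runt_hom: "X \<in> Obj C \<Longrightarrow> \<r>[X] \<in> hom C (X \<odot> \<I>) X"
    and runt_iso: "X \<in> Obj C \<Longrightarrow> iso C \<r>[X]"
    and runt_nat: "f \<in> hom C X Y \<Longrightarrow> \<r>[Y] \<cdot> (f \<otimes> \<i>[\<I>]) = f \<cdot> \<r>[X]"
    and pentagon: "W \<in> Obj C \<Longrightarrow> X \<in> Obj C \<Longrightarrow> Y \<in> Obj C \<Longrightarrow> Z \<in> Obj C \<Longrightarrow>
          \<a>[W,X,Y \<odot> Z] \<cdot> \<a>[W \<odot> X,Y,Z] =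
          (\<i>[W] \<otimes> \<a>[X,Y,Z]) \<cdot> \<a>[W,X \<odot> Y,Z] \<cdot> (\<a>[W,X,Y] \<otimes> \<i>[Z])"
    and triangle: "X \<in> Obj C \<Longrightarrow> Y \<in> Obj C \<Longrightarrow>
          (\<i>[X] \<otimes> \<l>[Y]) \<cdot> \<a>[X,\<I>,Y] = \<r>[X] \<otimes> \<i>[Y]"

locale braided_monoidal_category = monoidal_category C for C (structure) +
  assumes brd_hom: "X \<in> Obj C \<Longrightarrow> Y \<in> Obj C \<Longrightarrow> \<c>[X,Y] \<in> hom C (X \<odot> Y) (Y \<odot> X)"
    and brd_iso: "X \<in> Obj C \<Longrightarrow> Y \<in> Obj C \<Longrightarrow> iso C \<c>[X,Y]"
    and brd_nat: "f \<in> hom C X X' \<Longrightarrow> g \<in> hom C Y Y' \<Longrightarrow>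
          \<c>[X',Y'] \<cdot> (f \<otimes> g) = (g \<otimes> f) \<cdot> \<c>[X,Y]"
    and hexagon: "X \<in> Obj C \<Longrightarrow> Y \<in> Obj C \<Longrightarrow> Z \<in> Obj C \<Longrightarrow>
          \<a>[Y,Z,X] \<cdot> \<c>[X,Y \<odot> Z] \<cdot> \<a>[X,Y,Z] =
          (\<i>[Y] \<otimes> \<c>[X,Z]) \<cdot> \<a>[Y,X,Z] \<cdot> (\<c>[X,Y] \<otimes> \<i>[Z])"
    and hexagon': "X \<in> Obj C \<Longrightarrow> Y \<in> Obj C \<Longrightarrow> Z \<in> Obj C \<Longrightarrow>
          \<a>\<^sup>-\<^sup>1[Z,X,Y] \<cdot> \<c>[X \<odot> Y,Z] \<cdot> \<a>\<^sup>-\<^sup>1[X,Y,Z] =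
          (\<c>[X,Z] \<otimes> \<i>[Y]) \<cdot> \<a>\<^sup>-\<^sup>1[X,Z,Y] \<cdot> (\<i>[X] \<otimes> \<c>[Y,Z])"


section \<open>Algebras, coalgebras and bialgebras\<close>

text \<open>An object together with the structure arrows of an algebra and of a coalgebra.\<close>

record ('o, 'm) bialg =
  ob :: 'o
  mul :: 'm ("\<mu>\<index>")
  one :: 'm ("\<eta>\<index>")
  com :: 'm ("\<Delta>\<index>")
  cou :: 'm ("\<epsilon>\<index>")

context
  fixes C :: "('o, 'm, 'x) braided_cat_scheme" (structure)
begin

text \<open>
  The arrow \<open>X \<otimes> f \<otimes> W : (X \<odot> Y) \<odot> (Z \<odot> W) \<rightarrow> (X \<odot> Y') \<odot> (Z' \<odot> W)\<close>
  for \<open>f : Y \<odot> Z \<rightarrow> Y' \<odot> Z'\<close>, with the associativity constraints inserted.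
\<close>

definition mid :: "'o \<Rightarrow> 'o \<Rightarrow> 'o \<Rightarrow> 'm \<Rightarrow> 'o \<Rightarrow> 'o \<Rightarrow> 'o \<Rightarrow> 'm" where
  "mid X Y Z f Y' Z' W =
     \<a>\<^sup>-\<^sup>1[X,Y',Z' \<odot> W] \<cdot>
     (\<i>[X] \<otimes> (\<a>[Y',Z',W] \<cdot> (f \<otimes> \<i>[W]) \<cdot> \<a>\<^sup>-\<^sup>1[Y,Z,W])) \<cdot>
     \<a>[X,Y,Z \<odot> W]"

text \<open>The arrow \<open>X \<otimes> c\<^bsub>Y,Z\<^esub> : (X \<odot> Y) \<odot> Z \<rightarrow> (X \<odot> Z) \<odot> Y\<close>.\<close>

definition rbrd :: "'o \<Rightarrow> 'o \<Rightarrow> 'o \<Rightarrow> 'm" where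
  "rbrd X Y Z = \<a>\<^sup>-\<^sup>1[X,Z,Y] \<cdot> (\<i>[X] \<otimes> \<c>[Y,Z]) \<cdot> \<a>[X,Y,Z]"

definition algebra :: "('o, 'm) bialg \<Rightarrow> bool" where
  "algebra A \<longleftrightarrow>
     ob A \<in> Obj C \<and> \<mu>\<^bsub>A\<^esub> \<in> hom C (ob A \<odot> ob A) (ob A) \<and> \<eta>\<^bsub>A\<^esub> \<in> hom C \<I> (ob A) \<and>
     \<mu>\<^bsub>A\<^esub> \<cdot> (\<mu>\<^bsub>A\<^esub> \<otimes> \<i>[ob A]) = \<mu>\<^bsub>A\<^esub> \<cdot> (\<i>[ob A] \<otimes> \<mu>\<^bsub>A\<^esub>) \<cdot> \<a>[ob A,ob A,ob A] \<and>
     \<mu>\<^bsub>A\<^esub> \<cdot> (\<eta>\<^bsub>A\<^esub> \<otimes> \<i>[ob A]) = \<l>[ob A] \<and>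
     \<mu>\<^bsub>A\<^esub> \<cdot> (\<i>[ob A] \<otimes> \<eta>\<^bsub>A\<^esub>) = \<r>[ob A]"

definition coalgebra :: "('o, 'm) bialg \<Rightarrow> bool" where
  "coalgebra A \<longleftrightarrow>
     ob A \<in> Obj C \<and> \<Delta>\<^bsub>A\<^esub> \<in> hom C (ob A) (ob A \<odot> ob A) \<and> \<epsilon>\<^bsub>A\<^esub> \<in> hom C (ob A) \<I> \<and>
     \<a>[ob A,ob A,ob A] \<cdot> (\<Delta>\<^bsub>A\<^esub> \<otimes> \<i>[ob A]) \<cdot> \<Delta>\<^bsub>A\<^esub> = (\<i>[ob A] \<otimes> \<Delta>\<^bsub>A\<^esub>) \<cdot> \<Delta>\<^bsub>A\<^esub> \<and>
     \<l>[ob A] \<cdot> (\<epsilon>\<^bsub>A\<^esub> \<otimes> \<i>[ob A]) \<cdot> \<Delta>\<^bsub>A\<^esub> = \<i>[ob A] \<and>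
     \<r>[ob A] \<cdot> (\<i>[ob A] \<otimes> \<epsilon>\<^bsub>A\<^esub>) \<cdot> \<Delta>\<^bsub>A\<^esub> = \<i>[ob A]"

text \<open>
  Compatibility of the algebra and the coalgebra structure with respect to
  an arrow \<open>b : A \<odot> A \<rightarrow> A \<odot> A\<close> in the role of the (pre-)braiding.
\<close>

definition bialg_compat :: "'m \<Rightarrow> ('o, 'm) bialg \<Rightarrow> bool" where
  "bialg_compat b A \<longleftrightarrow>
     \<Delta>\<^bsub>A\<^esub> \<cdot> \<mu>\<^bsub>A\<^esub> =
       (\<mu>\<^bsub>A\<^esub> \<otimes> \<mu>\<^bsub>A\<^esub>) \<cdot> mid (ob A) (ob A) (ob A) b (ob A) (ob A) (ob A) \<cdot> (\<Delta>\<^bsub>A\<^esub> \<otimes> \<Delta>\<^bsub>A\<^esub>) \<and>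
     \<epsilon>\<^bsub>A\<^esub> \<cdot> \<mu>\<^bsub>A\<^esub> = \<l>[\<I>] \<cdot> (\<epsilon>\<^bsub>A\<^esub> \<otimes> \<epsilon>\<^bsub>A\<^esub>) \<and>
     \<Delta>\<^bsub>A\<^esub> \<cdot> \<eta>\<^bsub>A\<^esub> = (\<eta>\<^bsub>A\<^esub> \<otimes> \<eta>\<^bsub>A\<^esub>) \<cdot> \<l>\<^sup>-\<^sup>1[\<I>] \<and>
     \<epsilon>\<^bsub>A\<^esub> \<cdot> \<eta>\<^bsub>A\<^esub> = \<i>[\<I>]"

definition bialgebra :: "('o, 'm) bialg \<Rightarrow> bool" where
  "bialgebra A \<longleftrightarrow> algebra A \<and> coalgebra A \<and> bialg_compat (\<c>[ob A,ob A]) A"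


section \<open>Modules and comodules\<close>

definition left_module :: "('o, 'm) bialg \<Rightarrow> 'o \<Rightarrow> 'm \<Rightarrow> bool" where
  "left_module B X \<nu> \<longleftrightarrow>
     X \<in> Obj C \<and> \<nu> \<in> hom C (ob B \<odot> X) X \<and>
     \<nu> \<cdot> (\<mu>\<^bsub>B\<^esub> \<otimes> \<i>[X]) = \<nu> \<cdot> (\<i>[ob B] \<otimes> \<nu>) \<cdot> \<a>[ob B,ob B,X] \<and>
     \<nu> \<cdot> (\<eta>\<^bsub>B\<^esub> \<otimes> \<i>[X]) = \<l>[X]"

definition left_comodule :: "('o, 'm) bialg \<Rightarrow> 'o \<Rightarrow> 'm \<Rightarrow> bool" where
  "left_comodule B X \<delta> \<longleftrightarrow>
     X \<in> Obj C \<and> \<delta> \<in> hom C X (ob B \<odot> X) \<and>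
     \<a>[ob B,ob B,X] \<cdot> (\<Delta>\<^bsub>B\<^esub> \<otimes> \<i>[X]) \<cdot> \<delta> = (\<i>[ob B] \<otimes> \<delta>) \<cdot> \<delta> \<and>
     \<l>[X] \<cdot> (\<epsilon>\<^bsub>B\<^esub> \<otimes> \<i>[X]) \<cdot> \<delta> = \<i>[X]"

definition module_hom :: "('o, 'm) bialg \<Rightarrow> 'o \<Rightarrow> 'm \<Rightarrow> 'o \<Rightarrow> 'm \<Rightarrow> 'm set" where
  "module_hom B X \<nu>X Y \<nu>Y = {f \<in> hom C X Y. f \<cdot> \<nu>X = \<nu>Y \<cdot> (\<i>[ob B] \<otimes> f)}"

definition comodule_hom :: "('o, 'm) bialg \<Rightarrow> 'o \<Rightarrow> 'm \<Rightarrow> 'o \<Rightarrow> 'm \<Rightarrow> 'm set" where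
  "comodule_hom B X \<delta>X Y \<delta>Y = {f \<in> hom C X Y. \<delta>Y \<cdot> f = (\<i>[ob B] \<otimes> f) \<cdot> \<delta>X}"

definition tensor_act :: "('o, 'm) bialg \<Rightarrow> 'o \<Rightarrow> 'm \<Rightarrow> 'o \<Rightarrow> 'm \<Rightarrow> 'm" where
  "tensor_act B X \<nu>X Y \<nu>Y =
     (\<nu>X \<otimes> \<nu>Y) \<cdot> mid (ob B) (ob B) X (\<c>[ob B,X]) X (ob B) Y \<cdot> (\<Delta>\<^bsub>B\<^esub> \<otimes> \<i>[X \<odot> Y])"

definition tensor_coact :: "('o, 'm) bialg \<Rightarrow> 'o \<Rightarrow> 'm \<Rightarrow> 'o \<Rightarrow> 'm \<Rightarrow> 'm" where
  "tensor_coact B X \<delta>X Y \<delta>Y =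
     (\<mu>\<^bsub>B\<^esub> \<otimes> \<i>[X \<odot> Y]) \<cdot> mid (ob B) X (ob B) (\<c>[X,ob B]) (ob B) X Y \<cdot> (\<delta>X \<otimes> \<delta>Y)"

definition unit_act :: "('o, 'm) bialg \<Rightarrow> 'm" where
  "unit_act B = \<epsilon>\<^bsub>B\<^esub> \<cdot> \<r>[ob B]"

definition unit_coact :: "('o, 'm) bialg \<Rightarrow> 'm" where
  "unit_coact B = \<r>\<^sup>-\<^sup>1[ob B] \<cdot> \<eta>\<^bsub>B\<^esub>"

definition module_algebra :: "('o, 'm) bialg \<Rightarrow> ('o, 'm) bialg \<Rightarrow> 'm \<Rightarrow> bool" where
  "module_algebra B F \<nu> \<longleftrightarrow>
     algebra F \<and> left_module B (ob F) \<nu> \<and>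
     \<mu>\<^bsub>F\<^esub> \<in> module_hom B (ob F \<odot> ob F) (tensor_act B (ob F) \<nu> (ob F) \<nu>) (ob F) \<nu> \<and>
     \<eta>\<^bsub>F\<^esub> \<in> module_hom B \<I> (unit_act B) (ob F) \<nu>"

definition comodule_coalgebra :: "('o, 'm) bialg \<Rightarrow> ('o, 'm) bialg \<Rightarrow> 'm \<Rightarrow> bool" where
  "comodule_coalgebra B F \<delta> \<longleftrightarrow>
     coalgebra F \<and> left_comodule B (ob F) \<delta> \<and>
     \<Delta>\<^bsub>F\<^esub> \<in> comodule_hom B (ob F) \<delta> (ob F \<odot> ob F) (tensor_coact B (ob F) \<delta> (ob F) \<delta>) \<and>
     \<epsilon>\<^bsub>F\<^esub> \<in> comodule_hom B (ob F) \<delta> \<I> (unit_coact B)"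


section \<open>The biproduct\<close>

text \<open>
  By functoriality of the tensor product, the four-fold composite defining the smash product is
  \<open>(\<mu>\<^bsub>F\<^esub> \<otimes> \<mu>\<^bsub>B\<^esub>) (F \<otimes> \<psi> \<otimes> B)\<close> with \<open>\<psi> = (\<nu> \<otimes> B) (B \<otimes> c\<^bsub>B,F\<^esub>) (\<Delta>\<^bsub>B\<^esub> \<otimes> F) : B \<odot> F \<rightarrow> F \<odot> B\<close>, and
  the one defining the smash coproduct is \<open>(F \<otimes> \<phi> \<otimes> B) (\<Delta>\<^bsub>F\<^esub> \<otimes> \<Delta>\<^bsub>B\<^esub>)\<close> with
  \<open>\<phi> = (\<mu>\<^bsub>B\<^esub> \<otimes> F) (B \<otimes> c\<^bsub>F,B\<^esub>) (\<delta> \<otimes> B) : F \<odot> B \<rightarrow> B \<odot> F\<close>.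
\<close>

definition smash_mul :: "('o, 'm) bialg \<Rightarrow> ('o, 'm) bialg \<Rightarrow> 'm \<Rightarrow> 'm" where
  "smash_mul B F \<nu> =
     (\<mu>\<^bsub>F\<^esub> \<otimes> \<mu>\<^bsub>B\<^esub>) \<cdot>
     mid (ob F) (ob B) (ob F)
       ((\<nu> \<otimes> \<i>[ob B]) \<cdot> rbrd (ob B) (ob B) (ob F) \<cdot> (\<Delta>\<^bsub>B\<^esub> \<otimes> \<i>[ob F]))
       (ob F) (ob B) (ob B)"

definition smash_com :: "('o, 'm) bialg \<Rightarrow> ('o, 'm) bialg \<Rightarrow> 'm \<Rightarrow> 'm" where
  "smash_com B F \<delta> =
     mid (ob F) (ob F) (ob B)
       ((\<mu>\<^bsub>B\<^esub> \<otimes> \<i>[ob F]) \<cdot> rbrd (ob B) (ob F) (ob B) \<cdot> (\<delta> \<otimes> \<i>[ob B]))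
       (ob B) (ob F) (ob B) \<cdot>
     (\<Delta>\<^bsub>F\<^esub> \<otimes> \<Delta>\<^bsub>B\<^esub>)"

definition biproduct :: "('o, 'm) bialg \<Rightarrow> ('o, 'm) bialg \<Rightarrow> 'm \<Rightarrow> 'm \<Rightarrow> ('o, 'm) bialg" where
  "biproduct B F \<nu> \<delta> =
     \<lparr> ob = ob F \<odot> ob B,
       mul = smash_mul B F \<nu>,
       one = (\<eta>\<^bsub>F\<^esub> \<otimes> \<eta>\<^bsub>B\<^esub>) \<cdot> \<l>\<^sup>-\<^sup>1[\<I>],
       com = smash_com B F \<delta>,
       cou = \<l>[\<I>] \<cdot> (\<epsilon>\<^bsub>F\<^esub> \<otimes> \<epsilon>\<^bsub>B\<^esub>) \<rparr>"


section \<open>Yetter--Drinfel'd modules\<close>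

text \<open>An object of the category is given as a triple: underlying object, action, coaction.\<close>

fun yd_module :: "('o, 'm) bialg \<Rightarrow> 'o \<times> 'm \<times> 'm \<Rightarrow> bool" where
  "yd_module B (X, \<nu>, \<delta>) \<longleftrightarrow>
     left_module B X \<nu> \<and> left_comodule B X \<delta> \<and>
     (\<mu>\<^bsub>B\<^esub> \<otimes> \<i>[X]) \<cdot> rbrd (ob B) X (ob B) \<cdot> ((\<delta> \<cdot> \<nu>) \<otimes> \<i>[ob B]) \<cdot>
       rbrd (ob B) (ob B) X \<cdot> (\<Delta>\<^bsub>B\<^esub> \<otimes> \<i>[X]) =
     (\<mu>\<^bsub>B\<^esub> \<otimes> \<nu>) \<cdot> mid (ob B) (ob B) (ob B) (\<c>[ob B,ob B]) (ob B) (ob B) X \<cdot> (\<Delta>\<^bsub>B\<^esub> \<otimes> \<delta>)"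

fun yd_hom :: "('o, 'm) bialg \<Rightarrow> 'o \<times> 'm \<times> 'm \<Rightarrow> 'o \<times> 'm \<times> 'm \<Rightarrow> 'm set" where
  "yd_hom B (X, \<nu>X, \<delta>X) (Y, \<nu>Y, \<delta>Y) = module_hom B X \<nu>X Y \<nu>Y \<inter> comodule_hom B X \<delta>X Y \<delta>Y"

fun yd_tensor :: "('o, 'm) bialg \<Rightarrow> 'o \<times> 'm \<times> 'm \<Rightarrow> 'o \<times> 'm \<times> 'm \<Rightarrow> 'o \<times> 'm \<times> 'm" where
  "yd_tensor B (X, \<nu>X, \<delta>X) (Y, \<nu>Y, \<delta>Y) =
     (X \<odot> Y, tensor_act B X \<nu>X Y \<nu>Y, tensor_coact B X \<delta>X Y \<delta>Y)"

definition yd_unit :: "('o, 'm) bialg \<Rightarrow> 'o \<times> 'm \<times> 'm" where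
  "yd_unit B = (\<I>, unit_act B, unit_coact B)"

fun yd_brd :: "('o, 'm) bialg \<Rightarrow> 'o \<times> 'm \<times> 'm \<Rightarrow> 'o \<times> 'm \<times> 'm \<Rightarrow> 'm" where
  "yd_brd B (X, \<nu>X, \<delta>X) (Y, \<nu>Y, \<delta>Y) =
     (\<nu>Y \<otimes> \<i>[X]) \<cdot> rbrd (ob B) X Y \<cdot> (\<delta>X \<otimes> \<i>[Y])"

text \<open>
  The constraints of the Yetter--Drinfel'd category are those of \<open>C\<close>, so the (co)algebra axioms
  for \<open>F\<close> there are the ones in \<open>C\<close>.
\<close>

definition yd_bialgebra :: "('o, 'm) bialg \<Rightarrow> ('o, 'm) bialg \<Rightarrow> 'm \<Rightarrow> 'm \<Rightarrow> bool" where
  "yd_bialgebra B F \<nu> \<delta> \<longleftrightarrow> (let M = (ob F, \<nu>, \<delta>) in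
     yd_module B M \<and> algebra F \<and> coalgebra F \<and>
     \<mu>\<^bsub>F\<^esub> \<in> yd_hom B (yd_tensor B M M) M \<and> \<eta>\<^bsub>F\<^esub> \<in> yd_hom B (yd_unit B) M \<and>
     \<Delta>\<^bsub>F\<^esub> \<in> yd_hom B M (yd_tensor B M M) \<and> \<epsilon>\<^bsub>F\<^esub> \<in> yd_hom B M (yd_unit B) \<and>
     bialg_compat (yd_brd B M M) F)"

end

end

theory Submission
  imports Defs
begin

text \<open>
  The functors \<open>X \<odot> _\<close> compose strictly associatively. Reading every arrow \<open>f\<close> as the natural
  family \<open>f \<otimes> Z\<close> on iterated functors of this kind therefore removes all constraints, and an
  equation between composites of structure arrows becomes an equation between string diagrams.
  These may be rewritten by interchange, by naturality of the braiding and by the axioms.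

  If \<open>F \<times> B\<close> is a bialgebra, each condition on \<open>F\<close> is one of the bialgebra axioms of \<open>F \<times> B\<close>,
  restricted along \<open>\<eta>\<close> to a factor in every input and followed by \<open>\<epsilon>\<close> on some of the outputs: the
  restriction to \<open>F \<odot> F\<close> gives the compatibility in the Yetter--Drinfel'd category and the
  colinearity of \<open>\<mu>\<close>, the restriction to \<open>B \<odot> F\<close> gives the linearity of \<open>\<Delta>\<close> and the
  Yetter--Drinfel'd condition. Conversely these conditions suffice to rewrite both sides of
  every axiom for \<open>F \<times> B\<close> to a common diagram.
\<close>

section \<open>Coherence\<close>

text \<open>The compatibility axiom of the biproduct relates arrows on four tensor factors, and its
  derivation takes well over a hundred interchanges and rewritings. Diagrams are therefore encoded
  as data and derivations as lists of moves; replaying such a list is a computation, proved sound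
  once. The encoding loses nothing because \<open>f\<close> is recovered from its family at
  \<open>\<I>\<close>, and it supports local rewriting because families are natural in
  \<open>Z\<close>, so that strands may be added on either side.

  The four main conditions on \<open>F\<close> are four components of one axiom,
  \<open>BiCompat\<close>. Of the inputs \<open>F, B, F, B\<close> either both \<open>F\<close> or
  the middle pair \<open>B, F\<close> are kept, and likewise of the outputs. The inputs
  \<open>F, F\<close> give the compatibility for outputs \<open>F, F\<close> and the colinearity of
  \<open>\<mu>\<close> for outputs \<open>B, F\<close>; the inputs \<open>B, F\<close> give the
  linearity of \<open>\<Delta>\<close> and the Yetter-Drinfel'd condition in the same way. Where a
  unit or counit of \<open>F\<close> is inserted for this, it has to be carried through
  \<open>\<Delta>\<close>, \<open>\<delta>\<close>, \<open>\<mu>\<close> or \<open>\<nu>\<close>,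
  which is why the unit and counit conditions on \<open>F\<close> are extracted beforehand.\<close>

context category
begin

lemma hom_Obj: "f \<in> hom C X Y \<Longrightarrow> X \<in> Obj C" "f \<in> hom C X Y \<Longrightarrow> Y \<in> Obj C"
  using Dom_Obj Cod_Obj by (auto simp: hom_def)

text \<open>Makes the definite description in \<open>inverse_arrow\<close> denote.\<close>

lemma inverse_arrow_eqI:
  assumes "inverse_arrows C f g" "inverse_arrows C f h"
  shows "h = g"
proof -
  let ?X = "Dom C f" and ?Y = "Cod C f"
  have f: "f \<in> hom C ?X ?Y" using assms by (auto simp: inverse_arrows_def hom_def)
  have g: "g \<in> hom C ?Y ?X" "h \<in> hom C ?Y ?X" using assms by (auto simp: inverse_arrows_def)
  have "h = h \<cdot> (f \<cdot> g)" using assms idt_right[OF g(2)] by (simp add: inverse_arrows_def)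
  also have "\<dots> = (h \<cdot> f) \<cdot> g" using cmp_assoc[OF g(1) f g(2)] by simp
  also have "\<dots> = g" using assms idt_left[OF g(1)] by (simp add: inverse_arrows_def)
  finally show ?thesis .
qed

lemma inverse_arrow:
  assumes "iso C f" "f \<in> hom C X Y"
  shows "inverse_arrow C f \<in> hom C Y X" "inverse_arrow C f \<cdot> f = \<i>[X]" "f \<cdot> inverse_arrow C f = \<i>[Y]"
proof -
  obtain g where g: "inverse_arrows C f g" using assms by (auto simp: iso_def)
  have "inverse_arrows C f (inverse_arrow C f)"
    unfolding inverse_arrow_def by (rule theI[of _ g]) (use g inverse_arrow_eqI in blast)+
  then show "inverse_arrow C f \<in> hom C Y X" "inverse_arrow C f \<cdot> f = \<i>[X]" "f \<cdot> inverse_arrow C f = \<i>[Y]"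
    using assms(2) by (auto simp: inverse_arrows_def hom_def)
qed

lemma isoI:
  assumes "f \<in> hom C X Y" "g \<in> hom C Y X" "g \<cdot> f = \<i>[X]" "f \<cdot> g = \<i>[Y]"
  shows "iso C f"
  using assms unfolding iso_def inverse_arrows_def by (auto simp: hom_def)

lemma iso_cmp:
  assumes "iso C f" "iso C g" "f \<in> hom C X Y" "g \<in> hom C Y Z"
  shows "iso C (g \<cdot> f)"
proof -
  let ?f = "inverse_arrow C f" and ?g = "inverse_arrow C g"
  note F = inverse_arrow[OF assms(1,3)] and G = inverse_arrow[OF assms(2,4)]
  have "(?f \<cdot> ?g) \<cdot> (g \<cdot> f) = ?f \<cdot> ((?g \<cdot> g) \<cdot> f)"
    using cmp_assoc[OF assms(3,4) G(1)] cmp_assoc[OF cmp_hom[OF assms(3,4)] G(1) F(1)] by simp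
  also have "\<dots> = \<i>[X]" using F G idt_left[OF assms(3)] by simp
  finally have 1: "(?f \<cdot> ?g) \<cdot> (g \<cdot> f) = \<i>[X]" .
  have "(g \<cdot> f) \<cdot> (?f \<cdot> ?g) = g \<cdot> ((f \<cdot> ?f) \<cdot> ?g)"
    using cmp_assoc[OF G(1) F(1) assms(3)] cmp_assoc[OF cmp_hom[OF G(1) F(1)] assms(3,4)] by simp
  also have "\<dots> = \<i>[Z]" using F G idt_left[OF G(1)] by simp
  finally have 2: "(g \<cdot> f) \<cdot> (?f \<cdot> ?g) = \<i>[Z]" .
  show ?thesis by (rule isoI[OF cmp_hom[OF assms(3,4)] cmp_hom[OF G(1) F(1)] 1 2])
qed

lemma iso_idt: "X \<in> Obj C \<Longrightarrow> iso C \<i>[X]"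
  by (rule isoI[of _ X X "\<i>[X]"]) (simp_all add: idt_hom idt_left[OF idt_hom])

lemma iso_cancel_right:
  assumes "iso C k" "k \<in> hom C X Y" "f \<in> hom C Y Z" "g \<in> hom C Y Z" "f \<cdot> k = g \<cdot> k"
  shows "f = g"
proof -
  note K = inverse_arrow[OF assms(1,2)]
  have "f = (f \<cdot> k) \<cdot> inverse_arrow C k"
    using cmp_assoc[OF K(1) assms(2,3)] K idt_right[OF assms(3)] by simp
  also have "\<dots> = g"
    using cmp_assoc[OF K(1) assms(2,4)] K idt_right[OF assms(4)] assms(5) by simp
  finally show ?thesis .
qed

lemma iso_cancel_left:
  assumes "iso C k" "k \<in> hom C Y Z" "f \<in> hom C X Y" "g \<in> hom C X Y" "k \<cdot> f = k \<cdot> g"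
  shows "f = g"
proof -
  note K = inverse_arrow[OF assms(1,2)]
  have "f = inverse_arrow C k \<cdot> (k \<cdot> f)"
    using cmp_assoc[OF assms(3,2) K(1)] K idt_left[OF assms(3)] by simp
  also have "\<dots> = g"
    using cmp_assoc[OF assms(4,2) K(1)] K idt_left[OF assms(4)] assms(5) by simp
  finally show ?thesis .
qed

end

section \<open>Functoriality of the tensor product and the left unit constraint\<close>

context monoidal_category
begin

lemma inverse_hom [simp]:
  assumes "X \<in> Obj C" "Y \<in> Obj C" "Z \<in> Obj C"
  shows "\<a>\<^sup>-\<^sup>1[X,Y,Z] \<in> hom C (X \<odot> (Y \<odot> Z)) (X \<odot> Y \<odot> Z)"
    "\<l>\<^sup>-\<^sup>1[X] \<in> hom C X (\<I> \<odot> X)" "\<r>\<^sup>-\<^sup>1[X] \<in> hom C X (X \<odot> \<I>)"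
  by (rule inverse_arrow[OF assc_iso assc_hom] inverse_arrow[OF lunt_iso lunt_hom]
      inverse_arrow[OF runt_iso runt_hom] assms)+

lemmas hom_rules = unt_Obj tobj_Obj cmp_hom tarr_hom idt_hom assc_hom lunt_hom runt_hom inverse_hom

lemma iso_tarr:
  assumes "iso C f" "iso C g" "f \<in> hom C X Y" "g \<in> hom C X' Y'"
  shows "iso C (f \<otimes> g)"
proof -
  note F = inverse_arrow[OF assms(1,3)] and G = inverse_arrow[OF assms(2,4)]
  show ?thesis
    by (rule isoI[OF tarr_hom[OF assms(3,4)] tarr_hom[OF F(1) G(1)]])
      (use tarr_cmp[OF assms(3) F(1) assms(4) G(1)] tarr_cmp[OF F(1) assms(3) G(1) assms(4)] F G
        hom_Obj[OF assms(3)] hom_Obj[OF assms(4)] in \<open>simp_all add: tarr_idt\<close>)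
qed

lemma tarr_left:
  assumes "X \<in> Obj C" "f \<in> hom C Y Z" "g \<in> hom C Z W"
  shows "(\<i>[X] \<otimes> g) \<cdot> (\<i>[X] \<otimes> f) = \<i>[X] \<otimes> (g \<cdot> f)"
  using tarr_cmp[OF idt_hom idt_hom assms(2,3)] assms(1) idt_left[OF idt_hom] by simp

lemma tarr_right:
  assumes "X \<in> Obj C" "f \<in> hom C Y Z" "g \<in> hom C Z W"
  shows "(g \<otimes> \<i>[X]) \<cdot> (f \<otimes> \<i>[X]) = (g \<cdot> f) \<otimes> \<i>[X]"
  using tarr_cmp[OF assms(2,3) idt_hom idt_hom] assms(1) idt_left[OF idt_hom] by simp

lemma tarr_split:
  assumes "f \<in> hom C X Y" "g \<in> hom C X' Y'"
  shows "(\<i>[Y] \<otimes> g) \<cdot> (f \<otimes> \<i>[X']) = f \<otimes> g" "(f \<otimes> \<i>[Y']) \<cdot> (\<i>[X] \<otimes> g) = f \<otimes> g"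
  using tarr_cmp[OF assms(1) idt_hom idt_hom assms(2)] tarr_cmp[OF idt_hom assms(1) assms(2) idt_hom]
    hom_Obj[OF assms(1)] hom_Obj[OF assms(2)]
    idt_left[OF assms(1)] idt_left[OF assms(2)] idt_right[OF assms(1)] idt_right[OF assms(2)] by simp_all

text \<open>The left unit constraint is a natural isomorphism from \<open>\<I> \<odot> _\<close> to
  the identity functor, which makes the former faithful.\<close>

lemma unt_tarr_inject:
  assumes "f \<in> hom C X Y" "g \<in> hom C X Y" "\<i>[\<I>] \<otimes> f = \<i>[\<I>] \<otimes> g"
  shows "f = g"
  by (rule iso_cancel_right[OF lunt_iso lunt_hom assms(1,2)])
    (use lunt_nat[OF assms(1)] lunt_nat[OF assms(2)] assms(3) hom_Obj[OF assms(1)] in simp_all)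

lemma tarr_unt_inject:
  assumes "f \<in> hom C X Y" "g \<in> hom C X Y" "f \<otimes> \<i>[\<I>] = g \<otimes> \<i>[\<I>]"
  shows "f = g"
  by (rule iso_cancel_right[OF runt_iso runt_hom assms(1,2)])
    (use runt_nat[OF assms(1)] runt_nat[OF assms(2)] assms(3) hom_Obj[OF assms(1)] in simp_all)

text \<open>Kelly's consequence of pentagon and triangle. Both sides are tensored with
  \<open>\<I>\<close> on the left and composed with the two associators that precede
  \<open>\<i>[\<I>] \<otimes> \<a>[\<I>,X,Y]\<close> in the pentagon for
  \<open>\<I>, \<I>, X, Y\<close>. The pentagon and two triangles then identify them, and the added
  factor and associators cancel.\<close>

lemma lunt_tensor:
  assumes X: "X \<in> Obj C" and Y: "Y \<in> Obj C"
  shows "\<l>[X \<odot> Y] \<cdot> \<a>[\<I>,X,Y] = \<l>[X] \<otimes> \<i>[Y]"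
proof (rule unt_tarr_inject)
  note O = X Y unt_Obj
  note h = hom_rules O
  let ?a = "\<a>[\<I>,\<I>,X] \<otimes> \<i>[Y]"
  have k: "\<a>[\<I>,\<I> \<odot> X,Y] \<cdot> ?a \<in> hom C (\<I> \<odot> \<I> \<odot> X \<odot> Y) (\<I> \<odot> (\<I> \<odot> X \<odot> Y))"
    by (rule h)+
  have kiso: "iso C (\<a>[\<I>,\<I> \<odot> X,Y] \<cdot> ?a)"
    by (rule iso_cmp iso_tarr assc_iso iso_idt h)+
  show "\<l>[X \<odot> Y] \<cdot> \<a>[\<I>,X,Y] \<in> hom C (\<I> \<odot> X \<odot> Y) (X \<odot> Y)" "\<l>[X] \<otimes> \<i>[Y] \<in> hom C (\<I> \<odot> X \<odot> Y) (X \<odot> Y)"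
    by (rule h)+
  have "(\<i>[\<I>] \<otimes> (\<l>[X \<odot> Y] \<cdot> \<a>[\<I>,X,Y])) \<cdot> (\<a>[\<I>,\<I> \<odot> X,Y] \<cdot> ?a)
      = (\<i>[\<I>] \<otimes> \<l>[X \<odot> Y]) \<cdot> ((\<i>[\<I>] \<otimes> \<a>[\<I>,X,Y]) \<cdot> (\<a>[\<I>,\<I> \<odot> X,Y] \<cdot> ?a))"
    by (subst tarr_left[symmetric]; (rule h cmp_assoc)+)
  also have "\<dots> = (\<i>[\<I>] \<otimes> \<l>[X \<odot> Y]) \<cdot> (\<a>[\<I>,\<I>,X \<odot> Y] \<cdot> \<a>[\<I> \<odot> \<I>,X,Y])"
    using pentagon[of \<I> \<I> X Y] O by simp
  also have "\<dots> = ((\<i>[\<I>] \<otimes> \<l>[X \<odot> Y]) \<cdot> \<a>[\<I>,\<I>,X \<odot> Y]) \<cdot> \<a>[\<I> \<odot> \<I>,X,Y]"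
    by (rule cmp_assoc[symmetric]; (rule h)+)
  also have "\<dots> = (\<r>[\<I>] \<otimes> (\<i>[X] \<otimes> \<i>[Y])) \<cdot> \<a>[\<I> \<odot> \<I>,X,Y]"
    using triangle[of \<I> "X \<odot> Y"] O by (simp add: tobj_Obj tarr_idt)
  also have "\<dots> = \<a>[\<I>,X,Y] \<cdot> (\<r>[\<I>] \<otimes> \<i>[X] \<otimes> \<i>[Y])"
    by (rule assc_nat[symmetric]; (rule h)+)
  also have "\<dots> = \<a>[\<I>,X,Y] \<cdot> ((\<i>[\<I>] \<otimes> \<l>[X] \<otimes> \<i>[Y]) \<cdot> ?a)"
    by (subst tarr_right; ((rule h)+)?) (simp add: triangle O)
  also have "\<dots> = (\<a>[\<I>,X,Y] \<cdot> (\<i>[\<I>] \<otimes> \<l>[X] \<otimes> \<i>[Y])) \<cdot> ?a"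
    by (rule cmp_assoc[symmetric]; (rule h)+)
  also have "\<dots> = ((\<i>[\<I>] \<otimes> (\<l>[X] \<otimes> \<i>[Y])) \<cdot> \<a>[\<I>,\<I> \<odot> X,Y]) \<cdot> ?a"
    by (subst assc_nat; ((rule h)+)?) simp
  also have "\<dots> = (\<i>[\<I>] \<otimes> (\<l>[X] \<otimes> \<i>[Y])) \<cdot> (\<a>[\<I>,\<I> \<odot> X,Y] \<cdot> ?a)"
    by (rule cmp_assoc; (rule h)+)
  finally have eq: "(\<i>[\<I>] \<otimes> (\<l>[X \<odot> Y] \<cdot> \<a>[\<I>,X,Y])) \<cdot> (\<a>[\<I>,\<I> \<odot> X,Y] \<cdot> ?a)
      = (\<i>[\<I>] \<otimes> (\<l>[X] \<otimes> \<i>[Y])) \<cdot> (\<a>[\<I>,\<I> \<odot> X,Y] \<cdot> ?a)" .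
  show "\<i>[\<I>] \<otimes> (\<l>[X \<odot> Y] \<cdot> \<a>[\<I>,X,Y]) = \<i>[\<I>] \<otimes> (\<l>[X] \<otimes> \<i>[Y])"
    by (rule iso_cancel_right[OF kiso k _ _ eq]; (rule h)+)
qed

end

section \<open>Bracketed words and their flattening\<close>

datatype 'l tree = Unt | Leaf 'l | Tens "'l tree" "'l tree"

text \<open>Forgets brackets and units alike, so trees related by constraints have equal
  leaves.\<close>

primrec leaves :: "'l tree \<Rightarrow> 'l list" where
  "leaves Unt = []"
| "leaves (Leaf x) = [x]"
| "leaves (Tens s t) = leaves s @ leaves t"

locale diagrams = braided_monoidal_category C for C :: "('o, 'm, 'x) braided_cat_scheme" (structure) +
  fixes lobj :: "'l \<Rightarrow> 'o"
  assumes lobj_Obj: "lobj x \<in> Obj C"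
begin

primrec obj :: "'l tree \<Rightarrow> 'o" where
  "obj Unt = \<I>"
| "obj (Leaf x) = lobj x"
| "obj (Tens s t) = obj s \<odot> obj t"

primrec stack :: "'l list \<Rightarrow> 'o \<Rightarrow> 'o" where
  "stack [] Z = Z"
| "stack (x # w) Z = lobj x \<odot> stack w Z"

primrec stack_arr :: "'l list \<Rightarrow> 'm \<Rightarrow> 'm" where
  "stack_arr [] f = f"
| "stack_arr (x # w) f = \<i>[lobj x] \<otimes> stack_arr w f"

text \<open>The tail \<open>Z\<close> is a parameter because in \<open>Tens s t\<close> the
  flattened \<open>t\<close> becomes the tail of \<open>s\<close>.\<close>

primrec flatten :: "'l tree \<Rightarrow> 'o \<Rightarrow> 'm" where
  "flatten Unt Z = \<l>[Z]"
| "flatten (Leaf x) Z = \<i>[lobj x \<odot> Z]"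
| "flatten (Tens s t) Z = flatten s (stack (leaves t) Z) \<cdot> ((\<i>[obj s] \<otimes> flatten t Z) \<cdot> \<a>[obj s,obj t,Z])"

lemma obj_Obj: "obj t \<in> Obj C"
  by (induction t) (simp_all add: unt_Obj tobj_Obj lobj_Obj)

lemma stack_Obj: "Z \<in> Obj C \<Longrightarrow> stack w Z \<in> Obj C"
  by (induction w) (simp_all add: tobj_Obj lobj_Obj)

lemma stack_append: "stack (v @ w) Z = stack v (stack w Z)"
  by (induction v) simp_all

lemma stack_arr_append: "stack_arr (v @ w) f = stack_arr v (stack_arr w f)"
  by (induction v) simp_all

lemma stack_arr_hom: "f \<in> hom C Y Z \<Longrightarrow> stack_arr w f \<in> hom C (stack w Y) (stack w Z)"
  by (induction w) (simp_all add: tarr_hom idt_hom lobj_Obj)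

lemma stack_arr_idt: "Z \<in> Obj C \<Longrightarrow> stack_arr w \<i>[Z] = \<i>[stack w Z]"
  by (induction w) (simp_all add: tarr_idt lobj_Obj stack_Obj)

lemma stack_arr_cmp:
  assumes "f \<in> hom C X Y" "g \<in> hom C Y Z"
  shows "stack_arr w (g \<cdot> f) = stack_arr w g \<cdot> stack_arr w f"
proof (induction w)
  case (Cons x w)
  show ?case
    using tarr_left[OF lobj_Obj stack_arr_hom[OF assms(1)] stack_arr_hom[OF assms(2)], of x w] Cons by simp
qed simp

lemma flatten_hom: "Z \<in> Obj C \<Longrightarrow> flatten t Z \<in> hom C (obj t \<odot> Z) (stack (leaves t) Z)"
proof (induction t arbitrary: Z)
  case (Tens s t)
  show ?case
    by (simp add: stack_append) (rule hom_rules Tens obj_Obj stack_Obj)+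
qed (simp_all add: hom_rules lobj_Obj)

lemma flatten_iso: "Z \<in> Obj C \<Longrightarrow> iso C (flatten t Z)"
proof (induction t arbitrary: Z)
  case (Tens s t)
  show ?case
    by simp (rule iso_cmp iso_tarr iso_idt assc_iso hom_rules Tens obj_Obj stack_Obj flatten_hom)+
qed (simp_all add: hom_rules lobj_Obj lunt_iso iso_idt)

lemmas typing = hom_rules obj_Obj stack_Obj flatten_hom stack_arr_hom lobj_Obj

text \<open>Naturality in the tail. It is the source of the naturality of every represented family,
  and it lets \<open>stack_arr\<close> add strands on the left.\<close>

lemma flatten_nat:
  assumes "h \<in> hom C Y Z"
  shows "stack_arr (leaves t) h \<cdot> flatten t Y = flatten t Z \<cdot> (\<i>[obj t] \<otimes> h)"
  using assms
proof (induction t arbitrary: h Y Z)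
  case Unt
  show ?case using lunt_nat[OF Unt] by simp
next
  case (Leaf x)
  have "\<i>[lobj x] \<otimes> h \<in> hom C (lobj x \<odot> Y) (lobj x \<odot> Z)"
    by (rule typing Leaf)+
  then show ?case using idt_left idt_right by force
next
  case (Tens s t)
  note Y = hom_Obj(1)[OF Tens.prems] and Z = hom_Obj(2)[OF Tens.prems]
  note ty = typing Y Z Tens.prems
  let ?h = "stack_arr (leaves t) h" and ?W = "stack (leaves t) Y" and ?W' = "stack (leaves t) Z"
  have h: "?h \<in> hom C ?W ?W'" by (rule ty)+
  have "stack_arr (leaves (Tens s t)) h \<cdot> flatten (Tens s t) Y =
     (stack_arr (leaves s) ?h \<cdot> flatten s ?W) \<cdot> ((\<i>[obj s] \<otimes> flatten t Y) \<cdot> \<a>[obj s,obj t,Y])"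
    by (simp add: stack_arr_append, rule cmp_assoc[symmetric]; (rule ty)+)
  also have "\<dots> = (flatten s ?W' \<cdot> (\<i>[obj s] \<otimes> ?h)) \<cdot> ((\<i>[obj s] \<otimes> flatten t Y) \<cdot> \<a>[obj s,obj t,Y])"
    using Tens.IH(1)[OF h] by simp
  also have "\<dots> = flatten s ?W' \<cdot> ((\<i>[obj s] \<otimes> ?h) \<cdot> ((\<i>[obj s] \<otimes> flatten t Y) \<cdot> \<a>[obj s,obj t,Y]))"
    by (rule cmp_assoc; (rule ty)+)
  also have "(\<i>[obj s] \<otimes> ?h) \<cdot> ((\<i>[obj s] \<otimes> flatten t Y) \<cdot> \<a>[obj s,obj t,Y]) =
      ((\<i>[obj s] \<otimes> ?h) \<cdot> (\<i>[obj s] \<otimes> flatten t Y)) \<cdot> \<a>[obj s,obj t,Y]"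
    by (rule cmp_assoc[symmetric]; (rule ty)+)
  also have "(\<i>[obj s] \<otimes> ?h) \<cdot> (\<i>[obj s] \<otimes> flatten t Y) = \<i>[obj s] \<otimes> (?h \<cdot> flatten t Y)"
    by (rule tarr_left; (rule ty)+)
  also have "\<dots> = \<i>[obj s] \<otimes> (flatten t Z \<cdot> (\<i>[obj t] \<otimes> h))"
    using Tens.IH(2)[OF Tens.prems] by simp
  also have "\<dots> = (\<i>[obj s] \<otimes> flatten t Z) \<cdot> (\<i>[obj s] \<otimes> (\<i>[obj t] \<otimes> h))"
    by (rule tarr_left[symmetric]; (rule ty)+)
  also have "\<dots> \<cdot> \<a>[obj s,obj t,Y] = (\<i>[obj s] \<otimes> flatten t Z) \<cdot> ((\<i>[obj s] \<otimes> (\<i>[obj t] \<otimes> h)) \<cdot> \<a>[obj s,obj t,Y])"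
    by (rule cmp_assoc; (rule ty)+)
  also have "(\<i>[obj s] \<otimes> (\<i>[obj t] \<otimes> h)) \<cdot> \<a>[obj s,obj t,Y] = \<a>[obj s,obj t,Z] \<cdot> (\<i>[obj s] \<otimes> \<i>[obj t] \<otimes> h)"
    by (rule assc_nat[symmetric]; (rule ty)+)
  also have "\<i>[obj s] \<otimes> \<i>[obj t] = \<i>[obj (Tens s t)]"
    by (simp add: tarr_idt obj_Obj)
  also have "(\<i>[obj s] \<otimes> flatten t Z) \<cdot> (\<a>[obj s,obj t,Z] \<cdot> (\<i>[obj (Tens s t)] \<otimes> h)) =
     ((\<i>[obj s] \<otimes> flatten t Z) \<cdot> \<a>[obj s,obj t,Z]) \<cdot> (\<i>[obj (Tens s t)] \<otimes> h)"
    by (simp, rule cmp_assoc[symmetric]; (rule ty)+)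
  also have "flatten s ?W' \<cdot> \<dots> = flatten (Tens s t) Z \<cdot> (\<i>[obj (Tens s t)] \<otimes> h)"
    by (simp, rule cmp_assoc[symmetric]; (rule ty)+)
  finally show ?case .
qed

section \<open>Arrows as natural families\<close>

text \<open>
  \<open>\<phi> Z\<close> is \<open>f \<otimes> Z\<close> read through the isomorphisms \<open>flatten\<close>. On this side tensor products are
  strictly associative, because \<open>stack\<close> is composition of the functors \<open>lobj x \<odot> _\<close>.
\<close>

definition represents :: "'l tree \<Rightarrow> 'm \<Rightarrow> 'l tree \<Rightarrow> ('o \<Rightarrow> 'm) \<Rightarrow> bool" where
  "represents s f t \<phi> \<longleftrightarrow> f \<in> hom C (obj s) (obj t) \<and>
     (\<forall>Z\<in>Obj C. \<phi> Z \<in> hom C (stack (leaves s) Z) (stack (leaves t) Z) \<and>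
        flatten t Z \<cdot> (f \<otimes> \<i>[Z]) = \<phi> Z \<cdot> flatten s Z)"

lemma representsD:
  assumes "represents s f t \<phi>"
  shows "f \<in> hom C (obj s) (obj t)"
    "Z \<in> Obj C \<Longrightarrow> \<phi> Z \<in> hom C (stack (leaves s) Z) (stack (leaves t) Z)"
    "Z \<in> Obj C \<Longrightarrow> flatten t Z \<cdot> (f \<otimes> \<i>[Z]) = \<phi> Z \<cdot> flatten s Z"
  using assms by (auto simp: represents_def)

lemma represents_unique:
  assumes "represents s f t \<phi>" "represents s f t \<psi>" "Z \<in> Obj C"
  shows "\<phi> Z = \<psi> Z"
  by (rule iso_cancel_right[OF flatten_iso flatten_hom representsD(2)[OF assms(1)] representsD(2)[OF assms(2)]])
    (use assms(3) representsD(3)[OF assms(1,3)] representsD(3)[OF assms(2,3)] in simp_all)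

text \<open>The family at the tail \<open>\<I>\<close> determines
  \<open>f \<otimes> \<i>[\<I>]\<close>, and the right unit constraint recovers \<open>f\<close>
  from it.\<close>

lemma represents_faithful:
  assumes "represents s f t \<phi>" "represents s g t \<psi>" "\<And>Z. Z \<in> Obj C \<Longrightarrow> \<phi> Z = \<psi> Z"
  shows "f = g"
proof (rule tarr_unt_inject[OF representsD(1)[OF assms(1)] representsD(1)[OF assms(2)]])
  note ty = typing representsD(1)[OF assms(1)] representsD(1)[OF assms(2)]
  show "f \<otimes> \<i>[\<I>] = g \<otimes> \<i>[\<I>]"
    by (rule iso_cancel_left[OF flatten_iso[of _ t] flatten_hom]; ((rule ty)+)?)
      (use representsD(3)[OF assms(1) unt_Obj] representsD(3)[OF assms(2) unt_Obj] assms(3)[OF unt_Obj] in simp)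
qed

lemma represents_cong:
  assumes "represents s f t \<phi>" "\<And>Z. Z \<in> Obj C \<Longrightarrow> \<phi> Z = \<psi> Z"
  shows "represents s f t \<psi>"
  using assms unfolding represents_def by simp

lemma represents_exists:
  assumes "f \<in> hom C (obj s) (obj t)"
  shows "represents s f t (\<lambda>Z. flatten t Z \<cdot> ((f \<otimes> \<i>[Z]) \<cdot> inverse_arrow C (flatten s Z)))"
  unfolding represents_def
proof (intro conjI ballI assms)
  fix Z assume Z: "Z \<in> Obj C"
  note K = inverse_arrow[OF flatten_iso[OF Z, of s] flatten_hom[OF Z]]
  note ty = typing Z assms K(1)
  show "flatten t Z \<cdot> ((f \<otimes> \<i>[Z]) \<cdot> inverse_arrow C (flatten s Z)) \<in> hom C (stack (leaves s) Z) (stack (leaves t) Z)"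
    by (rule ty)+
  have f: "f \<otimes> \<i>[Z] \<in> hom C (obj s \<odot> Z) (obj t \<odot> Z)" by (rule ty)+
  have "(flatten t Z \<cdot> ((f \<otimes> \<i>[Z]) \<cdot> inverse_arrow C (flatten s Z))) \<cdot> flatten s Z
     = flatten t Z \<cdot> (((f \<otimes> \<i>[Z]) \<cdot> inverse_arrow C (flatten s Z)) \<cdot> flatten s Z)"
    by (rule cmp_assoc; (rule ty)+)
  also have "((f \<otimes> \<i>[Z]) \<cdot> inverse_arrow C (flatten s Z)) \<cdot> flatten s Z = (f \<otimes> \<i>[Z]) \<cdot> (inverse_arrow C (flatten s Z) \<cdot> flatten s Z)"
    by (rule cmp_assoc; (rule ty)+)
  also have "\<dots> = f \<otimes> \<i>[Z]" using K(2) idt_right[OF f] by simp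
  finally show "flatten t Z \<cdot> (f \<otimes> \<i>[Z]) = (flatten t Z \<cdot> ((f \<otimes> \<i>[Z]) \<cdot> inverse_arrow C (flatten s Z))) \<cdot> flatten s Z" ..
qed

lemma represents_idt: "represents s \<i>[obj s] s (\<lambda>Z. \<i>[stack (leaves s) Z])"
  unfolding represents_def
  by (auto simp: tarr_idt obj_Obj idt_hom stack_Obj idt_left[OF flatten_hom] idt_right[OF flatten_hom])

lemma represents_cmp:
  assumes "represents s f t \<phi>" "represents t g u \<psi>"
  shows "represents s (g \<cdot> f) u (\<lambda>Z. \<psi> Z \<cdot> \<phi> Z)"
  unfolding represents_def
proof (intro conjI ballI)
  note ty = typing representsD(1,2)[OF assms(1)] representsD(1,2)[OF assms(2)]
  show "g \<cdot> f \<in> hom C (obj s) (obj u)" by (rule ty)+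
  fix Z assume Z: "Z \<in> Obj C"
  show "\<psi> Z \<cdot> \<phi> Z \<in> hom C (stack (leaves s) Z) (stack (leaves u) Z)" by (rule ty Z)+
  have "flatten u Z \<cdot> ((g \<cdot> f) \<otimes> \<i>[Z]) = flatten u Z \<cdot> ((g \<otimes> \<i>[Z]) \<cdot> (f \<otimes> \<i>[Z]))"
    by (subst tarr_right; ((rule ty Z)+)?) simp
  also have "\<dots> = (flatten u Z \<cdot> (g \<otimes> \<i>[Z])) \<cdot> (f \<otimes> \<i>[Z])"
    by (rule cmp_assoc[symmetric]; (rule ty Z)+)
  also have "\<dots> = \<psi> Z \<cdot> flatten t Z \<cdot> (f \<otimes> \<i>[Z])"
    by (subst representsD(3)[OF assms(2) Z]) (rule cmp_assoc; (rule ty Z)+)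
  also have "\<dots> = \<psi> Z \<cdot> (\<phi> Z \<cdot> flatten s Z)"
    by (subst representsD(3)[OF assms(1) Z]) simp
  also have "\<dots> = (\<psi> Z \<cdot> \<phi> Z) \<cdot> flatten s Z"
    by (rule cmp_assoc[symmetric]; (rule ty Z)+)
  finally show "flatten u Z \<cdot> ((g \<cdot> f) \<otimes> \<i>[Z]) = (\<psi> Z \<cdot> \<phi> Z) \<cdot> flatten s Z" .
qed

text \<open>The interchange law of diagrams rests on this: an arrow of the tail passes through
  \<open>\<phi>\<close>.\<close>

lemma represents_natural:
  assumes "represents s f t \<phi>" "h \<in> hom C Y Z"
  shows "\<phi> Z \<cdot> stack_arr (leaves s) h = stack_arr (leaves t) h \<cdot> \<phi> Y"
proof (rule iso_cancel_right)
  note Y = hom_Obj(1)[OF assms(2)] and Z = hom_Obj(2)[OF assms(2)]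
  note ty = typing representsD(1,2)[OF assms(1)] assms(2) Y Z
  show "iso C (flatten s Y)" by (rule flatten_iso Y)+
  show "flatten s Y \<in> hom C (obj s \<odot> Y) (stack (leaves s) Y)"
    "\<phi> Z \<cdot> stack_arr (leaves s) h \<in> hom C (stack (leaves s) Y) (stack (leaves t) Z)"
    "stack_arr (leaves t) h \<cdot> \<phi> Y \<in> hom C (stack (leaves s) Y) (stack (leaves t) Z)"
    by (rule ty)+
  have "(\<phi> Z \<cdot> stack_arr (leaves s) h) \<cdot> flatten s Y = \<phi> Z \<cdot> (stack_arr (leaves s) h \<cdot> flatten s Y)"
    by (rule cmp_assoc; (rule ty)+)
  also have "\<dots> = \<phi> Z \<cdot> (flatten s Z \<cdot> (\<i>[obj s] \<otimes> h))"
    by (subst flatten_nat[OF assms(2)]) simp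
  also have "\<dots> = (\<phi> Z \<cdot> flatten s Z) \<cdot> (\<i>[obj s] \<otimes> h)"
    by (rule cmp_assoc[symmetric]; (rule ty)+)
  also have "\<dots> = flatten t Z \<cdot> ((f \<otimes> \<i>[Z]) \<cdot> (\<i>[obj s] \<otimes> h))"
    by (subst representsD(3)[OF assms(1) Z, symmetric]) (rule cmp_assoc; (rule ty)+)
  also have "\<dots> = flatten t Z \<cdot> ((\<i>[obj t] \<otimes> h) \<cdot> (f \<otimes> \<i>[Y]))"
    using tarr_split[OF representsD(1)[OF assms(1)] assms(2)] by simp
  also have "\<dots> = (flatten t Z \<cdot> (\<i>[obj t] \<otimes> h)) \<cdot> (f \<otimes> \<i>[Y])"
    by (rule cmp_assoc[symmetric]; (rule ty)+)
  also have "\<dots> = stack_arr (leaves t) h \<cdot> (flatten t Y \<cdot> (f \<otimes> \<i>[Y]))"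
    by (subst flatten_nat[OF assms(2), symmetric]) (rule cmp_assoc; (rule ty)+)
  also have "\<dots> = stack_arr (leaves t) h \<cdot> (\<phi> Y \<cdot> flatten s Y)"
    by (subst representsD(3)[OF assms(1) Y]) simp
  also have "\<dots> = (stack_arr (leaves t) h \<cdot> \<phi> Y) \<cdot> flatten s Y"
    by (rule cmp_assoc[symmetric]; (rule ty)+)
  finally show "(\<phi> Z \<cdot> stack_arr (leaves s) h) \<cdot> flatten s Y = (stack_arr (leaves t) h \<cdot> \<phi> Y) \<cdot> flatten s Y" .
qed

text \<open>Strands added on the right are absorbed in the tail.\<close>

lemma represents_tarr_left:
  assumes "represents s f t \<phi>"
  shows "represents (Tens s u) (f \<otimes> \<i>[obj u]) (Tens t u) (\<lambda>Z. \<phi> (stack (leaves u) Z))"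
  unfolding represents_def
proof (intro conjI ballI)
  note ty = typing representsD(1,2)[OF assms(1)]
  show "f \<otimes> \<i>[obj u] \<in> hom C (obj (Tens s u)) (obj (Tens t u))"
    by simp (rule ty)+
  fix Z assume Z: "Z \<in> Obj C"
  let ?W = "stack (leaves u) Z"
  have W: "?W \<in> Obj C" by (rule ty Z)+
  show "\<phi> ?W \<in> hom C (stack (leaves (Tens s u)) Z) (stack (leaves (Tens t u)) Z)"
    by (simp add: stack_append) (rule ty Z)+
  have "flatten (Tens t u) Z \<cdot> (f \<otimes> \<i>[obj u] \<otimes> \<i>[Z])
     = flatten t ?W \<cdot> (((\<i>[obj t] \<otimes> flatten u Z) \<cdot> \<a>[obj t,obj u,Z]) \<cdot> (f \<otimes> \<i>[obj u] \<otimes> \<i>[Z]))"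
    by (simp, rule cmp_assoc; (rule ty Z)+)
  also have "((\<i>[obj t] \<otimes> flatten u Z) \<cdot> \<a>[obj t,obj u,Z]) \<cdot> (f \<otimes> \<i>[obj u] \<otimes> \<i>[Z])
     = (\<i>[obj t] \<otimes> flatten u Z) \<cdot> (\<a>[obj t,obj u,Z] \<cdot> (f \<otimes> \<i>[obj u] \<otimes> \<i>[Z]))"
    by (rule cmp_assoc; (rule ty Z)+)
  also have "\<a>[obj t,obj u,Z] \<cdot> (f \<otimes> \<i>[obj u] \<otimes> \<i>[Z]) = (f \<otimes> (\<i>[obj u] \<otimes> \<i>[Z])) \<cdot> \<a>[obj s,obj u,Z]"
    by (rule assc_nat; (rule ty Z)+)
  also have "\<i>[obj u] \<otimes> \<i>[Z] = \<i>[obj u \<odot> Z]"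
    by (simp add: tarr_idt obj_Obj Z)
  also have "(\<i>[obj t] \<otimes> flatten u Z) \<cdot> ((f \<otimes> \<i>[obj u \<odot> Z]) \<cdot> \<a>[obj s,obj u,Z])
     = ((\<i>[obj t] \<otimes> flatten u Z) \<cdot> (f \<otimes> \<i>[obj u \<odot> Z])) \<cdot> \<a>[obj s,obj u,Z]"
    by (rule cmp_assoc[symmetric]; (rule ty Z)+)
  also have "(\<i>[obj t] \<otimes> flatten u Z) \<cdot> (f \<otimes> \<i>[obj u \<odot> Z]) = (f \<otimes> \<i>[?W]) \<cdot> (\<i>[obj s] \<otimes> flatten u Z)"
    using tarr_split[OF representsD(1)[OF assms] flatten_hom[OF Z, of u]] by simp
  also have "((f \<otimes> \<i>[?W]) \<cdot> (\<i>[obj s] \<otimes> flatten u Z)) \<cdot> \<a>[obj s,obj u,Z]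
     = (f \<otimes> \<i>[?W]) \<cdot> ((\<i>[obj s] \<otimes> flatten u Z) \<cdot> \<a>[obj s,obj u,Z])"
    by (rule cmp_assoc; (rule ty Z)+)
  also have "flatten t ?W \<cdot> \<dots> = (flatten t ?W \<cdot> (f \<otimes> \<i>[?W])) \<cdot> ((\<i>[obj s] \<otimes> flatten u Z) \<cdot> \<a>[obj s,obj u,Z])"
    by (rule cmp_assoc[symmetric]; (rule ty Z)+)
  also have "\<dots> = \<phi> ?W \<cdot> flatten (Tens s u) Z"
    by (simp add: representsD(3)[OF assms W], rule cmp_assoc; (rule ty Z)+)
  finally show "flatten (Tens t u) Z \<cdot> (f \<otimes> \<i>[obj u] \<otimes> \<i>[Z]) = \<phi> ?W \<cdot> flatten (Tens s u) Z" .
qed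

lemma represents_tarr_right:
  assumes "represents s f t \<phi>"
  shows "represents (Tens u s) (\<i>[obj u] \<otimes> f) (Tens u t) (\<lambda>Z. stack_arr (leaves u) (\<phi> Z))"
  unfolding represents_def
proof (intro conjI ballI)
  note ty = typing representsD(1,2)[OF assms(1)]
  show "\<i>[obj u] \<otimes> f \<in> hom C (obj (Tens u s)) (obj (Tens u t))"
    by simp (rule ty)+
  fix Z assume Z: "Z \<in> Obj C"
  let ?W = "stack (leaves s) Z" and ?W' = "stack (leaves t) Z"
  have W: "?W \<in> Obj C" by (rule ty Z)+
  have \<phi>: "\<phi> Z \<in> hom C ?W ?W'" by (rule ty Z)+
  show "stack_arr (leaves u) (\<phi> Z) \<in> hom C (stack (leaves (Tens u s)) Z) (stack (leaves (Tens u t)) Z)"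
    by (simp add: stack_append) (rule ty Z)+
  have "flatten (Tens u t) Z \<cdot> (\<i>[obj u] \<otimes> f \<otimes> \<i>[Z])
     = flatten u ?W' \<cdot> (((\<i>[obj u] \<otimes> flatten t Z) \<cdot> \<a>[obj u,obj t,Z]) \<cdot> (\<i>[obj u] \<otimes> f \<otimes> \<i>[Z]))"
    by (simp, rule cmp_assoc; (rule ty Z)+)
  also have "((\<i>[obj u] \<otimes> flatten t Z) \<cdot> \<a>[obj u,obj t,Z]) \<cdot> (\<i>[obj u] \<otimes> f \<otimes> \<i>[Z])
     = (\<i>[obj u] \<otimes> flatten t Z) \<cdot> (\<a>[obj u,obj t,Z] \<cdot> (\<i>[obj u] \<otimes> f \<otimes> \<i>[Z]))"
    by (rule cmp_assoc; (rule ty Z)+)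
  also have "\<a>[obj u,obj t,Z] \<cdot> (\<i>[obj u] \<otimes> f \<otimes> \<i>[Z]) = (\<i>[obj u] \<otimes> (f \<otimes> \<i>[Z])) \<cdot> \<a>[obj u,obj s,Z]"
    by (rule assc_nat; (rule ty Z)+)
  also have "(\<i>[obj u] \<otimes> flatten t Z) \<cdot> ((\<i>[obj u] \<otimes> (f \<otimes> \<i>[Z])) \<cdot> \<a>[obj u,obj s,Z])
     = ((\<i>[obj u] \<otimes> flatten t Z) \<cdot> (\<i>[obj u] \<otimes> (f \<otimes> \<i>[Z]))) \<cdot> \<a>[obj u,obj s,Z]"
    by (rule cmp_assoc[symmetric]; (rule ty Z)+)
  also have "(\<i>[obj u] \<otimes> flatten t Z) \<cdot> (\<i>[obj u] \<otimes> (f \<otimes> \<i>[Z])) = \<i>[obj u] \<otimes> (flatten t Z \<cdot> (f \<otimes> \<i>[Z]))"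
    by (rule tarr_left; (rule ty Z)+)
  also have "\<dots> = \<i>[obj u] \<otimes> (\<phi> Z \<cdot> flatten s Z)"
    by (subst representsD(3)[OF assms Z]) simp
  also have "\<dots> = (\<i>[obj u] \<otimes> \<phi> Z) \<cdot> (\<i>[obj u] \<otimes> flatten s Z)"
    by (rule tarr_left[symmetric]; (rule ty Z)+)
  also have "((\<i>[obj u] \<otimes> \<phi> Z) \<cdot> (\<i>[obj u] \<otimes> flatten s Z)) \<cdot> \<a>[obj u,obj s,Z]
     = (\<i>[obj u] \<otimes> \<phi> Z) \<cdot> ((\<i>[obj u] \<otimes> flatten s Z) \<cdot> \<a>[obj u,obj s,Z])"
    by (rule cmp_assoc; (rule ty Z)+)
  also have "flatten u ?W' \<cdot> \<dots> = (flatten u ?W' \<cdot> (\<i>[obj u] \<otimes> \<phi> Z)) \<cdot> ((\<i>[obj u] \<otimes> flatten s Z) \<cdot> \<a>[obj u,obj s,Z])"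
    by (rule cmp_assoc[symmetric]; (rule ty Z)+)
  also have "\<dots> = stack_arr (leaves u) (\<phi> Z) \<cdot> flatten (Tens u s) Z"
    by (simp add: flatten_nat[OF \<phi>, symmetric], rule cmp_assoc; (rule ty Z)+)
  finally show "flatten (Tens u t) Z \<cdot> (\<i>[obj u] \<otimes> f \<otimes> \<i>[Z]) = stack_arr (leaves u) (\<phi> Z) \<cdot> flatten (Tens u s) Z" .
qed

section \<open>Constraints and braidings with the unit object become identities\<close>

lemma represents_assc:
  "represents (Tens (Tens s t) u) \<a>[obj s,obj t,obj u] (Tens s (Tens t u))
     (\<lambda>Z. \<i>[stack (leaves s @ leaves t @ leaves u) Z])"
  unfolding represents_def
proof (intro conjI ballI)
  show "\<a>[obj s,obj t,obj u] \<in> hom C (obj (Tens (Tens s t) u)) (obj (Tens s (Tens t u)))"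
    by simp (rule typing)+
  fix Z assume Z: "Z \<in> Obj C"
  note ty = typing Z
  show "\<i>[stack (leaves s @ leaves t @ leaves u) Z]
      \<in> hom C (stack (leaves (Tens (Tens s t) u)) Z) (stack (leaves (Tens s (Tens t u))) Z)"
    by simp (rule ty)+
  let ?U = "stack (leaves u) Z" let ?T = "stack (leaves t) ?U"
  let ?S = "\<i>[obj s]" and ?a = "\<a>[obj s,obj t,obj u] \<otimes> \<i>[Z]"
  let ?b = "\<a>[obj t,obj u,Z]" and ?kt = "flatten t ?U" and ?ku = "flatten u Z" and ?ks = "flatten s ?T"
  have "flatten (Tens s (Tens t u)) Z \<cdot> ?a = ?ks \<cdot> (((?S \<otimes> (?kt \<cdot> ((\<i>[obj t] \<otimes> ?ku) \<cdot> ?b))) \<cdot> \<a>[obj s,obj t \<odot> obj u,Z]) \<cdot> ?a)"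
    by (simp add: stack_append, rule cmp_assoc; (rule ty)+)
  also have "((?S \<otimes> (?kt \<cdot> ((\<i>[obj t] \<otimes> ?ku) \<cdot> ?b))) \<cdot> \<a>[obj s,obj t \<odot> obj u,Z]) \<cdot> ?a
     = (?S \<otimes> (?kt \<cdot> ((\<i>[obj t] \<otimes> ?ku) \<cdot> ?b))) \<cdot> (\<a>[obj s,obj t \<odot> obj u,Z] \<cdot> ?a)"
    by (rule cmp_assoc; (rule ty)+)
  also have "?S \<otimes> (?kt \<cdot> ((\<i>[obj t] \<otimes> ?ku) \<cdot> ?b)) = (?S \<otimes> ?kt) \<cdot> (?S \<otimes> ((\<i>[obj t] \<otimes> ?ku) \<cdot> ?b))"
    by (rule tarr_left[symmetric]; (rule ty)+)
  also have "?S \<otimes> ((\<i>[obj t] \<otimes> ?ku) \<cdot> ?b) = (?S \<otimes> (\<i>[obj t] \<otimes> ?ku)) \<cdot> (?S \<otimes> ?b)"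
    by (rule tarr_left[symmetric]; (rule ty)+)
  also have "((?S \<otimes> ?kt) \<cdot> (?S \<otimes> (\<i>[obj t] \<otimes> ?ku)) \<cdot> (?S \<otimes> ?b)) \<cdot> (\<a>[obj s,obj t \<odot> obj u,Z] \<cdot> ?a)
     = (?S \<otimes> ?kt) \<cdot> (((?S \<otimes> (\<i>[obj t] \<otimes> ?ku)) \<cdot> (?S \<otimes> ?b)) \<cdot> (\<a>[obj s,obj t \<odot> obj u,Z] \<cdot> ?a))"
    by (rule cmp_assoc; (rule ty)+)
  also have "((?S \<otimes> (\<i>[obj t] \<otimes> ?ku)) \<cdot> (?S \<otimes> ?b)) \<cdot> (\<a>[obj s,obj t \<odot> obj u,Z] \<cdot> ?a)
     = (?S \<otimes> (\<i>[obj t] \<otimes> ?ku)) \<cdot> ((?S \<otimes> ?b) \<cdot> (\<a>[obj s,obj t \<odot> obj u,Z] \<cdot> ?a))"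
    by (rule cmp_assoc; (rule ty)+)
  \<comment> \<open>This is the pentagon with the tail as fourth object; what remains is naturality
    of the associator at \<open>flatten u Z\<close>.\<close>
  also have "(?S \<otimes> ?b) \<cdot> (\<a>[obj s,obj t \<odot> obj u,Z] \<cdot> ?a) = \<a>[obj s,obj t,obj u \<odot> Z] \<cdot> \<a>[obj s \<odot> obj t,obj u,Z]"
    by (rule pentagon[symmetric]; (rule ty)+)
  also have "(?S \<otimes> (\<i>[obj t] \<otimes> ?ku)) \<cdot> (\<a>[obj s,obj t,obj u \<odot> Z] \<cdot> \<a>[obj s \<odot> obj t,obj u,Z])
     = ((?S \<otimes> (\<i>[obj t] \<otimes> ?ku)) \<cdot> \<a>[obj s,obj t,obj u \<odot> Z]) \<cdot> \<a>[obj s \<odot> obj t,obj u,Z]"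
    by (rule cmp_assoc[symmetric]; (rule ty)+)
  also have "(?S \<otimes> (\<i>[obj t] \<otimes> ?ku)) \<cdot> \<a>[obj s,obj t,obj u \<odot> Z] = \<a>[obj s,obj t,?U] \<cdot> (?S \<otimes> \<i>[obj t] \<otimes> ?ku)"
    by (rule assc_nat[symmetric]; (rule ty)+)
  also have "?S \<otimes> \<i>[obj t] = \<i>[obj s \<odot> obj t]"
    by (simp add: tarr_idt obj_Obj)
  also have "(\<a>[obj s,obj t,?U] \<cdot> (\<i>[obj s \<odot> obj t] \<otimes> ?ku)) \<cdot> \<a>[obj s \<odot> obj t,obj u,Z]
     = \<a>[obj s,obj t,?U] \<cdot> ((\<i>[obj s \<odot> obj t] \<otimes> ?ku) \<cdot> \<a>[obj s \<odot> obj t,obj u,Z])"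
    by (rule cmp_assoc; (rule ty)+)
  also have "(?S \<otimes> ?kt) \<cdot> \<dots> = ((?S \<otimes> ?kt) \<cdot> \<a>[obj s,obj t,?U]) \<cdot> ((\<i>[obj s \<odot> obj t] \<otimes> ?ku) \<cdot> \<a>[obj s \<odot> obj t,obj u,Z])"
    by (rule cmp_assoc[symmetric]; (rule ty)+)
  also have "?ks \<cdot> \<dots> = flatten (Tens (Tens s t) u) Z"
    by (simp, rule cmp_assoc[symmetric]; (rule ty)+)
  also have "\<dots> = \<i>[stack (leaves s @ leaves t @ leaves u) Z] \<cdot> \<dots>"
    using idt_left[OF flatten_hom[OF Z, of "Tens (Tens s t) u"]] by simp
  finally show "flatten (Tens s (Tens t u)) Z \<cdot> ?a = \<dots>" .
qed

text \<open>At the tail \<open>Z\<close> this is \<open>lunt_tensor\<close>; for the right unit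
  constraint the triangle takes its place.\<close>

lemma represents_lunt: "represents (Tens Unt s) \<l>[obj s] s (\<lambda>Z. \<i>[stack (leaves s) Z])"
  unfolding represents_def
proof (intro conjI ballI)
  show "\<l>[obj s] \<in> hom C (obj (Tens Unt s)) (obj s)"
    by simp (rule typing)+
  fix Z assume Z: "Z \<in> Obj C"
  note ty = typing Z
  show "\<i>[stack (leaves s) Z] \<in> hom C (stack (leaves (Tens Unt s)) Z) (stack (leaves s) Z)"
    by simp (rule ty)+
  have "flatten s Z \<cdot> (\<l>[obj s] \<otimes> \<i>[Z]) = flatten s Z \<cdot> (\<l>[obj s \<odot> Z] \<cdot> \<a>[\<I>,obj s,Z])"
    using lunt_tensor[OF obj_Obj Z] by simp
  also have "\<dots> = (flatten s Z \<cdot> \<l>[obj s \<odot> Z]) \<cdot> \<a>[\<I>,obj s,Z]"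
    by (rule cmp_assoc[symmetric]; (rule ty)+)
  also have "\<dots> = (\<l>[stack (leaves s) Z] \<cdot> (\<i>[\<I>] \<otimes> flatten s Z)) \<cdot> \<a>[\<I>,obj s,Z]"
    using lunt_nat[OF flatten_hom[OF Z, of s]] by simp
  also have "\<dots> = flatten (Tens Unt s) Z"
    by (simp, rule cmp_assoc; (rule ty)+)
  also have "\<dots> = \<i>[stack (leaves s) Z] \<cdot> \<dots>"
    using idt_left[OF flatten_hom[OF Z, of "Tens Unt s"]] by simp
  finally show "flatten s Z \<cdot> (\<l>[obj s] \<otimes> \<i>[Z]) = \<dots>" .
qed

lemma represents_runt: "represents (Tens s Unt) \<r>[obj s] s (\<lambda>Z. \<i>[stack (leaves s) Z])"
  unfolding represents_def
proof (intro conjI ballI)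
  show "\<r>[obj s] \<in> hom C (obj (Tens s Unt)) (obj s)"
    by simp (rule typing)+
  fix Z assume Z: "Z \<in> Obj C"
  note ty = typing Z
  show "\<i>[stack (leaves s) Z] \<in> hom C (stack (leaves (Tens s Unt)) Z) (stack (leaves s) Z)"
    by simp (rule ty)+
  have "flatten s Z \<cdot> (\<r>[obj s] \<otimes> \<i>[Z]) = flatten (Tens s Unt) Z"
    using triangle[OF obj_Obj[of s] Z] by simp
  also have "\<dots> = \<i>[stack (leaves s) Z] \<cdot> \<dots>"
    using idt_left[OF flatten_hom[OF Z, of "Tens s Unt"]] by simp
  finally show "flatten s Z \<cdot> (\<r>[obj s] \<otimes> \<i>[Z]) = \<dots>" .
qed

text \<open>The family of the inverse arrow is a right inverse of \<open>\<phi>\<close>, so it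
  agrees with any left inverse \<open>\<psi>\<close>.\<close>

lemma represents_inverse:
  assumes "represents s f t \<phi>" "iso C f" "\<And>Z. Z \<in> Obj C \<Longrightarrow> \<psi> Z \<cdot> \<phi> Z = \<i>[stack (leaves s) Z]"
    "\<And>Z. Z \<in> Obj C \<Longrightarrow> \<psi> Z \<in> hom C (stack (leaves t) Z) (stack (leaves s) Z)"
  shows "represents t (inverse_arrow C f) s \<psi>"
proof -
  note f = representsD(1)[OF assms(1)] and \<phi> = representsD(2)[OF assms(1)]
  let ?g = "inverse_arrow C f"
  note F = inverse_arrow[OF assms(2) f]
  obtain \<chi> where \<chi>: "represents t ?g s \<chi>" using represents_exists[OF F(1)] by blast
  have "\<chi> Z = \<psi> Z" if Z: "Z \<in> Obj C" for Z
  proof -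
    have "represents t (f \<cdot> ?g) t (\<lambda>Z. \<phi> Z \<cdot> \<chi> Z)" by (rule represents_cmp[OF \<chi> assms(1)])
    then have 1: "\<phi> Z \<cdot> \<chi> Z = \<i>[stack (leaves t) Z]"
      using represents_unique[OF _ represents_idt Z, of t "\<lambda>Z. \<phi> Z \<cdot> \<chi> Z"] F(3) by simp
    have "\<psi> Z = \<psi> Z \<cdot> (\<phi> Z \<cdot> \<chi> Z)"
      using 1 idt_right[OF assms(4)[OF Z]] by simp
    also have "\<dots> = (\<psi> Z \<cdot> \<phi> Z) \<cdot> \<chi> Z"
      using cmp_assoc[OF representsD(2)[OF \<chi> Z] \<phi>[OF Z] assms(4)[OF Z]] by simp
    also have "\<dots> = \<chi> Z"
      using assms(3)[OF Z] idt_left[OF representsD(2)[OF \<chi> Z]] by simp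
    finally show ?thesis ..
  qed
  with \<chi> show ?thesis using represents_cong by blast
qed

text \<open>An invertible idempotent is an identity; invertibility of the family is inherited from
  \<open>f\<close>.\<close>

lemma represents_idempotent:
  assumes "represents s f t \<phi>" "iso C f" "leaves s = leaves t" "Z \<in> Obj C" "\<phi> Z \<cdot> \<phi> Z = \<phi> Z"
  shows "\<phi> Z = \<i>[stack (leaves s) Z]"
proof -
  let ?g = "inverse_arrow C f"
  note F = inverse_arrow[OF assms(2) representsD(1)[OF assms(1)]]
  obtain \<chi> where \<chi>: "represents t ?g s \<chi>" using represents_exists[OF F(1)] by blast
  have 1: "\<chi> Z \<cdot> \<phi> Z = \<i>[stack (leaves s) Z]"
    using represents_unique[OF represents_cmp[OF assms(1) \<chi>] _ assms(4), of "\<lambda>Z. \<i>[stack (leaves s) Z]"] F(2) represents_idt by simp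
  have \<phi>: "\<phi> Z \<in> hom C (stack (leaves s) Z) (stack (leaves s) Z)" "\<chi> Z \<in> hom C (stack (leaves s) Z) (stack (leaves s) Z)"
    using representsD(2)[OF assms(1,4)] representsD(2)[OF \<chi> assms(4)] assms(3) by simp_all
  have "\<phi> Z = (\<chi> Z \<cdot> \<phi> Z) \<cdot> \<phi> Z" using 1 idt_left[OF \<phi>(1)] by simp
  also have "\<dots> = \<chi> Z \<cdot> (\<phi> Z \<cdot> \<phi> Z)" by (rule cmp_assoc[OF \<phi>(1) \<phi>])
  also have "\<dots> = \<i>[stack (leaves s) Z]" using assms(5) 1 by simp
  finally show ?thesis .
qed

lemma represents_structure_inverse:
  assumes "represents s f t (\<lambda>Z. \<i>[stack w Z])" "iso C f" "leaves s = w" "leaves t = w"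
  shows "represents t (inverse_arrow C f) s (\<lambda>Z. \<i>[stack w Z])"
  by (rule represents_inverse[OF assms(1,2)])
    (use assms(3,4) in \<open>simp_all add: idt_left[OF idt_hom] idt_hom stack_Obj\<close>)

lemma represents_assc_inv:
  "represents (Tens s (Tens t u)) \<a>\<^sup>-\<^sup>1[obj s,obj t,obj u] (Tens (Tens s t) u)
     (\<lambda>Z. \<i>[stack (leaves s @ leaves t @ leaves u) Z])"
  by (rule represents_structure_inverse[OF represents_assc assc_iso]) (simp_all add: obj_Obj)

lemma represents_lunt_inv: "represents s \<l>\<^sup>-\<^sup>1[obj s] (Tens Unt s) (\<lambda>Z. \<i>[stack (leaves s) Z])"
  by (rule represents_structure_inverse[OF represents_lunt lunt_iso]) (simp_all add: obj_Obj)

lemma represents_runt_inv: "represents s \<r>\<^sup>-\<^sup>1[obj s] (Tens s Unt) (\<lambda>Z. \<i>[stack (leaves s) Z])"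
  by (rule represents_structure_inverse[OF represents_runt runt_iso]) (simp_all add: obj_Obj)

text \<open>
  Naturality of the braiding at \<open>\<l>[\<I>]\<close> identifies \<open>\<c>[X, \<I> \<odot> \<I>]\<close> with \<open>\<c>[X, \<I>]\<close>, so
  the hexagon makes the latter an idempotent isomorphism.
\<close>

lemma represents_brd_unt_right: "represents (Tens s Unt) \<c>[obj s,\<I>] (Tens Unt s) (\<lambda>Z. \<i>[stack (leaves s) Z])"
proof -
  note ty = typing brd_hom
  have "\<c>[obj s,\<I>] \<in> hom C (obj (Tens s Unt)) (obj (Tens Unt s))" by simp (rule ty)+
  then obtain u where u: "represents (Tens s Unt) \<c>[obj s,\<I>] (Tens Unt s) u" using represents_exists by blast
  have "\<c>[obj s,\<I> \<odot> \<I>] \<in> hom C (obj (Tens s (Tens Unt Unt))) (obj (Tens (Tens Unt Unt) s))"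
    by simp (rule ty)+
  then obtain v where v: "represents (Tens s (Tens Unt Unt)) \<c>[obj s,\<I> \<odot> \<I>] (Tens (Tens Unt Unt) s) v"
    using represents_exists by blast
  have nat: "\<c>[obj s,\<I>] \<cdot> (\<i>[obj s] \<otimes> \<l>[obj Unt]) = (\<l>[obj Unt] \<otimes> \<i>[obj s]) \<cdot> \<c>[obj s,\<I> \<odot> \<I>]"
    by simp (rule brd_nat; (rule ty)+)
  have hex: "\<a>[obj Unt,obj Unt,obj s] \<cdot> \<c>[obj s,\<I> \<odot> \<I>] \<cdot> \<a>[obj s,obj Unt,obj Unt]
      = (\<i>[obj Unt] \<otimes> \<c>[obj s,\<I>]) \<cdot> \<a>[obj Unt,obj s,obj Unt] \<cdot> (\<c>[obj s,\<I>] \<otimes> \<i>[obj Unt])"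
    by simp (rule hexagon; (rule ty)+)
  have "u Z = \<i>[stack (leaves s) Z]" if Z: "Z \<in> Obj C" for Z
  proof -
    have uh: "u Z \<in> hom C (stack (leaves s) Z) (stack (leaves s) Z)"
      and vh: "v Z \<in> hom C (stack (leaves s) Z) (stack (leaves s) Z)"
      using representsD(2)[OF u Z] representsD(2)[OF v Z] by simp_all
    note un = idt_left[OF uh] idt_right[OF uh] idt_left[OF vh] idt_right[OF vh] stack_arr_idt[OF Z]
    have uv: "u Z = v Z"
      using represents_unique[OF represents_cmp[OF represents_tarr_right[OF represents_lunt[of Unt], of s] u]
          represents_cmp[OF v represents_tarr_left[OF represents_lunt[of Unt], of s], folded nat] Z] un
      by simp
    have "v Z = u Z \<cdot> u Z"
      using represents_unique[OF represents_cmp[OF represents_cmp[OF represents_assc[of s Unt Unt] v] represents_assc[of Unt Unt s], unfolded hex]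
          represents_cmp[OF represents_cmp[OF represents_tarr_left[OF u, of Unt] represents_assc[of Unt s Unt]] represents_tarr_right[OF u, of Unt]] Z] un
      by simp
    then show ?thesis
      using represents_idempotent[OF u _ _ Z] uv brd_iso[OF obj_Obj unt_Obj] by simp
  qed
  then show ?thesis by (rule represents_cong[OF u])
qed

text \<open>Mirror image of the previous argument, with the second hexagon.\<close>

lemma represents_brd_unt_left: "represents (Tens Unt s) \<c>[\<I>,obj s] (Tens s Unt) (\<lambda>Z. \<i>[stack (leaves s) Z])"
proof -
  note ty = typing brd_hom
  have "\<c>[\<I>,obj s] \<in> hom C (obj (Tens Unt s)) (obj (Tens s Unt))" by simp (rule ty)+
  then obtain u where u: "represents (Tens Unt s) \<c>[\<I>,obj s] (Tens s Unt) u" using represents_exists by blast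
  have "\<c>[\<I> \<odot> \<I>,obj s] \<in> hom C (obj (Tens (Tens Unt Unt) s)) (obj (Tens s (Tens Unt Unt)))"
    by simp (rule ty)+
  then obtain v where v: "represents (Tens (Tens Unt Unt) s) \<c>[\<I> \<odot> \<I>,obj s] (Tens s (Tens Unt Unt)) v"
    using represents_exists by blast
  have nat: "\<c>[\<I>,obj s] \<cdot> (\<l>[obj Unt] \<otimes> \<i>[obj s]) = (\<i>[obj s] \<otimes> \<l>[obj Unt]) \<cdot> \<c>[\<I> \<odot> \<I>,obj s]"
    by simp (rule brd_nat; (rule ty)+)
  have hex: "\<a>\<^sup>-\<^sup>1[obj s,obj Unt,obj Unt] \<cdot> \<c>[\<I> \<odot> \<I>,obj s] \<cdot> \<a>\<^sup>-\<^sup>1[obj Unt,obj Unt,obj s]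
      = (\<c>[\<I>,obj s] \<otimes> \<i>[obj Unt]) \<cdot> \<a>\<^sup>-\<^sup>1[obj Unt,obj s,obj Unt] \<cdot> (\<i>[obj Unt] \<otimes> \<c>[\<I>,obj s])"
    by simp (rule hexagon'; (rule ty)+)
  have "u Z = \<i>[stack (leaves s) Z]" if Z: "Z \<in> Obj C" for Z
  proof -
    have uh: "u Z \<in> hom C (stack (leaves s) Z) (stack (leaves s) Z)"
      and vh: "v Z \<in> hom C (stack (leaves s) Z) (stack (leaves s) Z)"
      using representsD(2)[OF u Z] representsD(2)[OF v Z] by simp_all
    note un = idt_left[OF uh] idt_right[OF uh] idt_left[OF vh] idt_right[OF vh] stack_arr_idt[OF Z]
    have uv: "u Z = v Z"
      using represents_unique[OF represents_cmp[OF represents_tarr_left[OF represents_lunt[of Unt], of s] u]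
          represents_cmp[OF v represents_tarr_right[OF represents_lunt[of Unt], of s], folded nat] Z] un
      by simp
    have "v Z = u Z \<cdot> u Z"
      using represents_unique[OF represents_cmp[OF represents_cmp[OF represents_assc_inv[of Unt Unt s] v] represents_assc_inv[of s Unt Unt], unfolded hex]
          represents_cmp[OF represents_cmp[OF represents_tarr_right[OF u, of Unt] represents_assc_inv[of Unt s Unt]] represents_tarr_left[OF u, of Unt]] Z] un
      by simp
    then show ?thesis
      using represents_idempotent[OF u _ _ Z] uv brd_iso[OF unt_Obj obj_Obj] by simp
  qed
  then show ?thesis by (rule represents_cong[OF u])
qed

end

section \<open>String diagrams\<close>

datatype letter= Fob | Bob

datatype node = Mul letter | Uni letter | Com letter | Cou letter | Act | Coact | Cross letter letter

text \<open>A tree and not a word, since the arrow assigned to a node has a bracketed domain in the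
  category; \<open>src\<close> and \<open>tgt\<close> retain only the strands.\<close>

primrec ndom :: "node \<Rightarrow> letter tree" where
  "ndom (Mul x) = Tens (Leaf x) (Leaf x)"
| "ndom (Uni x) = Unt"
| "ndom (Com x) = Leaf x"
| "ndom (Cou x) = Leaf x"
| "ndom Act = Tens (Leaf Bob) (Leaf Fob)"
| "ndom Coact = Leaf Fob"
| "ndom (Cross x y) = Tens (Leaf x) (Leaf y)"

primrec ncod :: "node \<Rightarrow> letter tree" where
  "ncod (Mul x) = Leaf x"
| "ncod (Uni x) = Leaf x"
| "ncod (Com x) = Tens (Leaf x) (Leaf x)"
| "ncod (Cou x) = Unt"
| "ncod Act = Leaf Fob"
| "ncod Coact = Tens (Leaf Bob) (Leaf Fob)"
| "ncod (Cross x y) = Tens (Leaf y) (Leaf x)"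

abbreviation src :: "node \<Rightarrow> letter list" where "src n \<equiv> leaves (ndom n)"
abbreviation tgt :: "node \<Rightarrow> letter list" where "tgt n \<equiv> leaves (ncod n)"

text \<open>
  A string diagram, read from top to bottom: the layer \<open>(k, n)\<close> applies the node \<open>n\<close> to the
  strands starting at position \<open>k\<close>.
\<close>

type_synonym diagram = "(nat \<times> node) list"

text \<open>The bound on \<open>k\<close> matters for units: their list of input strands is empty,
  so the second condition is vacuous for them.\<close>

definition fits :: "letter list \<Rightarrow> nat \<Rightarrow> node \<Rightarrow> bool" where
  "fits w k n \<longleftrightarrow> k \<le> length w \<and> take (length (src n)) (drop k w) = src n"

definition after :: "letter list \<Rightarrow> nat \<Rightarrow> node \<Rightarrow> letter list" where
  "after w k n = take k w @ tgt n @ drop (k + length (src n)) w"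

fun run :: "letter list \<Rightarrow> diagram \<Rightarrow> letter list option" where
  "run w [] = Some w"
| "run w ((k, n) # d) = (if fits w k n then run (after w k n) d else None)"

definition shift :: "nat \<Rightarrow> diagram \<Rightarrow> diagram" where
  "shift i d = map (\<lambda>(k, n). (i + k, n)) d"

lemma shift_simps [simp]:
  "shift i [] = []" "shift i ((k, n) # d) = (i + k, n) # shift i d"
  "shift i (d @ e) = shift i d @ shift i e" "shift 0 d = d" "length (shift i d) = length d"
  "shift i (shift j d) = shift (i + j) d"
  by (auto simp: shift_def add.assoc)

lemma fitsE:
  assumes "fits w k n"
  obtains xs ys where "w = xs @ src n @ ys" "length xs = k"
proof
  have "drop k w = src n @ drop (length (src n)) (drop k w)"
    using assms append_take_drop_id[of "length (src n)" "drop k w"] by (simp add: fits_def)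
  then show "w = take k w @ src n @ drop (length (src n)) (drop k w)"
    using append_take_drop_id[of k w] by simp
  show "length (take k w) = k" using assms by (simp add: fits_def)
qed

lemma fits_append [simp]: "fits (xs @ src n @ ys) (length xs) n"
  by (simp add: fits_def)

lemma after_append [simp]: "after (xs @ src n @ ys) (length xs) n = xs @ tgt n @ ys"
  by (simp add: after_def)

lemma run_append: "run w (d @ e) = Option.bind (run w d) (\<lambda>v. run v e)"
  by (induction w d rule: run.induct) auto

section \<open>Semantics and equality of diagrams\<close>

locale signature = diagrams C lobj
  for C :: "('o, 'm, 'x) braided_cat_scheme" (structure) and lobj :: "letter \<Rightarrow> 'o" +
  fixes narr :: "node \<Rightarrow> 'm"
  assumes narr_hom: "narr n \<in> hom C (obj (ndom n)) (obj (ncod n))"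
    and narr_Cross: "narr (Cross x y) = \<c>[lobj x,lobj y]"
begin

definition node_family :: "node \<Rightarrow> 'o \<Rightarrow> 'm" where
  "node_family n Z = flatten (ncod n) Z \<cdot> ((narr n \<otimes> \<i>[Z]) \<cdot> inverse_arrow C (flatten (ndom n) Z))"

lemma represents_node_family: "represents (ndom n) (narr n) (ncod n) (node_family n)"
  using represents_exists[OF narr_hom] unfolding node_family_def .

text \<open>Whiskering on both sides: the strands to the left act through \<open>stack_arr\<close>,
  those to the right are part of the tail.\<close>

definition layer :: "letter list \<Rightarrow> nat \<Rightarrow> node \<Rightarrow> 'o \<Rightarrow> 'm" where
  "layer w k n Z = stack_arr (take k w) (node_family n (stack (drop (k + length (src n)) w) Z))"

lemma layer_append [simp]: "layer (xs @ src n @ ys) (length xs) n Z = stack_arr xs (node_family n (stack ys Z))"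
  by (simp add: layer_def)

text \<open>Also defined on ill-typed diagrams, where the value means nothing; success of
  \<open>run\<close> is what guards it.\<close>

fun ev :: "letter list \<Rightarrow> diagram \<Rightarrow> 'o \<Rightarrow> 'm" where
  "ev w [] Z = \<i>[stack w Z]"
| "ev w ((k, n) # d) Z = ev (after w k n) d Z \<cdot> layer w k n Z"

lemma layer_hom:
  assumes "fits w k n" "Z \<in> Obj C"
  shows "layer w k n Z \<in> hom C (stack w Z) (stack (after w k n) Z)"
  using assms(1)
proof (rule fitsE)
  fix xs ys assume "w = xs @ src n @ ys" "length xs = k"
  then show ?thesis
    using stack_arr_hom[OF representsD(2)[OF represents_node_family stack_Obj[OF assms(2)]], of xs n ys] by (auto simp: stack_append)
qed

lemma ev_hom: "run w d = Some v \<Longrightarrow> Z \<in> Obj C \<Longrightarrow> ev w d Z \<in> hom C (stack w Z) (stack v Z)"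
proof (induction w d rule: run.induct)
  case (2 w k n d)
  then show ?case by (auto split: if_splits intro!: cmp_hom layer_hom)
qed (simp add: idt_hom stack_Obj)

lemma ev_append:
  "run w d = Some v \<Longrightarrow> run v e = Some u \<Longrightarrow> Z \<in> Obj C \<Longrightarrow> ev w (d @ e) Z = ev v e Z \<cdot> ev w d Z"
proof (induction w d rule: run.induct)
  case (1 w)
  then show ?case using idt_right[OF ev_hom] by simp
next
  case (2 w k n d)
  then have f: "fits w k n" and r: "run (after w k n) d = Some v" by (auto split: if_splits)
  show ?case
    using 2 f r cmp_assoc[OF layer_hom[OF f] ev_hom[OF r] ev_hom[OF 2(3)]] by simp
qed

lemma ev_context:
  "run w d = Some v \<Longrightarrow> Z \<in> Obj C \<Longrightarrow>
     run (xs @ w @ ys) (shift (length xs) d) = Some (xs @ v @ ys) \<and>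
     ev (xs @ w @ ys) (shift (length xs) d) Z = stack_arr xs (ev w d (stack ys Z))"
proof (induction w d rule: run.induct)
  case (1 w)
  then show ?case by (simp add: stack_append stack_arr_idt stack_Obj)
next
  case (2 w k n d)
  then have f: "fits w k n" and r: "run (after w k n) d = Some v" by (auto split: if_splits)
  from f show ?case
  proof (rule fitsE)
    fix us vs assume w: "w = us @ src n @ vs" "length us = k"
    note IH = 2(1)[OF f r 2(3)]
    have k: "length xs + k = length (xs @ us)" using w by simp
    have w': "xs @ w @ ys = (xs @ us) @ src n @ (vs @ ys)" using w by simp
    have fit: "fits (xs @ w @ ys) (length xs + k) n" unfolding k w' by (rule fits_append)
    have aft: "after (xs @ w @ ys) (length xs + k) n = xs @ after w k n @ ys"
      unfolding k w' after_append using w after_append[of us n vs] by simp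
    have layer: "layer (xs @ w @ ys) (length xs + k) n Z = stack_arr xs (layer w k n (stack ys Z))"
      unfolding k w' layer_append using w layer_append[of us n vs] by (simp add: stack_arr_append stack_append)
    have Y: "stack ys Z \<in> Obj C" by (rule stack_Obj[OF 2(3)])
    show ?thesis
      using IH fit aft layer stack_arr_cmp[OF layer_hom[OF f Y] ev_hom[OF r Y], of xs] by simp
  qed
qed

text \<open>Equality is required at every tail, because strands to the right of a rewritten part are
  a change of tail. Typing is included, so the relation is reflexive on well-typed diagrams
  only.\<close>

definition deq :: "letter list \<Rightarrow> diagram \<Rightarrow> diagram \<Rightarrow> bool" where
  "deq w d e \<longleftrightarrow> (\<exists>v. run w d = Some v \<and> run w e = Some v \<and> (\<forall>Z\<in>Obj C. ev w d Z = ev w e Z))"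

lemma deq_refl: "run w d = Some v \<Longrightarrow> deq w d d"
  by (simp add: deq_def)

lemma deq_sym: "deq w d e \<Longrightarrow> deq w e d"
  by (auto simp: deq_def)

lemma deq_trans: "deq w d e \<Longrightarrow> deq w e f \<Longrightarrow> deq w d f"
  by (auto simp: deq_def)

text \<open>Replacement inside a larger diagram: \<open>xs\<close> and \<open>ys\<close> are the
  strands beside the replaced part, \<open>p\<close> and \<open>q\<close> the layers above and
  below. Both sides of a rule end in the same word, so \<open>q\<close> still fits.\<close>

lemma deq_context:
  assumes "deq w l r" "run u p = Some (xs @ w @ ys)" "run u (p @ shift (length xs) l @ q) = Some t"
  shows "deq u (p @ shift (length xs) l @ q) (p @ shift (length xs) r @ q)"
proof -
  from assms(1) obtain v where v: "run w l = Some v" "run w r = Some v"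
    and eq: "\<And>Z. Z \<in> Obj C \<Longrightarrow> ev w l Z = ev w r Z"
    by (auto simp: deq_def)
  note cl = ev_context[OF v(1) unt_Obj, THEN conjunct1, of xs ys]
  note cr = ev_context[OF v(2) unt_Obj, THEN conjunct1, of xs ys]
  have q: "run (xs @ v @ ys) q = Some t"
    using assms(2,3) cl by (simp add: run_append)
  have rl: "run (xs @ w @ ys) (shift (length xs) l @ q) = Some t"
    and rr: "run (xs @ w @ ys) (shift (length xs) r @ q) = Some t"
    using cl cr q by (simp_all add: run_append)
  have "ev u (p @ shift (length xs) l @ q) Z = ev u (p @ shift (length xs) r @ q) Z" if Z: "Z \<in> Obj C" for Z
    using ev_append[OF assms(2) rl Z] ev_append[OF assms(2) rr Z] ev_append[OF cl q Z] ev_append[OF cr q Z]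
      ev_context[OF v(1) Z, of xs ys] ev_context[OF v(2) Z, of xs ys] eq[OF stack_Obj[OF Z]] by simp
  then show ?thesis
    using assms(2) rl rr by (auto simp: deq_def run_append)
qed

text \<open>Seen from \<open>n\<close>, the node \<open>m\<close> together with the strands
  \<open>ys\<close> is an arrow of the tail, so this is naturality of the family of
  \<open>n\<close>.\<close>

lemma deq_exchange:
  fixes xs ys zs :: "letter list" and m n :: node
  shows "deq (xs @ src n @ ys @ src m @ zs)
     [(length xs, n), (length xs + length (tgt n) + length ys, m)]
     [(length xs + length (src n) + length ys, m), (length xs, n)]"
proof -
  let ?w = "xs @ src n @ ys @ src m @ zs"
  have eqs: "length xs + length (tgt n) + length ys = length (xs @ tgt n @ ys)"
    "length xs + length (src n) + length ys = length (xs @ src n @ ys)" by simp_all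
  have a: "fits (xs @ tgt n @ ys @ src m @ zs) (length (xs @ tgt n @ ys)) m"
    "after (xs @ tgt n @ ys @ src m @ zs) (length (xs @ tgt n @ ys)) m = xs @ tgt n @ ys @ tgt m @ zs"
    "layer (xs @ tgt n @ ys @ src m @ zs) (length (xs @ tgt n @ ys)) m Z = stack_arr (xs @ tgt n @ ys) (node_family m (stack zs Z))" for Z
    using fits_append[of "xs @ tgt n @ ys" m zs] after_append[of "xs @ tgt n @ ys" m zs]
      layer_append[of "xs @ tgt n @ ys" m zs] by simp_all
  have b: "fits ?w (length (xs @ src n @ ys)) m"
    "after ?w (length (xs @ src n @ ys)) m = xs @ src n @ ys @ tgt m @ zs"
    "layer ?w (length (xs @ src n @ ys)) m Z = stack_arr (xs @ src n @ ys) (node_family m (stack zs Z))" for Z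
    using fits_append[of "xs @ src n @ ys" m zs] after_append[of "xs @ src n @ ys" m zs]
      layer_append[of "xs @ src n @ ys" m zs] by simp_all
  have eq: "layer (xs @ tgt n @ ys @ src m @ zs) (length (xs @ tgt n @ ys)) m Z \<cdot> layer ?w (length xs) n Z
      = layer (xs @ src n @ ys @ tgt m @ zs) (length xs) n Z \<cdot> layer ?w (length (xs @ src n @ ys)) m Z"
    if Z: "Z \<in> Obj C" for Z
  proof -
    let ?h = "stack_arr ys (node_family m (stack zs Z))"
    have h: "?h \<in> hom C (stack (ys @ src m @ zs) Z) (stack (ys @ tgt m @ zs) Z)"
      using stack_arr_hom[OF representsD(2)[OF represents_node_family stack_Obj[OF Z]], of ys m zs] by (simp add: stack_append)
    note n1 = representsD(2)[OF represents_node_family[of n] stack_Obj[OF Z], of "ys @ src m @ zs"]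
      and n2 = representsD(2)[OF represents_node_family[of n] stack_Obj[OF Z], of "ys @ tgt m @ zs"]
    show ?thesis
      unfolding a(3) b(3) layer_append stack_arr_append
      using represents_natural[OF represents_node_family[of n] h] stack_arr_cmp[OF n1 stack_arr_hom[OF h], of xs] stack_arr_cmp[OF stack_arr_hom[OF h] n2, of xs]
      by simp
  qed
  have H: "layer ?w (length xs) n Z \<in> hom C (stack ?w Z) (stack (xs @ tgt n @ ys @ src m @ zs) Z)"
    "layer ?w (length (xs @ src n @ ys)) m Z \<in> hom C (stack ?w Z) (stack (xs @ src n @ ys @ tgt m @ zs) Z)"
    "layer (xs @ tgt n @ ys @ src m @ zs) (length (xs @ tgt n @ ys)) m Z
       \<in> hom C (stack (xs @ tgt n @ ys @ src m @ zs) Z) (stack (xs @ tgt n @ ys @ tgt m @ zs) Z)"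
    "layer (xs @ src n @ ys @ tgt m @ zs) (length xs) n Z
       \<in> hom C (stack (xs @ src n @ ys @ tgt m @ zs) Z) (stack (xs @ tgt n @ ys @ tgt m @ zs) Z)"
    if Z: "Z \<in> Obj C" for Z
    using layer_hom[OF fits_append Z, of xs n "ys @ src m @ zs"] layer_hom[OF b(1) Z] layer_hom[OF a(1) Z]
      layer_hom[OF fits_append Z, of xs n "ys @ tgt m @ zs"] a(2) b(2) by simp_all
  show ?thesis
    unfolding deq_def eqs
    by (auto simp: a(1,2) b(1,2) idt_left[OF H(3)] idt_left[OF H(4)] eq simp del: length_append layer_append)
qed

end

section \<open>Braidings of words, and the diagrams of arrows\<close>

primrec cross1 :: "letter \<Rightarrow> letter list \<Rightarrow> diagram" where
  "cross1 x [] = []"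
| "cross1 x (y # w) = (0, Cross x y) # shift 1 (cross1 x w)"

text \<open>The braiding of two words, resolved into crossings of single strands in the order that
  the hexagons dictate.\<close>

primrec cross :: "letter list \<Rightarrow> letter list \<Rightarrow> diagram" where
  "cross [] w = []"
| "cross (x # v) w = shift 1 (cross v w) @ cross1 x w"

lemma cross1_append: "cross1 x (v @ w) = cross1 x v @ shift (length v) (cross1 x w)"
  by (induction v) simp_all

lemma cross_append: "cross (u @ v) w = shift (length u) (cross v w) @ cross u w"
  by (induction u) simp_all

context signature
begin

text \<open>The trees belong to the relation because one diagram stands for many arrows, which
  differ by constraints.\<close>

definition depicts :: "letter tree \<Rightarrow> 'm \<Rightarrow> letter tree \<Rightarrow> diagram \<Rightarrow> bool" where
  "depicts s f t d \<longleftrightarrow> run (leaves s) d = Some (leaves t) \<and> represents s f t (ev (leaves s) d)"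

lemma depicts_idt: "obj s = X \<Longrightarrow> depicts s \<i>[X] s []"
  using represents_idt[of s] by (auto simp: depicts_def elim: represents_cong)

lemma depicts_cmp: "depicts s f t d \<Longrightarrow> depicts t g u e \<Longrightarrow> depicts s (g \<cdot> f) u (d @ e)"
  unfolding depicts_def
  by (auto simp: run_append ev_append intro: represents_cong[OF represents_cmp])

text \<open>Layers are sequential, so \<open>f\<close> is drawn first; the offset of
  \<open>e\<close> therefore counts the outputs of \<open>f\<close>, not its inputs.\<close>

lemma depicts_tarr:
  assumes f: "depicts s f s' d" and g: "depicts t g t' e"
  shows "depicts (Tens s t) (f \<otimes> g) (Tens s' t') (d @ shift (length (leaves s')) e)"
proof -
  note F = f[unfolded depicts_def] and G = g[unfolded depicts_def]
  have 1: "run (leaves s @ leaves t) d = Some (leaves s' @ leaves t)"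
    "ev (leaves s @ leaves t) d Z = ev (leaves s) d (stack (leaves t) Z)" if "Z \<in> Obj C" for Z
    using ev_context[of "leaves s" d "leaves s'" Z "[]" "leaves t"] F that by simp_all
  have 2: "run (leaves s' @ leaves t) (shift (length (leaves s')) e) = Some (leaves s' @ leaves t')"
    "ev (leaves s' @ leaves t) (shift (length (leaves s')) e) Z = stack_arr (leaves s') (ev (leaves t) e Z)"
    if "Z \<in> Obj C" for Z
    using ev_context[of "leaves t" e "leaves t'" Z "leaves s'" "[]"] G that by simp_all
  note R = represents_cmp[OF represents_tarr_left[of s f s' "ev (leaves s) d" t] represents_tarr_right[of t g t' "ev (leaves t) e" s']]
  have "represents (Tens s t) (f \<otimes> g) (Tens s' t') (ev (leaves (Tens s t)) (d @ shift (length (leaves s')) e))"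
    by (rule represents_cong[OF R[unfolded tarr_split[OF representsD(1) representsD(1), OF conjunct2[OF F] conjunct2[OF G]]]])
      (use F G 1 2 ev_append[OF 1(1) 2(1)] unt_Obj in auto)
  then show ?thesis using 1(1)[OF unt_Obj] 2(1)[OF unt_Obj] by (simp add: depicts_def run_append)
qed

lemma depicts_structure:
  assumes "represents s f t (\<lambda>Z. \<i>[stack w Z])" "leaves s = w" "leaves t = w"
  shows "depicts s f t []"
  using assms by (auto simp: depicts_def elim: represents_cong)

lemma depicts_assc:
  assumes "obj s = X" "obj t = Y" "obj u = Z"
  shows "depicts (Tens (Tens s t) u) \<a>[X,Y,Z] (Tens s (Tens t u)) []"
    "depicts (Tens s (Tens t u)) \<a>\<^sup>-\<^sup>1[X,Y,Z] (Tens (Tens s t) u) []"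
  using assms by (auto intro: depicts_structure[OF represents_assc] depicts_structure[OF represents_assc_inv])

lemma depicts_unit:
  assumes "obj s = X"
  shows "depicts (Tens Unt s) \<l>[X] s []" "depicts s \<l>\<^sup>-\<^sup>1[X] (Tens Unt s) []"
    "depicts (Tens s Unt) \<r>[X] s []" "depicts s \<r>\<^sup>-\<^sup>1[X] (Tens s Unt) []"
  using assms by (auto intro: depicts_structure[OF represents_lunt] depicts_structure[OF represents_lunt_inv]
      depicts_structure[OF represents_runt] depicts_structure[OF represents_runt_inv])

lemma depicts_narr: "depicts (ndom n) (narr n) (ncod n) [(0, n)]"
proof -
  note f = fits_append[of "[]" n "[]"] and a = after_append[of "[]" n "[]"] and l = layer_append[of "[]" n "[]"]
  show ?thesis
    unfolding depicts_def
    using f a l representsD(2)[OF represents_node_family] by (auto intro!: represents_cong[OF represents_node_family] idt_left[symmetric])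
qed

text \<open>Uniqueness of families gives one direction, faithfulness the other. This is the bridge
  between equations of arrows and rewriting.\<close>

lemma depicts_eq:
  assumes "depicts s f t d" "depicts s g t e"
  shows "f = g \<longleftrightarrow> deq (leaves s) d e"
proof
  assume "f = g"
  then show "deq (leaves s) d e"
    using assms represents_unique by (auto simp: depicts_def deq_def)
next
  assume "deq (leaves s) d e"
  then show "f = g"
    using assms by (auto simp: depicts_def deq_def intro: represents_faithful)
qed

lemma depicts_brd_leaf: "depicts (Tens (Leaf x) t) \<c>[lobj x,obj t] (Tens t (Leaf x)) (cross1 x (leaves t))"
proof (induction t)
  case Unt
  then show ?case using depicts_structure[OF represents_brd_unt_right[of "Leaf x"]] by simp
next
  case (Leaf y)
  then show ?case using depicts_narr[of "Cross x y"] by (simp add: narr_Cross)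
next
  case (Tens t u)
  let ?X = "lobj x" and ?Y = "obj t" and ?Z = "obj u"
  note ty = typing brd_hom
  have A: "\<a>[?Y,?Z,?X] \<in> hom C (?Y \<odot> ?Z \<odot> ?X) (?Y \<odot> (?Z \<odot> ?X))"
    and B: "\<a>[?X,?Y,?Z] \<in> hom C (?X \<odot> ?Y \<odot> ?Z) (?X \<odot> (?Y \<odot> ?Z))"
    and c: "\<c>[?X,?Y \<odot> ?Z] \<in> hom C (?X \<odot> (?Y \<odot> ?Z)) (?Y \<odot> ?Z \<odot> ?X)"
    by (rule ty)+
  note A' = inverse_arrow[OF assc_iso A, OF obj_Obj obj_Obj lobj_Obj]
    and B' = inverse_arrow[OF assc_iso B, OF lobj_Obj obj_Obj obj_Obj]
  let ?f = "(\<i>[?Y] \<otimes> \<c>[?X,?Z]) \<cdot> \<a>[?Y,?X,?Z] \<cdot> (\<c>[?X,?Y] \<otimes> \<i>[?Z])"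
  \<comment> \<open>The hexagon is solved for the braiding with a tensor product, which the
    induction hypotheses then resolve.\<close>
  have "\<a>\<^sup>-\<^sup>1[?Y,?Z,?X] \<cdot> (\<a>[?Y,?Z,?X] \<cdot> (\<c>[?X,?Y \<odot> ?Z] \<cdot> \<a>[?X,?Y,?Z])) = \<c>[?X,?Y \<odot> ?Z] \<cdot> \<a>[?X,?Y,?Z]"
    using cmp_assoc[OF cmp_hom[OF B c] A A'(1)] A'(2) idt_left[OF cmp_hom[OF B c]] by simp
  then have "(\<a>\<^sup>-\<^sup>1[?Y,?Z,?X] \<cdot> ?f) \<cdot> \<a>\<^sup>-\<^sup>1[?X,?Y,?Z] = (\<c>[?X,?Y \<odot> ?Z] \<cdot> \<a>[?X,?Y,?Z]) \<cdot> \<a>\<^sup>-\<^sup>1[?X,?Y,?Z]"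
    by (simp add: hexagon obj_Obj lobj_Obj)
  also have "\<dots> = \<c>[?X,?Y \<odot> ?Z]"
    using cmp_assoc[OF B'(1) B c] B'(3) idt_right[OF c] by simp
  finally have *: "\<c>[?X,?Y \<odot> ?Z] = (\<a>\<^sup>-\<^sup>1[?Y,?Z,?X] \<cdot> ?f) \<cdot> \<a>\<^sup>-\<^sup>1[?X,?Y,?Z]" ..
  \<comment> \<open>The list is spelled in the shape that the rules produce; its empty parts stem
    from constraints and identities.\<close>
  have "depicts (Tens (Leaf x) (Tens t u)) ((\<a>\<^sup>-\<^sup>1[?Y,?Z,?X] \<cdot> ?f) \<cdot> \<a>\<^sup>-\<^sup>1[?X,?Y,?Z]) (Tens (Tens t u) (Leaf x))
     ([] @ ((((cross1 x (leaves t) @ shift (length (leaves (Tens t (Leaf x)))) []) @ [])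
        @ ([] @ shift (length (leaves t)) (cross1 x (leaves u)))) @ []))"
    by (rule depicts_cmp depicts_tarr depicts_assc depicts_idt Tens obj.simps refl)+
  then show ?case by (simp add: * cross1_append)
qed

lemma depicts_brd:
  assumes "obj s = X" "obj t = Y"
  shows "depicts (Tens s t) \<c>[X,Y] (Tens t s) (cross (leaves s) (leaves t))"
  unfolding assms[symmetric]
proof (induction s)
  case Unt
  then show ?case using depicts_structure[OF represents_brd_unt_left[of t]] by simp
next
  case (Leaf x)
  then show ?case using depicts_brd_leaf by simp
next
  case (Tens s u)
  let ?X = "obj s" and ?Y = "obj u" and ?Z = "obj t"
  note ty = typing brd_hom
  have A: "\<a>[?Z,?X,?Y] \<in> hom C (?Z \<odot> ?X \<odot> ?Y) (?Z \<odot> (?X \<odot> ?Y))"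
    and B: "\<a>[?X,?Y,?Z] \<in> hom C (?X \<odot> ?Y \<odot> ?Z) (?X \<odot> (?Y \<odot> ?Z))"
    and c: "\<c>[?X \<odot> ?Y,?Z] \<in> hom C (?X \<odot> ?Y \<odot> ?Z) (?Z \<odot> (?X \<odot> ?Y))"
    by (rule ty)+
  note A' = inverse_arrow[OF assc_iso A, OF obj_Obj obj_Obj obj_Obj]
    and B' = inverse_arrow[OF assc_iso B, OF obj_Obj obj_Obj obj_Obj]
  let ?f = "(\<c>[?X,?Z] \<otimes> \<i>[?Y]) \<cdot> \<a>\<^sup>-\<^sup>1[?X,?Z,?Y] \<cdot> (\<i>[?X] \<otimes> \<c>[?Y,?Z])"
  have "\<a>[?Z,?X,?Y] \<cdot> (\<a>\<^sup>-\<^sup>1[?Z,?X,?Y] \<cdot> (\<c>[?X \<odot> ?Y,?Z] \<cdot> \<a>\<^sup>-\<^sup>1[?X,?Y,?Z])) = \<c>[?X \<odot> ?Y,?Z] \<cdot> \<a>\<^sup>-\<^sup>1[?X,?Y,?Z]"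
    using cmp_assoc[OF cmp_hom[OF B'(1) c] A'(1) A] A'(3) idt_left[OF cmp_hom[OF B'(1) c]] by simp
  then have "(\<a>[?Z,?X,?Y] \<cdot> ?f) \<cdot> \<a>[?X,?Y,?Z] = (\<c>[?X \<odot> ?Y,?Z] \<cdot> \<a>\<^sup>-\<^sup>1[?X,?Y,?Z]) \<cdot> \<a>[?X,?Y,?Z]"
    by (simp add: hexagon' obj_Obj)
  also have "\<dots> = \<c>[?X \<odot> ?Y,?Z]"
    using cmp_assoc[OF B B'(1) c] B'(2) idt_right[OF c] by simp
  finally have *: "\<c>[?X \<odot> ?Y,?Z] = (\<a>[?Z,?X,?Y] \<cdot> ?f) \<cdot> \<a>[?X,?Y,?Z]" ..
  have "depicts (Tens (Tens s u) t) ((\<a>[?Z,?X,?Y] \<cdot> ?f) \<cdot> \<a>[?X,?Y,?Z]) (Tens t (Tens s u))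
     ([] @ ((([] @ shift (length (leaves s)) (cross (leaves u) (leaves t))) @ [])
        @ (cross (leaves s) (leaves t) @ shift (length (leaves (Tens t s))) [])) @ [])"
    by (rule depicts_cmp depicts_tarr depicts_assc depicts_idt Tens refl)+
  then show ?case by (simp add: * cross_append)
qed

lemma deq_natural_left: "deq (x # src n) (shift 1 [(0, n)] @ cross [x] (tgt n)) (cross [x] (src n) @ [(0, n)])"
proof -
  let ?X = "lobj x"
  have "\<c>[?X,obj (ncod n)] \<cdot> (\<i>[?X] \<otimes> narr n) = (narr n \<otimes> \<i>[?X]) \<cdot> \<c>[?X,obj (ndom n)]"
    by (rule brd_nat[OF idt_hom[OF lobj_Obj] narr_hom])
  moreover have "depicts (Tens (Leaf x) (ndom n)) (\<c>[?X,obj (ncod n)] \<cdot> (\<i>[?X] \<otimes> narr n)) (Tens (ncod n) (Leaf x))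
      (([] @ shift (length (leaves (Leaf x))) [(0, n)]) @ cross (leaves (Leaf x)) (tgt n))"
    by (rule depicts_cmp depicts_tarr depicts_brd depicts_narr depicts_idt obj.simps refl)+
  moreover have "depicts (Tens (Leaf x) (ndom n)) ((narr n \<otimes> \<i>[?X]) \<cdot> \<c>[?X,obj (ndom n)]) (Tens (ncod n) (Leaf x))
      (cross (leaves (Leaf x)) (src n) @ ([(0, n)] @ shift (length (tgt n)) []))"
    by (rule depicts_cmp depicts_tarr depicts_brd depicts_narr depicts_idt obj.simps refl)+
  ultimately show ?thesis using depicts_eq by fastforce
qed

lemma deq_natural_right: "deq (src n @ [x]) ([(0, n)] @ cross (tgt n) [x]) (cross (src n) [x] @ shift 1 [(0, n)])"
proof -
  let ?X = "lobj x"
  have "\<c>[obj (ncod n),?X] \<cdot> (narr n \<otimes> \<i>[?X]) = (\<i>[?X] \<otimes> narr n) \<cdot> \<c>[obj (ndom n),?X]"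
    by (rule brd_nat[OF narr_hom idt_hom[OF lobj_Obj]])
  moreover have "depicts (Tens (ndom n) (Leaf x)) (\<c>[obj (ncod n),?X] \<cdot> (narr n \<otimes> \<i>[?X])) (Tens (Leaf x) (ncod n))
      (([(0, n)] @ shift (length (tgt n)) []) @ cross (tgt n) (leaves (Leaf x)))"
    by (rule depicts_cmp depicts_tarr depicts_brd depicts_narr depicts_idt obj.simps refl)+
  moreover have "depicts (Tens (ndom n) (Leaf x)) ((\<i>[?X] \<otimes> narr n) \<cdot> \<c>[obj (ndom n),?X]) (Tens (Leaf x) (ncod n))
      (cross (src n) (leaves (Leaf x)) @ ([] @ shift (length (leaves (Leaf x))) [(0, n)]))"
    by (rule depicts_cmp depicts_tarr depicts_brd depicts_narr depicts_idt obj.simps refl)+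
  ultimately show ?thesis using depicts_eq by fastforce
qed

end

section \<open>Rewriting certificates\<close>

text \<open>The offsets change by the arity of the node that is passed on its left. Both tests
  succeed only for a counit directly above a unit at the same position; the unit then goes to the
  right.\<close>

fun swap ::"nat \<times> node \<Rightarrow> nat \<times> node \<Rightarrow> ((nat \<times> node) \<times> (nat \<times> node)) option" where
  "swap (k, n) (j, m) =
     (if k + length (tgt n) \<le> j then Some ((j - length (tgt n) + length (src n), m), (k, n))
      else if j + length (src m) \<le> k then Some ((j, m), (k - length (src m) + length (tgt m), n))
      else None)"

fun pull :: "diagram \<Rightarrow> nat \<times> node \<Rightarrow> diagram option" where
  "pull [] b = Some [b]"
| "pull (a # s) b =
     (case pull s b of Some (b' # s') \<Rightarrow> map_option (\<lambda>(b'', a'). b'' # a' # s') (swap a b')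
      | _ \<Rightarrow> None)"

datatype 'r move = Pull nat nat | Fwd 'r nat nat | Bwd 'r nat nat

text \<open>
  \<open>Pull i j\<close> moves layer \<open>i\<close> up to index \<open>j\<close> by interchanges; \<open>Fwd r p k\<close> and \<open>Bwd r p k\<close>
  rewrite the layers from index \<open>p\<close> on with the rule \<open>r\<close>, placed at strand \<open>k\<close>.
\<close>

definition rewrite :: "letter list \<Rightarrow> letter list \<Rightarrow> diagram \<Rightarrow> diagram \<Rightarrow> nat \<Rightarrow> nat \<Rightarrow> diagram \<Rightarrow> diagram option" where
  "rewrite u w l r p k d =
     (case run u (take p d) of None \<Rightarrow> None
      | Some v \<Rightarrow>
         if k \<le> length v \<and> take (length w) (drop k v) = w \<and> take (length l) (drop p d) = shift k l
         then Some (take p d @ shift k r @ drop (length l) (drop p d)) else None)"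

fun step :: "('r \<Rightarrow> letter list \<times> diagram \<times> diagram) \<Rightarrow> letter list \<Rightarrow> 'r move \<Rightarrow> diagram \<Rightarrow> diagram option" where
  "step R u (Pull i j) d =
     (case drop i d of [] \<Rightarrow> None
      | b # q \<Rightarrow> if j \<le> i then map_option (\<lambda>s. take j d @ s @ q) (pull (drop j (take i d)) b) else None)"
| "step R u (Fwd r p k) d = (case R r of (w, l, l') \<Rightarrow> rewrite u w l l' p k d)"
| "step R u (Bwd r p k) d = (case R r of (w, l, l') \<Rightarrow> rewrite u w l' l p k d)"

fun replay :: "('r \<Rightarrow> letter list \<times> diagram \<times> diagram) \<Rightarrow> letter list \<Rightarrow> 'r move list \<Rightarrow> diagram \<Rightarrow> diagram option" where
  "replay R u [] d = Some d"
| "replay R u (m # ms) d = (case step R u m d of None \<Rightarrow> None | Some e \<Rightarrow> replay R u ms e)"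

section \<open>Soundness of rewriting\<close>

context signature
begin

lemma deq_run: "deq w d e \<Longrightarrow> run w e = run w d"
  by (auto simp: deq_def)

lemma deq_swap:
  assumes "swap a b = Some (b', a')" "run w [a, b] = Some v"
  shows "deq w [a, b] [b', a']"
proof -
  obtain k n j m where ab: "a = (k, n)" "b = (j, m)" by (cases a, cases b)
  have fn: "fits w k n" and fm: "fits (after w k n) j m" using assms(2) ab by (auto split: if_splits)
  obtain xs rest where w: "w = xs @ src n @ rest" "length xs = k" by (rule fitsE[OF fn])
  have aft: "after w k n = xs @ tgt n @ rest" using after_append[of xs n rest] w by simp
  obtain xs' ys' where w': "xs @ tgt n @ rest = xs' @ src m @ ys'" "length xs' = j"
    using fm unfolding aft by (rule fitsE)
  show ?thesis
  proof (cases "k + length (tgt n) \<le> j")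
    case True
    \<comment> \<open>The strands between the outputs of \<open>n\<close> and the inputs of
      \<open>m\<close>; the other case is the same with the two nodes exchanged.\<close>
    define ys where "ys = drop (length (xs @ tgt n)) xs'"
    have "take (length (xs @ tgt n)) xs' = xs @ tgt n"
      using arg_cong[OF w'(1), of "take (length (xs @ tgt n))"] True w w'(2) by simp
    then have xs': "xs' = xs @ tgt n @ ys"
      unfolding ys_def by (metis append_take_drop_id append_assoc)
    then have "rest = ys @ src m @ ys'" using w'(1) by simp
    then show ?thesis
      using deq_exchange[of xs n ys m ys'] assms(1) True ab w xs' w'(2) by (auto simp: algebra_simps)
  next
    case False
    then have le: "j + length (src m) \<le> k" and e: "b' = (j, m)" "a' = (k - length (src m) + length (tgt m), n)"
      using assms(1) ab by (auto split: if_splits)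
    define ys where "ys = drop (length (xs' @ src m)) xs"
    have "take (length (xs' @ src m)) xs = xs' @ src m"
      using arg_cong[OF w'(1), of "take (length (xs' @ src m))"] le w w'(2) by simp
    then have xs: "xs = xs' @ src m @ ys"
      unfolding ys_def by (metis append_take_drop_id append_assoc)
    then show ?thesis
      using deq_sym[OF deq_exchange[of xs' m ys n rest]] ab w w'(2) e by (auto simp: algebra_simps)
  qed
qed

lemma deq_append:
  assumes "deq w d e" "run w (d @ q) = Some v"
  shows "deq w (d @ q) (e @ q)"
  using deq_context[of w d e w "[]" "[]" "[]" q] assms by simp

lemma deq_prepend:
  assumes "deq w d e" "run u p = Some w" "run u (p @ d @ q) = Some v"
  shows "deq u (p @ d @ q) (p @ e @ q)"
  using deq_context[of w d e u p "[]" "[]" q] assms by simp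

lemma deq_pull:
  "pull s b = Some e \<Longrightarrow> run w (s @ [b]) = Some v \<Longrightarrow> deq w (s @ [b]) e"
proof (induction s arbitrary: e w v)
  case Nil
  then show ?case using deq_refl by simp
next
  case (Cons a s)
  from Cons.prems(1) obtain b' s' b'' a' where p: "pull s b = Some (b' # s')"
    and sw: "swap a b' = Some (b'', a')" and e: "e = b'' # a' # s'"
    by (auto split: option.splits list.splits)
  obtain w1 where w1: "run w [a] = Some w1" "run w1 (s @ [b]) = Some v"
    using Cons.prems(2) run_append[of w "[a]" "s @ [b]"] by (cases "run w [a]") auto
  have 1: "deq w1 (s @ [b]) (b' # s')" by (rule Cons.IH[OF p w1(2)])
  have 2: "deq w (a # s @ [b]) (a # b' # s')"
    using deq_prepend[OF 1 w1(1), of "[]" v] Cons.prems(2) by simp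
  have r: "run w ([a, b'] @ s') = Some v"
    using deq_run[OF 2] Cons.prems(2) by simp
  then obtain v' where "run w [a, b'] = Some v'" unfolding run_append by (auto simp: bind_eq_Some_conv)
  from deq_append[OF deq_swap[OF sw this] r] 2 show ?case
    using deq_trans e by simp
qed

lemma deq_rewrite:
  assumes "deq w l r" "rewrite u w l r p k d = Some e" "run u d = Some v"
  shows "deq u d e"
proof -
  obtain t where t: "run u (take p d) = Some t"
    and k: "k \<le> length t" "take (length w) (drop k t) = w" "take (length l) (drop p d) = shift k l"
    and e: "e = take p d @ shift k r @ drop (length l) (drop p d)"
    using assms(2) by (auto simp: rewrite_def split: option.splits if_splits)
  have t': "t = take k t @ w @ drop (length w) (drop k t)"
    by (metis append_take_drop_id k(2))
  have l: "length (take k t) = k" using k(1) by simp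
  have d: "d = take p d @ shift k l @ drop (length l) (drop p d)"
    by (metis append_take_drop_id k(3))
  let ?q = "drop (length l) (drop p d)"
  have run: "run u (take p d @ shift k l @ ?q) = Some v" using assms(3) d by metis
  have "run u (take p d) = Some (take k t @ w @ drop (length w) (drop k t))" using t t' by metis
  from deq_context[OF assms(1) this, of ?q v] l run
  have "deq u (take p d @ shift k l @ ?q) (take p d @ shift k r @ ?q)" by simp
  then show ?thesis using d e by metis
qed

definition valid :: "letter list \<times> diagram \<times> diagram \<Rightarrow> bool" where
  "valid = (\<lambda>(w, l, r). deq w l r)"

lemma deq_step:
  assumes "step R u m d = Some e" "run u d = Some v" "\<And>r. r \<in> set_move m \<Longrightarrow> valid (R r)"
  shows "deq u d e"
proof (cases m)
  case (Pull i j)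
  obtain b q s where q: "drop i d = b # q" and s: "pull (drop j (take i d)) b = Some s"
    and ij: "j \<le> i" and e: "e = take j d @ s @ q"
    using assms(1) Pull by (auto split: list.splits if_splits)
  have "take j d @ drop j (take i d) = take i d"
    using append_take_drop_id[of j "take i d"] ij by (simp add: min_def)
  then have d: "d = take j d @ (drop j (take i d) @ [b]) @ q"
    using append_take_drop_id[of i d] q by (metis append.assoc append_Cons append_Nil)
  obtain t where t: "run u (take j d) = Some t"
    using assms(2) run_append[of u "take j d" "drop j d"] by (cases "run u (take j d)") auto
  obtain t' where t': "run t (drop j (take i d) @ [b]) = Some t'"
    using assms(2) t run_append[of u "take j d" "(drop j (take i d) @ [b]) @ q"]
      run_append[of t "drop j (take i d) @ [b]" q] d
    by (cases "run t (drop j (take i d) @ [b])") auto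
  show ?thesis
    using deq_prepend[OF deq_pull[OF s t'] t(1), of q v] d assms(2) e by simp
next
  case (Fwd r p k)
  obtain w l l' where R: "R r = (w, l, l')" by (cases "R r")
  have "deq w l l'" using assms(3)[of r] Fwd R by (simp add: valid_def)
  then show ?thesis using deq_rewrite assms(1,2) Fwd R by simp
next
  case (Bwd r p k)
  obtain w l l' where R: "R r = (w, l, l')" by (cases "R r")
  have "deq w l l'" using assms(3)[of r] Bwd R by (simp add: valid_def)
  then show ?thesis using deq_rewrite[OF deq_sym] assms(1,2) Bwd R by simp
qed

text \<open>Validity is asked only of the rules that occur in the moves, so one table of rules can
  hold assumptions and goals together.\<close>

lemma deq_replay:
  assumes "replay R u ms d = Some e" "run u d = Some v" "\<And>m r. m \<in> set ms \<Longrightarrow> r \<in> set_move m \<Longrightarrow> valid (R r)"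
  shows "deq u d e"
  using assms
proof (induction ms arbitrary: d)
  case Nil
  then show ?case using deq_refl by simp
next
  case (Cons m ms)
  from Cons.prems(1) obtain d' where d': "step R u m d = Some d'" "replay R u ms d' = Some e"
    by (auto split: option.splits)
  have 1: "deq u d d'" by (rule deq_step[OF d'(1) Cons.prems(2,3)]) simp_all
  have "run u d' = Some v" using deq_run[OF 1] Cons.prems(2) by simp
  then have 2: "deq u d' e" by (rule Cons.IH[OF d'(2)]) (use Cons.prems(3) in auto)
  show ?case by (rule deq_trans[OF 1 2])
qed

end

section \<open>The laws\<close>

text \<open>Contains the hypotheses and both sides of the equivalence; \<open>base_law\<close> and
  the lists \<open>hs\<close> control which laws a certificate may use.\<close>

datatype law =
  Assoc letter | LUnit letter | RUnit letter
| Coassoc letter | LCounit letter | RCounit letter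
| Compat letter | CouMul letter | ComUni letter | CouUni letter
| ActMul | ActUni | CoactCom | CoactCou
| LinMul | LinUni | LinCom | LinCou
| ColinMul | ColinUni | ColinCom | ColinCou
| YD
| NatL letter node | NatR node letter
| BiAssoc | BiLUnit | BiRUnit | BiCoassoc | BiLCounit | BiRCounit
| BiCompat | BiCouMul | BiComUni | BiCouUni

text \<open>For \<open>Fob\<close> this is the pre-braiding of the Yetter-Drinfel'd category on
  \<open>F \<odot> F\<close>.\<close>

fun twist :: "letter \<Rightarrow> diagram" where
  "twist Bob = [(0, Cross Bob Bob)]"
| "twist Fob = [(0, Coact), (1, Cross Fob Fob), (0, Act)]"

text \<open>The diagonal action of \<open>B\<close> on \<open>F \<odot> F\<close>;
  \<open>coact2\<close> is the codiagonal coaction.\<close>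

definition act2 :: diagram where
  "act2 = [(0, Com Bob), (1, Cross Bob Fob), (0, Act), (1, Act)]"

definition coact2 :: diagram where
  "coact2 = [(0, Coact), (2, Coact), (1, Cross Fob Bob), (0, Mul Bob)]"

definition bi_mul :: diagram where
  "bi_mul = [(1, Com Bob), (2, Cross Bob Fob), (1, Act), (0, Mul Fob), (1, Mul Bob)]"

definition bi_uni :: diagram where
  "bi_uni = [(0, Uni Fob), (1, Uni Bob)]"

definition bi_com :: diagram where
  "bi_com = [(0, Com Fob), (2, Com Bob), (1, Coact), (2, Cross Fob Bob), (1, Mul Bob)]"

definition bi_cou :: diagram where
  "bi_cou = [(0, Cou Fob), (0, Cou Bob)]"

text \<open>An empty diagram is an identity. \<open>NatL\<close> and \<open>NatR\<close> slide a
  node through a strand: for a unit or counit the crossing disappears on one side, and for a node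
  that is itself a crossing the law is the Yang-Baxter equation.\<close>

fun eqn :: "law \<Rightarrow> letter list \<times> diagram \<times> diagram" where
  "eqn (Assoc x) = ([x, x, x], [(0, Mul x), (0, Mul x)], [(1, Mul x), (0, Mul x)])"
| "eqn (LUnit x) = ([x], [(0, Uni x), (0, Mul x)], [])"
| "eqn (RUnit x) = ([x], [(1, Uni x), (0, Mul x)], [])"
| "eqn (Coassoc x) = ([x], [(0, Com x), (0, Com x)], [(0, Com x), (1, Com x)])"
| "eqn (LCounit x) = ([x], [(0, Com x), (0, Cou x)], [])"
| "eqn (RCounit x) = ([x], [(0, Com x), (1, Cou x)], [])"
| "eqn (Compat x) = ([x, x], [(0, Mul x), (0, Com x)],
     [(0, Com x), (2, Com x)] @ shift 1 (twist x) @ [(0, Mul x), (1, Mul x)])"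
| "eqn (CouMul x) = ([x, x], [(0, Mul x), (0, Cou x)], [(0, Cou x), (0, Cou x)])"
| "eqn (ComUni x) = ([], [(0, Uni x), (0, Com x)], [(0, Uni x), (1, Uni x)])"
| "eqn (CouUni x) = ([], [(0, Uni x), (0, Cou x)], [])"
| "eqn ActMul = ([Bob, Bob, Fob], [(0, Mul Bob), (0, Act)], [(1, Act), (0, Act)])"
| "eqn ActUni = ([Fob], [(0, Uni Bob), (0, Act)], [])"
| "eqn CoactCom = ([Fob], [(0, Coact), (0, Com Bob)], [(0, Coact), (1, Coact)])"
| "eqn CoactCou = ([Fob], [(0, Coact), (0, Cou Bob)], [])"
| "eqn LinMul = ([Bob, Fob, Fob], act2 @ [(0, Mul Fob)], [(1, Mul Fob), (0, Act)])"
| "eqn LinUni = ([Bob], [(0, Cou Bob), (0, Uni Fob)], [(1, Uni Fob), (0, Act)])"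
| "eqn LinCom = ([Bob, Fob], [(0, Act), (0, Com Fob)], [(1, Com Fob)] @ act2)"
| "eqn LinCou = ([Bob, Fob], [(0, Act), (0, Cou Fob)], [(1, Cou Fob), (0, Cou Bob)])"
| "eqn ColinMul = ([Fob, Fob], [(0, Mul Fob), (0, Coact)], coact2 @ [(1, Mul Fob)])"
| "eqn ColinUni = ([], [(0, Uni Fob), (0, Coact)], [(0, Uni Bob), (1, Uni Fob)])"
| "eqn ColinCom = ([Fob], [(0, Com Fob)] @ coact2, [(0, Coact), (1, Com Fob)])"
| "eqn ColinCou = ([Fob], [(0, Cou Fob), (0, Uni Bob)], [(0, Coact), (1, Cou Fob)])"
| "eqn YD = ([Bob, Fob],
     [(0, Com Bob), (1, Cross Bob Fob), (0, Act), (0, Coact), (1, Cross Fob Bob), (0, Mul Bob)],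
     [(0, Com Bob), (2, Coact), (1, Cross Bob Bob), (0, Mul Bob), (1, Act)])"
| "eqn (NatL x n) = (x # src n, shift 1 [(0, n)] @ cross [x] (tgt n), cross [x] (src n) @ [(0, n)])"
| "eqn (NatR n x) = (src n @ [x], [(0, n)] @ cross (tgt n) [x], cross (src n) [x] @ shift 1 [(0, n)])"
| "eqn BiAssoc = ([Fob, Bob, Fob, Bob, Fob, Bob], bi_mul @ bi_mul, shift 2 bi_mul @ bi_mul)"
| "eqn BiLUnit = ([Fob, Bob], bi_uni @ bi_mul, [])"
| "eqn BiRUnit = ([Fob, Bob], shift 2 bi_uni @ bi_mul, [])"
| "eqn BiCoassoc = ([Fob, Bob], bi_com @ bi_com, bi_com @ shift 2 bi_com)"
| "eqn BiLCounit = ([Fob, Bob], bi_com @ bi_cou, [])"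
| "eqn BiRCounit = ([Fob, Bob], bi_com @ shift 2 bi_cou, [])"
| "eqn BiCompat = ([Fob, Bob, Fob, Bob], bi_mul @ bi_com,
     bi_com @ shift 4 bi_com @ shift 2 (cross [Fob, Bob] [Fob, Bob]) @ bi_mul @ shift 2 bi_mul)"
| "eqn BiCouMul = ([Fob, Bob, Fob, Bob], bi_mul @ bi_cou, bi_cou @ bi_cou)"
| "eqn BiComUni = ([], bi_uni @ bi_com, bi_uni @ shift 2 bi_uni)"
| "eqn BiCouUni = ([], bi_uni @ bi_cou, [])"

text \<open>The laws supplied by the hypotheses on \<open>B\<close> and \<open>F\<close> and by
  naturality of the braiding; the remaining ones make up the two sides of the equivalence.\<close>

fun base_law :: "law \<Rightarrow> bool" where
  "base_law (Compat x) = (x = Bob)"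
| "base_law (CouMul x) = (x = Bob)"
| "base_law (ComUni x) = (x = Bob)"
| "base_law (CouUni x) = (x = Bob)"
| "base_law LinCom = False"
| "base_law LinCou = False"
| "base_law ColinMul = False"
| "base_law ColinUni = False"
| "base_law YD = False"
| "base_law BiAssoc = False"
| "base_law BiLUnit = False"
| "base_law BiRUnit = False"
| "base_law BiCoassoc = False"
| "base_law BiLCounit = False"
| "base_law BiRCounit = False"
| "base_law BiCompat = False"
| "base_law BiCouMul = False"
| "base_law BiComUni = False"
| "base_law BiCouUni = False"
| "base_law _ = True"

fun permits :: "law list \<Rightarrow> law move \<Rightarrow> bool" where
  "permits hs (Pull i j) = True"
| "permits hs (Fwd r p k) = (base_law r \<or> r \<in> set hs)"
| "permits hs (Bwd r p k) = (base_law r \<or> r \<in> set hs)"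

text \<open>The two sides are rewritten separately to a common diagram, so each list of moves can be
  found by simplifying one side.\<close>

fun certifies :: "law list \<Rightarrow> letter list \<times> diagram \<times> diagram \<Rightarrow> law move list \<Rightarrow> law move list \<Rightarrow> bool" where
  "certifies hs (w, d, e) ms ns \<longleftrightarrow>
     list_all (permits hs) ms \<and> list_all (permits hs) ns \<and>
     run w d \<noteq> None \<and> run w e \<noteq> None \<and>
     (case replay eqn w ms d of None \<Rightarrow> False
      | Some x \<Rightarrow> (case replay eqn w ns e of None \<Rightarrow> False | Some y \<Rightarrow> x = y))"

text \<open>Derives an equation from the law \<open>h\<close> with left side \<open>l\<close>: the
  diagram \<open>d\<close> is linked to \<open>p @ l @ q\<close>, and \<open>h\<close> is then
  applied between \<open>p\<close> and \<open>q\<close>. Strand 0 is right because \<open>p\<close>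
  ends in the whole input word of \<open>h\<close>.\<close>

fun certifies_via :: "law list \<Rightarrow> letter list \<times> diagram \<times> diagram \<Rightarrow> law \<Rightarrow> letter list \<times> diagram \<times> diagram \<Rightarrow>
    diagram \<Rightarrow> diagram \<Rightarrow> law move list \<Rightarrow> law move list \<Rightarrow> law move list \<Rightarrow> law move list \<Rightarrow> bool" where
  "certifies_via hs (w, d, e) h (w', l, r) p q ms ns ms' ns' \<longleftrightarrow>
     certifies hs (w, d, p @ l @ q) ms ns \<and>
     certifies (h # hs) (w, p @ l @ q, e) (Fwd h (length p) 0 # ms') ns'"

context signature
begin

definition law_valid :: "law \<Rightarrow> bool" where
  "law_valid r \<longleftrightarrow> valid (eqn r)"

lemma law_valid_Nat: "law_valid (NatL x n)" "law_valid (NatR n x)"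
  using deq_natural_left deq_natural_right by (simp_all add: law_valid_def valid_def)

end

section \<open>The laws as equations in the given braided category\<close>

locale biproduct_data = braided_monoidal_category C
  for C :: "('o, 'm, 'x) braided_cat_scheme" (structure) +
  fixes B F :: "('o, 'm) bialg" and \<nu> \<delta> :: 'm
  assumes bialgebra_B: "bialgebra C B"
    and module_algebra_F: "module_algebra C B F \<nu>"
    and comodule_coalgebra_F: "comodule_coalgebra C B F \<delta>"
begin

primrec str :: "letter \<Rightarrow> ('o, 'm) bialg" where
  "str Fob = F"
| "str Bob = B"

abbreviation lob :: "letter \<Rightarrow> 'o" where "lob x \<equiv> ob (str x)"

primrec arr :: "node \<Rightarrow> 'm" where
  "arr (Mul x) = mul (str x)"
| "arr (Uni x) = one (str x)"
| "arr (Com x) = com (str x)"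
| "arr (Cou x) = cou (str x)"
| "arr Act = \<nu>"
| "arr Coact = \<delta>"
| "arr (Cross x y) = \<c>[lob x,lob y]"

lemmas structure_F = module_algebra_F[unfolded module_algebra_def] comodule_coalgebra_F[unfolded comodule_coalgebra_def]
lemmas structure_B = bialgebra_B[unfolded bialgebra_def]

lemma algebra_str: "algebra C (str x)" and coalgebra_str: "coalgebra C (str x)"
  using structure_F structure_B by (cases x; simp)+

sublocale diagrams C lob
  using algebra_str by unfold_locales (simp add: algebra_def)

sublocale signature C lob arr
proof
  show "arr n \<in> hom C (obj (ndom n)) (obj (ncod n))" for n
    using algebra_str coalgebra_str structure_F
    by (cases n) (auto simp: algebra_def coalgebra_def left_module_def left_comodule_def brd_hom)
qed simp

lemma depicts_arr:
  "depicts (Tens (Leaf x) (Leaf x)) (mul (str x)) (Leaf x) [(0, Mul x)]"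
  "depicts Unt (one (str x)) (Leaf x) [(0, Uni x)]"
  "depicts (Leaf x) (com (str x)) (Tens (Leaf x) (Leaf x)) [(0, Com x)]"
  "depicts (Leaf x) (cou (str x)) Unt [(0, Cou x)]"
  "depicts (Tens (Leaf Bob) (Leaf Fob)) \<nu> (Leaf Fob) [(0, Act)]"
  "depicts (Leaf Fob) \<delta> (Tens (Leaf Bob) (Leaf Fob)) [(0, Coact)]"
  using depicts_narr[of "Mul x"] depicts_narr[of "Uni x"] depicts_narr[of "Com x"] depicts_narr[of "Cou x"]
    depicts_narr[of Act] depicts_narr[of Coact] by simp_all

text \<open>In rule form, so that side conditions \<open>obj s = X\<close> are solved by resolution,
  which at the same time constructs the tree \<open>s\<close>.\<close>

lemma obj_eqs:
  "obj Unt = \<I>" "obj (Leaf x) = lob x" "obj s = X \<Longrightarrow> obj t = Y \<Longrightarrow> obj (Tens s t) = X \<odot> Y"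
  by simp_all

text \<open>The instances at \<open>Fob\<close> and \<open>Bob\<close> are listed because
  unification does not see \<open>F\<close> and \<open>B\<close> as values of
  \<open>str\<close>.\<close>

lemmas depicts_rules = depicts_cmp depicts_tarr depicts_assc depicts_unit depicts_brd
  depicts_arr depicts_arr(1-4)[of Fob, simplified str.simps] depicts_arr(1-4)[of Bob, simplified str.simps] depicts_idt
  obj_eqs obj_eqs(2)[of Fob, simplified str.simps] obj_eqs(2)[of Bob, simplified str.simps]

text \<open>Resolution with \<open>depicts_rules\<close> synthesises the trees and diagrams of both
  sides; the last premise compares them with the table.\<close>

lemma law_iff:
  assumes "depicts s f t d" "depicts s g t e" "eqn r = (leaves s, d, e)"
  shows "f = g \<longleftrightarrow> law_valid r"
  using depicts_eq[OF assms(1,2)] assms(3) by (simp add: law_valid_def valid_def)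

lemmas diagram_defs = mid_def rbrd_def tensor_act_def tensor_coact_def unit_act_def unit_coact_def

text \<open>Keeps the diagram schematic while the rules build it, and leaves the comparison to
  simplification.\<close>

lemma depicts_diagram: "depicts s f t d \<Longrightarrow> d = e \<Longrightarrow> depicts s f t e"
  by simp

lemma depicts_hom: "depicts s f t d \<Longrightarrow> f \<in> hom C (obj s) (obj t)"
  by (simp add: depicts_def represents_def)

abbreviation (input) biob :: "letter tree" where "biob \<equiv> Tens (Leaf Fob) (Leaf Bob)"

lemma depicts_biproduct:
  "depicts (Tens biob biob) (smash_mul C B F \<nu>) biob bi_mul"
  "depicts Unt ((\<eta>\<^bsub>F\<^esub> \<otimes> \<eta>\<^bsub>B\<^esub>) \<cdot> \<l>\<^sup>-\<^sup>1[\<I>]) biob bi_uni"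
  "depicts biob (smash_com C B F \<delta>) (Tens biob biob) bi_com"
  "depicts biob (\<l>[\<I>] \<cdot> (\<epsilon>\<^bsub>F\<^esub> \<otimes> \<epsilon>\<^bsub>B\<^esub>)) Unt bi_cou"
  unfolding smash_mul_def smash_com_def diagram_defs
  by (rule depicts_diagram, (rule depicts_rules)+, simp add: bi_mul_def bi_uni_def bi_com_def bi_cou_def)+

lemmas biproduct_homs = depicts_biproduct[THEN depicts_hom, simplified]

text \<open>The typing conjuncts are known from \<open>algebra_str\<close> and
  \<open>coalgebra_str\<close>; each equation is translated on its own.\<close>

lemma algebra_iff:
  "algebra C (str x) \<longleftrightarrow> law_valid (Assoc x) \<and> law_valid (LUnit x) \<and> law_valid (RUnit x)"
  "coalgebra C (str x) \<longleftrightarrow> law_valid (Coassoc x) \<and> law_valid (LCounit x) \<and> law_valid (RCounit x)"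
proof -
  have "\<mu>\<^bsub>str x\<^esub> \<cdot> (\<mu>\<^bsub>str x\<^esub> \<otimes> \<i>[lob x]) = \<mu>\<^bsub>str x\<^esub> \<cdot> (\<i>[lob x] \<otimes> \<mu>\<^bsub>str x\<^esub>) \<cdot> \<a>[lob x,lob x,lob x] \<longleftrightarrow> law_valid (Assoc x)"
    "\<mu>\<^bsub>str x\<^esub> \<cdot> (\<eta>\<^bsub>str x\<^esub> \<otimes> \<i>[lob x]) = \<l>[lob x] \<longleftrightarrow> law_valid (LUnit x)"
    "\<mu>\<^bsub>str x\<^esub> \<cdot> (\<i>[lob x] \<otimes> \<eta>\<^bsub>str x\<^esub>) = \<r>[lob x] \<longleftrightarrow> law_valid (RUnit x)"
    by (rule law_iff, (rule depicts_rules)+, simp)+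
  then show "algebra C (str x) \<longleftrightarrow> law_valid (Assoc x) \<and> law_valid (LUnit x) \<and> law_valid (RUnit x)"
    using algebra_str[of x] unfolding algebra_def by blast
  have "\<a>[lob x,lob x,lob x] \<cdot> (\<Delta>\<^bsub>str x\<^esub> \<otimes> \<i>[lob x]) \<cdot> \<Delta>\<^bsub>str x\<^esub> = (\<i>[lob x] \<otimes> \<Delta>\<^bsub>str x\<^esub>) \<cdot> \<Delta>\<^bsub>str x\<^esub> \<longleftrightarrow> law_valid (Coassoc x)"
    "\<l>[lob x] \<cdot> (\<epsilon>\<^bsub>str x\<^esub> \<otimes> \<i>[lob x]) \<cdot> \<Delta>\<^bsub>str x\<^esub> = \<i>[lob x] \<longleftrightarrow> law_valid (LCounit x)"
    "\<r>[lob x] \<cdot> (\<i>[lob x] \<otimes> \<epsilon>\<^bsub>str x\<^esub>) \<cdot> \<Delta>\<^bsub>str x\<^esub> = \<i>[lob x] \<longleftrightarrow> law_valid (RCounit x)"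
    by (rule law_iff, (rule depicts_rules)+, simp)+
  then show "coalgebra C (str x) \<longleftrightarrow> law_valid (Coassoc x) \<and> law_valid (LCounit x) \<and> law_valid (RCounit x)"
    using coalgebra_str[of x] unfolding coalgebra_def by blast
qed

lemma bialg_compat_iff:
  "bialg_compat C \<c>[ob B,ob B] B \<longleftrightarrow>
     law_valid (Compat Bob) \<and> law_valid (CouMul Bob) \<and> law_valid (ComUni Bob) \<and> law_valid (CouUni Bob)"
  "bialg_compat C (yd_brd C B (ob F, \<nu>, \<delta>) (ob F, \<nu>, \<delta>)) F \<longleftrightarrow>
     law_valid (Compat Fob) \<and> law_valid (CouMul Fob) \<and> law_valid (ComUni Fob) \<and> law_valid (CouUni Fob)"
  unfolding bialg_compat_def yd_brd.simps diagram_defs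
  by (intro arg_cong2[of _ _ _ _ "(\<and>)"]; rule law_iff, (rule depicts_rules)+, simp)+

lemma left_module_iff:
  "left_module C B (ob F) \<nu> \<longleftrightarrow> law_valid ActMul \<and> law_valid ActUni"
  "left_comodule C B (ob F) \<delta> \<longleftrightarrow> law_valid CoactCom \<and> law_valid CoactCou"
proof -
  have "\<nu> \<cdot> (\<mu>\<^bsub>B\<^esub> \<otimes> \<i>[ob F]) = \<nu> \<cdot> (\<i>[ob B] \<otimes> \<nu>) \<cdot> \<a>[ob B,ob B,ob F] \<longleftrightarrow> law_valid ActMul"
    "\<nu> \<cdot> (\<eta>\<^bsub>B\<^esub> \<otimes> \<i>[ob F]) = \<l>[ob F] \<longleftrightarrow> law_valid ActUni"
    by (rule law_iff, (rule depicts_rules)+, simp)+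
  then show "left_module C B (ob F) \<nu> \<longleftrightarrow> law_valid ActMul \<and> law_valid ActUni"
    using structure_F unfolding left_module_def by blast
  have "\<a>[ob B,ob B,ob F] \<cdot> (\<Delta>\<^bsub>B\<^esub> \<otimes> \<i>[ob F]) \<cdot> \<delta> = (\<i>[ob B] \<otimes> \<delta>) \<cdot> \<delta> \<longleftrightarrow> law_valid CoactCom"
    "\<l>[ob F] \<cdot> (\<epsilon>\<^bsub>B\<^esub> \<otimes> \<i>[ob F]) \<cdot> \<delta> = \<i>[ob F] \<longleftrightarrow> law_valid CoactCou"
    by (rule law_iff, (rule depicts_rules)+, simp)+
  then show "left_comodule C B (ob F) \<delta> \<longleftrightarrow> law_valid CoactCom \<and> law_valid CoactCou"
    using structure_F unfolding left_comodule_def by blast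
qed

lemma module_hom_iff:
  "\<mu>\<^bsub>F\<^esub> \<in> module_hom C B (ob F \<odot> ob F) (tensor_act C B (ob F) \<nu> (ob F) \<nu>) (ob F) \<nu> \<longleftrightarrow> law_valid LinMul"
  "\<eta>\<^bsub>F\<^esub> \<in> module_hom C B \<I> (unit_act C B) (ob F) \<nu> \<longleftrightarrow> law_valid LinUni"
  "\<Delta>\<^bsub>F\<^esub> \<in> module_hom C B (ob F) \<nu> (ob F \<odot> ob F) (tensor_act C B (ob F) \<nu> (ob F) \<nu>) \<longleftrightarrow> law_valid LinCom"
  "\<epsilon>\<^bsub>F\<^esub> \<in> module_hom C B (ob F) \<nu> \<I> (unit_act C B) \<longleftrightarrow> law_valid LinCou"
proof -
  have "\<mu>\<^bsub>F\<^esub> \<cdot> tensor_act C B (ob F) \<nu> (ob F) \<nu> = \<nu> \<cdot> (\<i>[ob B] \<otimes> \<mu>\<^bsub>F\<^esub>) \<longleftrightarrow> law_valid LinMul"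
    "\<eta>\<^bsub>F\<^esub> \<cdot> unit_act C B = \<nu> \<cdot> (\<i>[ob B] \<otimes> \<eta>\<^bsub>F\<^esub>) \<longleftrightarrow> law_valid LinUni"
    "\<Delta>\<^bsub>F\<^esub> \<cdot> \<nu> = tensor_act C B (ob F) \<nu> (ob F) \<nu> \<cdot> (\<i>[ob B] \<otimes> \<Delta>\<^bsub>F\<^esub>) \<longleftrightarrow> law_valid LinCom"
    "\<epsilon>\<^bsub>F\<^esub> \<cdot> \<nu> = unit_act C B \<cdot> (\<i>[ob B] \<otimes> \<epsilon>\<^bsub>F\<^esub>) \<longleftrightarrow> law_valid LinCou"
    unfolding diagram_defs by (rule law_iff, (rule depicts_rules)+, simp add: act2_def)+
  then show
    "\<mu>\<^bsub>F\<^esub> \<in> module_hom C B (ob F \<odot> ob F) (tensor_act C B (ob F) \<nu> (ob F) \<nu>) (ob F) \<nu> \<longleftrightarrow> law_valid LinMul"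
    "\<eta>\<^bsub>F\<^esub> \<in> module_hom C B \<I> (unit_act C B) (ob F) \<nu> \<longleftrightarrow> law_valid LinUni"
    "\<Delta>\<^bsub>F\<^esub> \<in> module_hom C B (ob F) \<nu> (ob F \<odot> ob F) (tensor_act C B (ob F) \<nu> (ob F) \<nu>) \<longleftrightarrow> law_valid LinCom"
    "\<epsilon>\<^bsub>F\<^esub> \<in> module_hom C B (ob F) \<nu> \<I> (unit_act C B) \<longleftrightarrow> law_valid LinCou"
    using structure_F unfolding module_hom_def algebra_def coalgebra_def by simp_all
qed

lemma comodule_hom_iff:
  "\<mu>\<^bsub>F\<^esub> \<in> comodule_hom C B (ob F \<odot> ob F) (tensor_coact C B (ob F) \<delta> (ob F) \<delta>) (ob F) \<delta> \<longleftrightarrow> law_valid ColinMul"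
  "\<eta>\<^bsub>F\<^esub> \<in> comodule_hom C B \<I> (unit_coact C B) (ob F) \<delta> \<longleftrightarrow> law_valid ColinUni"
  "\<Delta>\<^bsub>F\<^esub> \<in> comodule_hom C B (ob F) \<delta> (ob F \<odot> ob F) (tensor_coact C B (ob F) \<delta> (ob F) \<delta>) \<longleftrightarrow> law_valid ColinCom"
  "\<epsilon>\<^bsub>F\<^esub> \<in> comodule_hom C B (ob F) \<delta> \<I> (unit_coact C B) \<longleftrightarrow> law_valid ColinCou"
proof -
  have "\<delta> \<cdot> \<mu>\<^bsub>F\<^esub> = (\<i>[ob B] \<otimes> \<mu>\<^bsub>F\<^esub>) \<cdot> tensor_coact C B (ob F) \<delta> (ob F) \<delta> \<longleftrightarrow> law_valid ColinMul"
    "\<delta> \<cdot> \<eta>\<^bsub>F\<^esub> = (\<i>[ob B] \<otimes> \<eta>\<^bsub>F\<^esub>) \<cdot> unit_coact C B \<longleftrightarrow> law_valid ColinUni"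
    "tensor_coact C B (ob F) \<delta> (ob F) \<delta> \<cdot> \<Delta>\<^bsub>F\<^esub> = (\<i>[ob B] \<otimes> \<Delta>\<^bsub>F\<^esub>) \<cdot> \<delta> \<longleftrightarrow> law_valid ColinCom"
    "unit_coact C B \<cdot> \<epsilon>\<^bsub>F\<^esub> = (\<i>[ob B] \<otimes> \<epsilon>\<^bsub>F\<^esub>) \<cdot> \<delta> \<longleftrightarrow> law_valid ColinCou"
    unfolding diagram_defs by (rule law_iff, (rule depicts_rules)+, simp add: coact2_def)+
  then show
    "\<mu>\<^bsub>F\<^esub> \<in> comodule_hom C B (ob F \<odot> ob F) (tensor_coact C B (ob F) \<delta> (ob F) \<delta>) (ob F) \<delta> \<longleftrightarrow> law_valid ColinMul"
    "\<eta>\<^bsub>F\<^esub> \<in> comodule_hom C B \<I> (unit_coact C B) (ob F) \<delta> \<longleftrightarrow> law_valid ColinUni"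
    "\<Delta>\<^bsub>F\<^esub> \<in> comodule_hom C B (ob F) \<delta> (ob F \<odot> ob F) (tensor_coact C B (ob F) \<delta> (ob F) \<delta>) \<longleftrightarrow> law_valid ColinCom"
    "\<epsilon>\<^bsub>F\<^esub> \<in> comodule_hom C B (ob F) \<delta> \<I> (unit_coact C B) \<longleftrightarrow> law_valid ColinCou"
    using structure_F unfolding comodule_hom_def algebra_def coalgebra_def by simp_all
qed

lemma base_law_valid:
  assumes "base_law r"
  shows "law_valid r"
  using assms structure_F structure_B algebra_iff bialg_compat_iff left_module_iff module_hom_iff comodule_hom_iff
    algebra_str coalgebra_str law_valid_Nat
  by (cases r) simp_all

lemma permits_valid:
  assumes "permits hs m" "r \<in> set_move m" "\<forall>h\<in>set hs. law_valid h"
  shows "valid (eqn r)"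
  using assms base_law_valid by (cases m) (auto simp: law_valid_def)

lemma deq_certified:
  assumes "certifies hs (w, d, e) ms ns" "\<forall>h\<in>set hs. law_valid h"
  shows "deq w d e"
proof -
  obtain v v' x where c: "list_all (permits hs) ms" "list_all (permits hs) ns"
    "run w d = Some v" "run w e = Some v'" "replay eqn w ms d = Some x" "replay eqn w ns e = Some x"
    using assms(1) by (auto split: option.splits)
  have "deq w d x"
    by (rule deq_replay[OF c(5,3)]) (use c(1) permits_valid assms(2) in \<open>auto simp: list_all_iff\<close>)
  moreover have "deq w e x"
    by (rule deq_replay[OF c(6,4)]) (use c(2) permits_valid assms(2) in \<open>auto simp: list_all_iff\<close>)
  ultimately show ?thesis using deq_trans deq_sym by blast
qed

lemma law_valid_by_certificate:
  assumes "\<forall>h\<in>set hs. law_valid h" "certifies hs (eqn r) ms ns"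
  shows "law_valid r"
  using deq_certified[OF _ assms(1)] assms(2)
  by (cases "eqn r") (auto simp: law_valid_def valid_def simp del: certifies.simps)

lemma law_valid_via_certificate:
  assumes "\<forall>g\<in>set (h # hs). law_valid g"
    "certifies_via hs (eqn r) h (eqn h) p q ms ns ms' ns'"
  shows "law_valid r"
proof -
  obtain w d e w' l m where eq: "eqn r = (w, d, e)" "eqn h = (w', l, m)"
    by (cases "eqn r", cases "eqn h")
  have c: "certifies hs (w, d, p @ l @ q) ms ns"
    "certifies (h # hs) (w, p @ l @ q, e) (Fwd h (length p) 0 # ms') ns'"
    using assms(2) by (simp_all add: eq del: certifies.simps)
  have "deq w d (p @ l @ q)" by (rule deq_certified[OF c(1)]) (use assms(1) in auto)
  moreover have "deq w (p @ l @ q) e" by (rule deq_certified[OF c(2) assms(1)])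
  ultimately show ?thesis using deq_trans by (auto simp: law_valid_def valid_def eq)
qed

lemma yd_module_iff: "yd_module C B (ob F, \<nu>, \<delta>) \<longleftrightarrow> law_valid YD"
proof -
  have "(\<mu>\<^bsub>B\<^esub> \<otimes> \<i>[ob F]) \<cdot> rbrd C (ob B) (ob F) (ob B) \<cdot> ((\<delta> \<cdot> \<nu>) \<otimes> \<i>[ob B]) \<cdot>
       rbrd C (ob B) (ob B) (ob F) \<cdot> (\<Delta>\<^bsub>B\<^esub> \<otimes> \<i>[ob F]) =
     (\<mu>\<^bsub>B\<^esub> \<otimes> \<nu>) \<cdot> mid C (ob B) (ob B) (ob B) (\<c>[ob B,ob B]) (ob B) (ob B) (ob F) \<cdot> (\<Delta>\<^bsub>B\<^esub> \<otimes> \<delta>) \<longleftrightarrow> law_valid YD"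
    unfolding diagram_defs by (rule law_iff, (rule depicts_rules)+, simp)
  then show ?thesis using structure_F by simp
qed

text \<open>The right side lists what being a bialgebra in the Yetter-Drinfel'd category demands
  beyond a module algebra and comodule coalgebra.\<close>

lemma yd_bialgebra_iff:
  "yd_bialgebra C B F \<nu> \<delta> \<longleftrightarrow>
     law_valid YD \<and> law_valid LinCom \<and> law_valid LinCou \<and> law_valid ColinMul \<and> law_valid ColinUni \<and>
     law_valid (Compat Fob) \<and> law_valid (CouMul Fob) \<and> law_valid (ComUni Fob) \<and> law_valid (CouUni Fob)"
  using structure_F
  by (auto simp: yd_bialgebra_def Let_def yd_module_iff bialg_compat_iff yd_unit_def
      module_hom_iff comodule_hom_iff simp del: yd_module.simps yd_brd.simps)

lemma bialgebra_biproduct_iff: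
  "bialgebra C (biproduct C B F \<nu> \<delta>) \<longleftrightarrow>
     law_valid BiAssoc \<and> law_valid BiLUnit \<and> law_valid BiRUnit \<and>
     law_valid BiCoassoc \<and> law_valid BiLCounit \<and> law_valid BiRCounit \<and>
     law_valid BiCompat \<and> law_valid BiCouMul \<and> law_valid BiComUni \<and> law_valid BiCouUni"
proof -
  let ?P = "biproduct C B F \<nu> \<delta>"
  have P: "ob ?P = ob F \<odot> ob B" "mul ?P = smash_mul C B F \<nu>" "com ?P = smash_com C B F \<delta>"
    "one ?P = (\<eta>\<^bsub>F\<^esub> \<otimes> \<eta>\<^bsub>B\<^esub>) \<cdot> \<l>\<^sup>-\<^sup>1[\<I>]" "cou ?P = \<l>[\<I>] \<cdot> (\<epsilon>\<^bsub>F\<^esub> \<otimes> \<epsilon>\<^bsub>B\<^esub>)"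
    by (simp_all add: biproduct_def)
  have ob: "ob F \<odot> ob B \<in> Obj C" using obj_Obj[of biob] by simp
  show ?thesis
    unfolding bialgebra_def algebra_def coalgebra_def bialg_compat_def P diagram_defs
    \<comment> \<open>Once the typing conjuncts are gone, ten equations remain.
      \<open>eval_nat_numeral\<close> brings the numerals of \<open>eqn\<close> to the successor
      form of the computed offsets.\<close>
    by (simp only: biproduct_homs ob simp_thms conj_assoc,
      intro arg_cong2[of _ _ _ _ "(\<and>)"]; rule law_iff, (rule depicts_biproduct depicts_rules)+, simp add: eval_nat_numeral)
qed

section \<open>The diagrammatic computations\<close>

text \<open>
  The certificates were found by orienting the laws: actions and multiplications are moved below
  crossings, coactions and comultiplications above them. Only \<open>YD\<close> resists an orientation; it
  is applied once, in \<open>BiCompat\<close>.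
\<close>

lemma law_valid_BiAssoc: "law_valid BiAssoc"
  \<comment> \<open>\<open>hs\<close> is empty here and in the five laws that follow: a module
    algebra always yields a smash product algebra, and a comodule coalgebra a smash coproduct
    coalgebra. For associativity, \<open>Compat Bob\<close> and \<open>ActMul\<close> resolve the
    action of a product on one side, and \<open>LinMul\<close> the action on a product on the
    other.\<close>
  by (rule law_valid_by_certificate[where hs = "[]"
      and ms = "[Pull 4 3, Pull 5 4, Pull 6 5, Pull 7 6, Fwd (Assoc Fob) 7 0, Fwd (Compat Bob) 3 2, Pull 7 6, Pull 8 7,
          Fwd ActMul 8 2, Fwd (NatR (Mul Bob) Fob) 6 4, Pull 13 9, Fwd (Assoc Bob) 8 5, Pull 3 2,
          Bwd (NatR (Com Bob) Fob) 1 2, Pull 11 9, Pull 12 10, Pull 13 11, Pull 14 12]"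
      and ns = "[Pull 5 3, Pull 6 5, Fwd (NatL Bob (Mul Fob)) 4 2, Pull 8 7, Bwd LinMul 6 1, Pull 6 4,
          Fwd (Coassoc Bob) 3 1, Pull 3 2, Pull 4 3, Pull 5 4, Fwd (NatL Bob Act) 5 4, Pull 2 0, Pull 3 1,
          Pull 4 2, Pull 5 4, Pull 8 3, Pull 9 4, Pull 13 12]"])
    (simp, code_simp)

lemma law_valid_BiLUnit: "law_valid BiLUnit"
  by (rule law_valid_by_certificate[where hs = "[]"
      and ms = "[Pull 1 0, Pull 2 1, Pull 3 2, Pull 4 3, Fwd (LUnit Fob) 4 0, Fwd (ComUni Bob) 0 0, Pull 1 0, Pull 2 1,
          Fwd ActUni 2 0, Fwd (NatR (Uni Bob) Fob) 0 0, Fwd (LUnit Bob) 0 1]"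
      and ns = "[]"])
    (simp, code_simp)

lemma law_valid_BiRUnit: "law_valid BiRUnit"
  by (rule law_valid_by_certificate[where hs = "[]"
      and ms = "[Pull 6 4, Pull 2 1, Pull 3 2, Fwd (RUnit Bob) 3 3, Pull 1 0, Fwd (NatL Bob (Uni Fob)) 1 2,
          Bwd LinUni 1 1, Fwd (RUnit Fob) 2 0, Fwd (LCounit Bob) 0 1]"
      and ns = "[]"])
    (simp, code_simp)

text \<open>Dual to associativity, with \<open>CoactCom\<close> and \<open>ColinCom\<close> in the
  roles of \<open>ActMul\<close> and \<open>LinMul\<close>.\<close>

lemma law_valid_BiCoassoc: "law_valid BiCoassoc"
  by (rule law_valid_by_certificate[where hs = "[]"
      and ms = "[Pull 5 1, Fwd (Coassoc Fob) 0 0, Fwd (Compat Bob) 5 2, Pull 5 4, Fwd CoactCom 3 2, Pull 10 8,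
          Pull 11 10, Fwd (NatL Fob (Mul Bob)) 9 2, Bwd (NatL Fob (Com Bob)) 5 4, Pull 5 3,
          Fwd (Coassoc Bob) 2 3, Pull 4 2, Pull 5 3, Pull 6 5, Pull 8 6, Pull 9 2, Pull 10 4, Pull 11 9,
          Pull 12 10, Pull 14 11]"
      and ns = "[Pull 5 4, Bwd (NatR (Com Fob) Bob) 3 2, Bwd ColinCom 2 1, Pull 7 6, Pull 8 7, Fwd (Assoc Bob) 8 1,
          Pull 11 7, Bwd (NatR Coact Bob) 6 4, Pull 2 1, Pull 3 2, Pull 4 3, Pull 5 4, Pull 6 5]"])
    (simp, code_simp)

lemma law_valid_BiLCounit: "law_valid BiLCounit"
  by (rule law_valid_by_certificate[where hs = "[]"
      and ms = "[Pull 5 1, Fwd (LCounit Fob) 0 0, Fwd (CouMul Bob) 3 0, Pull 3 2, Fwd CoactCou 1 0,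
          Bwd (NatL Fob (Cou Bob)) 1 0, Fwd (LCounit Bob) 0 1]"
      and ns = "[]"])
    (simp, code_simp)

lemma law_valid_BiRCounit: "law_valid BiRCounit"
  by (rule law_valid_by_certificate[where hs = "[]"
      and ms = "[Pull 6 2, Fwd (RCounit Bob) 1 2, Pull 4 3, Bwd (NatR (Cou Fob) Bob) 2 2, Bwd ColinCou 1 1,
          Fwd (RCounit Fob) 0 0, Fwd (LUnit Bob) 0 1]"
      and ns = "[]"])
    (simp, code_simp)

section \<open>Compatibility of the biproduct from the conditions on the factor\<close>

lemma law_valid_BiCouMul:
  assumes "law_valid (CouMul Fob)" "law_valid LinCou"
  shows "law_valid BiCouMul"
  \<comment> \<open>The counit of \<open>F\<close> splits over the product, and
    \<open>LinCou\<close> turns the action below it into a counit of \<open>B\<close>, which cancels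
    against the comultiplication.\<close>
  by (rule law_valid_by_certificate[where hs = "[CouMul Fob, LinCou]"
      and ms = "[Pull 5 4, Fwd (CouMul Fob) 3 0, Pull 4 3, Fwd LinCou 2 1, Pull 3 1, Fwd (LCounit Bob) 0 1,
          Fwd (CouMul Bob) 3 0, Bwd (NatL Bob (Cou Fob)) 0 1, Pull 1 0, Pull 2 1]"
      and ns = "[]"])
    (simp add: assms, code_simp)

text \<open>Dual to the preceding law: \<open>ColinUni\<close> turns the coaction on a unit into a
  unit of \<open>B\<close>.\<close>

lemma law_valid_BiComUni:
  assumes "law_valid (ComUni Fob)" "law_valid ColinUni"
  shows "law_valid BiComUni"
  by (rule law_valid_by_certificate[where hs = "[ComUni Fob, ColinUni]"
      and ms = "[Pull 2 1, Fwd (ComUni Fob) 0 0, Pull 4 2, Fwd ColinUni 1 1, Pull 3 1, Pull 4 2, Pull 4 3, Pull 5 4,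
          Fwd (LUnit Bob) 5 1, Fwd (ComUni Bob) 1 1, Fwd (NatR (Uni Fob) Bob) 3 1, Pull 3 2]"
      and ns = "[]"])
    (simp add: assms, code_simp)

lemma law_valid_BiCouUni:
  assumes "law_valid (CouUni Fob)"
  shows "law_valid BiCouUni"
  by (rule law_valid_by_certificate[where hs = "[CouUni Fob]"
      and ms = "[Pull 3 2, Fwd (CouUni Bob) 1 1, Fwd (CouUni Fob) 0 0]"
      and ns = "[]"])
    (simp add: assms, code_simp)

text \<open>On the left, \<open>Compat Fob\<close> and \<open>Compat Bob\<close> open the coproducts
  of products, \<open>LinCom\<close> and \<open>ColinMul\<close> distribute coproduct over action
  and coaction over product, and \<open>YD\<close> replaces the remaining action followed by a
  coaction. On the right, \<open>ActMul\<close> and \<open>CoactCom\<close> separate iterated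
  actions and coactions. Coassociativity, associativity and one Yang-Baxter move on each side bring
  both to the same diagram.\<close>

lemma law_valid_BiCompat:
  assumes "law_valid (Compat Fob)" "law_valid LinCom" "law_valid ColinMul" "law_valid YD"
  shows "law_valid BiCompat"
  by (rule law_valid_by_certificate[where hs = "[Compat Fob, LinCom, ColinMul, YD]"
      and ms = "[Pull 5 4, Fwd (Compat Fob) 3 0, Pull 4 3, Fwd LinCom 2 1, Pull 15 13, Fwd ColinMul 12 1,
          Fwd (Compat Bob) 17 3, Pull 3 1, Pull 7 0, Pull 8 1, Pull 9 8, Pull 10 9, Pull 11 10, Pull 12 11,
          Pull 22 21, Pull 23 22, Pull 18 16, Pull 18 17, Pull 19 18, Pull 20 19, Fwd (NatR (Mul Fob) Bob) 20 2,
          Fwd (NatL Fob (Mul Bob)) 19 3, Fwd (NatL Fob (Mul Bob)) 21 2, Pull 17 5, Bwd (NatR (Com Bob) Fob) 4 5,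
          Bwd (NatL Bob (Com Fob)) 6 5, Bwd (NatL Bob (Com Fob)) 5 6, Pull 28 27, Pull 24 23, Pull 22 19,
          Pull 23 20, Pull 22 21, Pull 23 22, Pull 24 23, Pull 25 24, Pull 26 25, Fwd (Assoc Bob) 26 1,
          Fwd (Coassoc Bob) 2 3, Pull 8 7, Pull 10 8, Pull 11 9, Pull 12 10, Pull 13 11, Pull 14 12, Pull 15 13,
          Bwd (Coassoc Bob) 3 4, Bwd (Assoc Bob) 25 2, Pull 19 18, Pull 25 21, Bwd (NatL Fob (Mul Bob)) 19 2,
          Pull 5 4, Pull 6 5, Fwd (NatR (Com Bob) Fob) 6 4, Pull 13 7, Pull 14 9, Pull 15 10, Pull 16 11,
          Pull 17 12, Pull 18 13, Fwd YD 8 5, Pull 17 15, Pull 13 11, Pull 14 12, Pull 15 13, Pull 18 15,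
          Fwd (NatL Fob (Mul Bob)) 14 4, Pull 20 16, Pull 21 17, Pull 22 20, Pull 19 18, Pull 20 19, Pull 23 20,
          Pull 24 22, Fwd (Assoc Bob) 21 4, Fwd (NatL Fob Act) 11 2, Fwd (NatR Act Bob) 19 7, Pull 8 7,
          Bwd (NatR (Com Bob) Fob) 6 4, Pull 6 4, Fwd (Coassoc Bob) 3 4, Pull 15 14, Bwd (NatR Coact Fob) 13 3,
          Bwd (NatL Bob Coact) 9 7, Bwd (NatR Coact Bob) 13 2, Pull 21 11, Pull 22 13, Pull 23 14,
          Fwd (NatR (Cross Bob Fob) Bob) 12 8, Pull 15 11, Pull 16 2, Pull 17 4, Pull 18 5, Pull 19 12,
          Pull 20 13, Pull 21 14, Pull 22 15, Pull 23 19, Pull 24 23, Pull 26 24, Pull 27 25, Pull 28 26,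
          Pull 29 15, Pull 30 16, Pull 31 29]"
      and ns = "[Pull 14 5, Fwd (Compat Bob) 4 1, Pull 18 17, Pull 16 15, Pull 14 10, Pull 9 7, Pull 10 8, Pull 15 9,
          Pull 17 12, Pull 11 10, Pull 12 11, Pull 19 13, Fwd ActMul 12 1, Pull 4 3, Fwd CoactCom 2 1,
          Fwd (NatR (Mul Bob) Fob) 10 3, Pull 22 21, Pull 16 12, Pull 16 13, Pull 17 14, Pull 18 15, Pull 19 16,
          Pull 20 17, Pull 21 19, Fwd (Assoc Bob) 18 4, Fwd (NatL Bob (Mul Bob)) 15 7,
          Fwd (NatL Fob (Mul Bob)) 17 6, Bwd (NatL Fob (Com Bob)) 4 3, Pull 4 2, Fwd (Coassoc Bob) 1 2,
          Pull 26 18, Bwd (NatR (Com Bob) Bob) 17 8, Bwd (NatR (Com Bob) Bob) 16 7, Pull 16 10,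
          Bwd (NatR (Com Bob) Fob) 9 6, Pull 9 6, Pull 9 7, Pull 10 8, Pull 11 9, Pull 12 11, Pull 13 12,
          Fwd (NatR (Cross Fob Bob) Fob) 10 4, Pull 3 1, Pull 4 2, Pull 5 4, Pull 13 5, Pull 14 13, Pull 18 16,
          Pull 19 17, Pull 22 18, Pull 27 14, Pull 28 15, Pull 29 16]"])
    (simp add: assms, code_simp)

section \<open>Conditions on the factor, extracted from the biproduct\<close>

text \<open>
  Here \<open>p\<close> inserts the units and \<open>q\<close> the counits that restrict a law of the biproduct.
\<close>

lemma law_valid_CouUni_F:
  assumes "law_valid BiCouUni"
  shows "law_valid (CouUni Fob)"
  by (rule law_valid_via_certificate[where hs = "[]"
      and h = BiCouUni
      and p = "[]"
      and q = "[]"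
      and ms = "[]"
      and ns = "[Pull 3 2, Fwd (CouUni Bob) 1 1]"
      and ms' = "[]"
      and ns' = "[]"])
    (simp add: assms, code_simp)

lemma law_valid_ComUni_F:
  assumes "law_valid BiComUni"
  shows "law_valid (ComUni Fob)"
  by (rule law_valid_via_certificate[where hs = "[]"
      and h = BiComUni
      and p = "[]"
      and q = "[(1, Cou Bob), (2, Cou Bob)]"
      and ms = "[]"
      and ns = "[Pull 8 4, Fwd (RCounit Bob) 3 2, Fwd (CouMul Bob) 5 1, Pull 5 4, Fwd CoactCou 3 1, Pull 2 1,
          Fwd (NatL Fob (Uni Bob)) 2 1, Fwd (CouUni Bob) 2 1]"
      and ms' = "[Pull 4 2, Fwd (CouUni Bob) 1 1, Fwd (CouUni Bob) 2 2]"
      and ns' = "[]"])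
    (simp add: assms, code_simp)

text \<open>The second and third outputs are kept. The left side becomes the coaction on the unit;
  on the right a scalar, the counit of the unit of \<open>F\<close>, remains and is removed by
  \<open>CouUni Fob\<close>.\<close>

lemma law_valid_ColinUni:
  assumes "law_valid BiComUni" "law_valid (CouUni Fob)"
  shows "law_valid ColinUni"
  by (rule law_valid_via_certificate[where hs = "[CouUni Fob]"
      and h = BiComUni
      and p = "[]"
      and q = "[(0, Cou Fob), (2, Cou Bob)]"
      and ms = "[]"
      and ns = "[Pull 7 3, Fwd (LCounit Fob) 2 0, Pull 6 3, Fwd (RCounit Bob) 2 1, Pull 2 1,
          Fwd (NatL Fob (Uni Bob)) 2 1, Fwd (RUnit Bob) 2 0]"
      and ms' = "[Pull 5 4, Fwd (CouUni Bob) 3 3, Pull 3 1, Fwd (CouUni Fob) 0 0]"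
      and ns' = "[]"])
    (simp add: assms, code_simp)

lemma law_valid_CouMul_F:
  assumes "law_valid BiCouMul"
  shows "law_valid (CouMul Fob)"
  by (rule law_valid_via_certificate[where hs = "[]"
      and h = BiCouMul
      and p = "[(1, Uni Bob), (3, Uni Bob)]"
      and q = "[]"
      and ms = "[]"
      and ns = "[Pull 6 4, Pull 2 1, Pull 3 2, Fwd (RUnit Bob) 3 3, Fwd (ComUni Bob) 0 1, Pull 1 0, Pull 2 1,
          Fwd ActUni 2 1, Fwd (NatR (Uni Bob) Fob) 0 1, Pull 3 1, Fwd (CouUni Bob) 0 2]"
      and ms' = "[Pull 3 1, Fwd (CouUni Bob) 0 1, Pull 3 1, Fwd (CouUni Bob) 0 2]"
      and ns' = "[]"])
    (simp add: assms, code_simp)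

text \<open>Restricted to \<open>B \<odot> F\<close>, the smash product is the action paired with
  the second leg of the comultiplication, and the counit of \<open>B\<close> removes that
  leg.\<close>

lemma law_valid_LinCou:
  assumes "law_valid BiCouMul" "law_valid (CouUni Fob)"
  shows "law_valid LinCou"
  by (rule law_valid_via_certificate[where hs = "[CouUni Fob]"
      and h = BiCouMul
      and p = "[(0, Uni Fob), (3, Uni Bob)]"
      and q = "[]"
      and ms = "[]"
      and ns = "[Pull 2 0, Pull 3 1, Pull 4 2, Pull 5 4, Fwd (LUnit Fob) 3 0, Fwd (RUnit Bob) 3 1, Pull 4 2,
          Bwd (NatR (Cou Bob) Fob) 1 1, Fwd (RCounit Bob) 0 0]"
      and ms' = "[Pull 5 2, Fwd (CouUni Bob) 1 3, Fwd (CouUni Fob) 0 0]"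
      and ns' = "[Pull 1 0]"])
    (simp add: assms, code_simp)

text \<open>Inputs \<open>F, F\<close> and outputs \<open>F, F\<close>. On the right there survive
  the coaction on a second leg, its crossing with a first leg of the other factor, and the action on
  that leg: together the pre-braiding.\<close>

lemma law_valid_Compat_F:
  assumes "law_valid BiCompat"
  shows "law_valid (Compat Fob)"
  by (rule law_valid_via_certificate[where hs = "[]"
      and h = BiCompat
      and p = "[(1, Uni Bob), (3, Uni Bob)]"
      and q = "[(1, Cou Bob), (2, Cou Bob)]"
      and ms = "[]"
      and ns = "[Pull 6 4, Pull 2 1, Pull 3 2, Fwd (RUnit Bob) 3 3, Pull 11 7, Fwd (RCounit Bob) 6 2,
          Fwd (CouMul Bob) 8 1, Pull 8 7, Fwd CoactCou 6 1, Fwd (ComUni Bob) 0 1, Pull 1 0, Pull 2 1,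
          Fwd ActUni 2 1, Fwd (NatR (Uni Bob) Fob) 0 1, Pull 1 0, Pull 2 1, Fwd (NatL Fob (Uni Bob)) 2 1,
          Fwd (CouUni Bob) 2 1]"
      and ms' = "[Pull 26 21, Fwd (CouMul Bob) 20 1, Fwd (CouMul Bob) 26 2, Pull 27 9, Fwd (RCounit Bob) 8 6, Pull 3 1,
          Fwd (ComUni Bob) 0 1, Pull 3 0, Pull 4 1, Pull 5 3, Fwd (NatL Fob (Uni Bob)) 2 2, Pull 5 3,
          Fwd (RUnit Bob) 2 1, Pull 4 3, Pull 5 4, Fwd (NatL Fob (Uni Bob)) 5 6, Fwd (RUnit Bob) 5 5, Pull 5 4,
          Pull 3 2, Fwd (NatR (Uni Bob) Fob) 3 3, Pull 4 3, Fwd (NatR (Uni Bob) Bob) 4 4, Pull 13 5,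
          Fwd (ComUni Bob) 4 5, Pull 14 6, Pull 5 4, Pull 6 5, Pull 15 7, Fwd ActUni 6 5,
          Fwd (NatR (Uni Bob) Fob) 4 5, Pull 14 5, Fwd (CouUni Bob) 4 6, Pull 11 6, Bwd (NatL Fob (Cou Bob)) 5 3,
          Pull 5 4, Fwd CoactCou 3 4, Pull 8 6, Bwd (NatR (Cou Bob) Fob) 5 2, Fwd (RCounit Bob) 4 1]"
      and ns' = "[Pull 2 1]"])
    (simp add: assms, code_simp)

text \<open>Inputs \<open>F, F\<close> and outputs \<open>B, F\<close>. The counit on the first
  output meets the product of \<open>F\<close> with an acted-on factor, hence the assumptions
  \<open>CouMul Fob\<close> and \<open>LinCou\<close>.\<close>

lemma law_valid_ColinMul:
  assumes "law_valid BiCompat" "law_valid (CouMul Fob)" "law_valid LinCou"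
  shows "law_valid ColinMul"
  by (rule law_valid_via_certificate[where hs = "[CouMul Fob, LinCou]"
      and h = BiCompat
      and p = "[(1, Uni Bob), (3, Uni Bob)]"
      and q = "[(0, Cou Fob), (2, Cou Bob)]"
      and ms = "[]"
      and ns = "[Pull 12 8, Fwd (LCounit Fob) 7 0, Pull 6 4, Pull 2 1, Pull 3 2, Fwd (RUnit Bob) 3 3, Pull 9 6,
          Fwd (RCounit Bob) 5 1, Fwd (ComUni Bob) 0 1, Pull 1 0, Pull 2 1, Fwd ActUni 2 1,
          Fwd (NatR (Uni Bob) Fob) 0 1, Pull 1 0, Pull 2 1, Fwd (NatL Fob (Uni Bob)) 2 1, Fwd (RUnit Bob) 2 0]"
      and ms' = "[Pull 26 20, Fwd (CouMul Fob) 19 0, Pull 19 3, Fwd (LCounit Fob) 2 0, Fwd LinCou 17 0, Pull 18 16,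
          Fwd (LCounit Bob) 15 0, Fwd (CouMul Bob) 22 2, Pull 23 8, Fwd (RCounit Bob) 7 5, Pull 2 1,
          Fwd (ComUni Bob) 0 1, Pull 3 0, Pull 4 2, Fwd (NatL Fob (Uni Bob)) 1 1, Pull 4 2, Fwd (RUnit Bob) 1 0,
          Pull 3 2, Pull 4 3, Fwd (NatL Fob (Uni Bob)) 4 5, Fwd (RUnit Bob) 4 4, Pull 4 3, Pull 2 1,
          Fwd (NatR (Uni Bob) Fob) 2 2, Pull 3 2, Fwd (NatR (Uni Bob) Bob) 3 3, Pull 9 4, Fwd (ComUni Bob) 3 4,
          Pull 10 5, Pull 4 3, Pull 5 4, Pull 11 6, Fwd ActUni 5 4, Fwd (NatR (Uni Bob) Fob) 3 4, Pull 10 4,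
          Fwd (CouUni Bob) 3 5, Bwd (NatL Bob (Cou Fob)) 5 0, Pull 5 4, Bwd (NatL Fob (Cou Fob)) 3 1, Pull 3 2,
          Fwd (LCounit Fob) 1 2]"
      and ns' = "[]"])
    (simp add: assms, code_simp)

text \<open>Inputs \<open>B, F\<close> and outputs \<open>F, F\<close>. The unit on the first input
  passes through the comultiplication of \<open>F\<close> and one coaction, hence the assumptions
  \<open>ComUni Fob\<close> and \<open>ColinUni\<close>.\<close>

lemma law_valid_LinCom:
  assumes "law_valid BiCompat" "law_valid (ComUni Fob)" "law_valid ColinUni"
  shows "law_valid LinCom"
  by (rule law_valid_via_certificate[where hs = "[ComUni Fob, ColinUni]"
      and h = BiCompat
      and p = "[(0, Uni Fob), (3, Uni Bob)]"
      and q = "[(1, Cou Bob), (2, Cou Bob)]"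
      and ms = "[]"
      and ns = "[Pull 2 0, Pull 3 1, Pull 4 2, Pull 5 4, Fwd (LUnit Fob) 3 0, Fwd (RUnit Bob) 3 1, Pull 9 5,
          Fwd (RCounit Bob) 4 2, Fwd (CouMul Bob) 6 1, Pull 6 5, Fwd CoactCou 4 1, Bwd (NatL Fob (Cou Bob)) 4 1,
          Pull 4 2, Bwd (NatR (Cou Bob) Fob) 1 1, Fwd (RCounit Bob) 0 0]"
      and ms' = "[Pull 2 1, Fwd (ComUni Fob) 0 0, Pull 16 7, Pull 4 2, Pull 1 0, Pull 2 1, Pull 4 2, Pull 5 3, Pull 6 4,
          Pull 7 5, Pull 17 16, Pull 15 14, Pull 13 9, Pull 8 6, Pull 9 7, Pull 14 8, Pull 16 9, Pull 18 10,
          Pull 19 12, Fwd (LUnit Fob) 11 0, Fwd ColinUni 0 0, Pull 2 0, Pull 2 1, Pull 3 2, Fwd (LUnit Bob) 3 0,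
          Pull 22 17, Fwd (CouMul Bob) 16 1, Fwd (CouMul Bob) 22 2, Pull 23 11, Fwd (RCounit Bob) 10 5,
          Fwd (NatR (Uni Fob) Bob) 1 0, Pull 3 1, Pull 4 2, Pull 5 4, Fwd (NatR (Uni Fob) Fob) 3 1, Pull 8 3,
          Pull 8 4, Pull 9 5, Pull 10 6, Pull 11 7, Pull 12 9, Fwd (NatR (Uni Fob) Bob) 8 2, Pull 14 8,
          Pull 15 9, Pull 16 10, Pull 17 12, Fwd (LUnit Fob) 11 3, Fwd (NatL Fob (Uni Bob)) 4 4,
          Fwd (RUnit Bob) 4 3, Pull 13 7, Bwd (NatR (Cou Bob) Fob) 6 4, Fwd (RCounit Bob) 5 3, Pull 9 8,
          Bwd (NatR (Cou Bob) Fob) 7 1, Fwd (RCounit Bob) 6 0, Pull 7 5, Bwd (NatL Bob (Cou Bob)) 4 2,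
          Fwd CoactCou 3 3, Pull 4 3]"
      and ns' = "[Pull 1 0]"])
    (simp add: assms, code_simp)

text \<open>Inputs \<open>B, F\<close> and outputs \<open>B, F\<close>. The unit needs the
  assumptions of the previous extraction. It also reduces the product on the first output to an
  action, so the counit there needs \<open>LinCou\<close>.\<close>

lemma law_valid_YD:
  assumes "law_valid BiCompat" "law_valid (ComUni Fob)" "law_valid ColinUni" "law_valid LinCou"
  shows "law_valid YD"
  by (rule law_valid_via_certificate[where hs = "[ComUni Fob, ColinUni, LinCou]"
      and h = BiCompat
      and p = "[(0, Uni Fob), (3, Uni Bob)]"
      and q = "[(0, Cou Fob), (2, Cou Bob)]"
      and ms = "[]"
      and ns = "[Pull 2 0, Pull 3 1, Pull 4 2, Pull 5 4, Fwd (LUnit Fob) 3 0, Pull 10 6, Fwd (LCounit Fob) 5 0,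
          Fwd (RUnit Bob) 3 1, Pull 7 4, Fwd (RCounit Bob) 3 1]"
      and ms' = "[Pull 2 1, Fwd (ComUni Fob) 0 0, Pull 16 7, Pull 4 2, Pull 1 0, Pull 2 1, Pull 4 2, Pull 5 3, Pull 6 4,
          Pull 7 5, Pull 17 16, Pull 15 14, Pull 13 9, Pull 8 6, Pull 9 7, Pull 14 8, Pull 16 9, Pull 18 10,
          Pull 19 12, Fwd (LUnit Fob) 11 0, Fwd ColinUni 0 0, Pull 2 0, Pull 2 1, Pull 3 2, Fwd (LUnit Bob) 3 0,
          Pull 22 9, Fwd LinCou 8 0, Pull 9 4, Fwd (LCounit Bob) 3 0, Fwd (CouMul Bob) 20 2, Pull 21 10,
          Fwd (RCounit Bob) 9 4, Fwd (NatR (Uni Fob) Bob) 1 0, Pull 2 1, Pull 3 2, Fwd (NatR (Uni Fob) Fob) 3 1,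
          Pull 7 3, Pull 7 4, Pull 8 5, Pull 9 6, Pull 10 7, Pull 11 9, Fwd (NatR (Uni Fob) Bob) 8 2, Pull 12 8,
          Pull 13 9, Pull 14 10, Pull 15 12, Fwd (LUnit Fob) 11 3, Fwd (NatL Fob (Uni Bob)) 4 4,
          Fwd (RUnit Bob) 4 3, Bwd (NatL Bob (Cou Fob)) 8 0, Pull 8 3, Bwd (NatL Bob (Cou Fob)) 2 1,
          Fwd (LCounit Fob) 1 2, Pull 7 5, Bwd (NatR (Cou Bob) Fob) 4 3, Fwd (RCounit Bob) 3 2, Pull 4 3]"
      and ns' = "[]"])
    (simp add: assms, code_simp)

theorem bialgebra_biproduct_iff_yd_bialgebra:
  "bialgebra C (biproduct C B F \<nu> \<delta>) \<longleftrightarrow> yd_bialgebra C B F \<nu> \<delta>"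
proof
  assume "yd_bialgebra C B F \<nu> \<delta>"
  then show "bialgebra C (biproduct C B F \<nu> \<delta>)"
    unfolding yd_bialgebra_iff bialgebra_biproduct_iff
    by (auto intro: law_valid_BiAssoc law_valid_BiLUnit law_valid_BiRUnit
        law_valid_BiCoassoc law_valid_BiLCounit law_valid_BiRCounit
        law_valid_BiCompat law_valid_BiCouMul law_valid_BiComUni law_valid_BiCouUni)
next
  assume "bialgebra C (biproduct C B F \<nu> \<delta>)"
  then have bi: "law_valid BiCompat" "law_valid BiCouMul" "law_valid BiComUni" "law_valid BiCouUni"
    unfolding bialgebra_biproduct_iff by blast+
  show "yd_bialgebra C B F \<nu> \<delta>"
    unfolding yd_bialgebra_iff
    using bi by (auto intro: law_valid_CouUni_F law_valid_ComUni_F law_valid_ColinUni law_valid_CouMul_F law_valid_LinCou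
        law_valid_Compat_F law_valid_ColinMul law_valid_LinCom law_valid_YD)
qed

end

theorem theorem5p3:
  fixes C :: "('o, 'm) braided_cat"
    and B F :: "('o, 'm) bialg"
    and \<nu> \<delta> :: 'm
  assumes "braided_monoidal_category C"
    and "bialgebra C B"
    and "module_algebra C B F \<nu>"
    and "comodule_coalgebra C B F \<delta>"
  shows "bialgebra C (biproduct C B F \<nu> \<delta>) \<longleftrightarrow> yd_bialgebra C B F \<nu> \<delta>"
proof -
  interpret braided_monoidal_category C by fact
  interpret biproduct_data C B F \<nu> \<delta> by unfold_locales fact+
  show ?thesis by (rule bialgebra_biproduct_iff_yd_bialgebra)
qed

end
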